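(* Let $X$ be a symmetric space on $[0,1]$ and let $w$ be a positive measurable function on $[0,1]$ such that $L_\infty\subset X(w)\subset L_1$. Then the projection $$Pf(t)=\sum_{k=1}^\infty c_k(f)\,r_k(t),\qquad c_k(f)=\int_0^1 f(u)r_k(u)\,du,$$ is bounded in $X(w)$ if and only if $G\subset X\subset G'$, $w\in\mathcal{M}(X)$ and $1/w\in\mathcal{M}(X')$. In particular, $P$ is bounded in $X(w)$ whenever $w^*(t)\log^{1/2}(e/t)\in X''$ and $(1/w)^*(t)\log^{1/2}(e/t)\in X'$.
   Context: All functions are (classes of) real measurable, a.e. finite functions on $[0,1]$; $m$ is Lebesgue measure; $L_p=L_p[0,1]$. The decreasing rearrangement $x^*$ of $x$ is the right-continuous inverse of $n_x(\tau)=m\{t:|x(t)|>\tau\}$. A Banach function lattice $E$ on $[0,1]$ is a Banach space of such functions such that $x\in E$, $|y|\le|x|$ imply $y\in E$, $\|y\|_E\le\|x\|_E$. Its Köthe dual $E'$ is the space of all $y$ with $\int_0^1|xy|\,dt<\infty$ for all $x\in E$, with norm $\|y\|_{E'}=\sup\{\int_0^1 xy\,dt:\|x\|_E\le1\}$; $E''=(E')'$. A symmetric space $X$ is a (nonzero) Banach space of such functions such that $y^*\le x^*$, $x\in X$ imply $y\in X$ and $\|y\|_X\le\|x\|_X$. Then $L_\infty\subset X\subset L_1$ continuously. Standing assumption: the natural inclusion of $X$ into $X''$ is isometric, i.e. $\|x\|_X=\|x\|_{X''}$ for $x\in X$. Weighted space: $X(w)=\{f: fw\in X\}$ with $\|f\|_{X(w)}=\|fw\|_X$.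 (Its Köthe dual is $X'(1/w)$.) $\mathrm{Exp}\,L^2$ is the Orlicz space $L_{N_2}$ on $[0,1]$ (Luxemburg norm), where $N_2$ is an Orlicz function equivalent to $\exp(t^2)-1$. $G$ is the closure of $L_\infty$ in $\mathrm{Exp}\,L^2$, and $G'$ is its Köthe dual. Rademacher functions: $r_k(t)=\mathrm{sign}\,\sin(2^k\pi t)$, $t\in[0,1]$, $k\ge1$. "$P$ is bounded in $E$" means: for every $f\in E$ the series $\sum_k c_k(f)r_k$ converges in $E$, and there is a constant $C$ with $\|Pf\|_E\le C\|f\|_E$ for all $f\in E$. Rademacher multiplicator space $\mathcal{M}(X)$ of a symmetric space $X$: all measurable $f:[0,1]\to\mathbb{R}$ such that $f\cdot\sum_{k=1}^\infty a_kr_k\in X$ for every Rademacher sum $\sum_{k=1}^\infty a_kr_k\in X$, with norm $\|f\|_{\mathcal{M}(X)}=\sup\{\|f\sum a_kr_k\|_X:\|\sum a_kr_k\|_X\le1\}$. *)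

theory Defs
  imports "HOL-Analysis.Analysis"
begin

section \<open>Normed spaces of measurable functions on the unit interval\<close>

text \<open>Functions have type \<^typ>\<open>real \<Rightarrow> real\<close>, but only their values on the unit interval, modulo
  equality a.e., matter: instead of forming classes, every space below is saturated under equality a.e.\<close>

abbreviation leb01 :: "real measure" where
  "leb01 \<equiv> lebesgue_on {0..1}"

record fspace =
  funs :: "(real \<Rightarrow> real) set"
  fnorm :: "(real \<Rightarrow> real) \<Rightarrow> real"

definition converges_in :: "fspace \<Rightarrow> (nat \<Rightarrow> real \<Rightarrow> real) \<Rightarrow> (real \<Rightarrow> real) \<Rightarrow> bool" where
  "converges_in E s g \<longleftrightarrow>
     (\<forall>n. s n \<in> funs E) \<and> g \<in> funs E \<and> (\<lambda>n. fnorm E (\<lambda>t. s n t - g t)) \<longlonglongrightarrow> 0"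

definition cauchy_in :: "fspace \<Rightarrow> (nat \<Rightarrow> real \<Rightarrow> real) \<Rightarrow> bool" where
  "cauchy_in E s \<longleftrightarrow>
     (\<forall>n. s n \<in> funs E) \<and>
     (\<forall>e>0. \<exists>N. \<forall>m\<ge>N. \<forall>n\<ge>N. fnorm E (\<lambda>t. s m t - s n t) < e)"

definition banach_function_space :: "fspace \<Rightarrow> bool" where
  "banach_function_space E \<longleftrightarrow>
     funs E \<subseteq> borel_measurable leb01 \<and>
     (\<forall>f\<in>funs E. \<forall>g\<in>borel_measurable leb01.
        (AE t in leb01. f t = g t) \<longrightarrow> g \<in> funs E \<and> fnorm E g = fnorm E f) \<and>
     (\<lambda>t. 0) \<in> funs E \<and>
     (\<forall>f\<in>funs E. \<forall>g\<in>funs E. (\<lambda>t. f t + g t) \<in> funs E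
        \<and> fnorm E (\<lambda>t. f t + g t) \<le> fnorm E f + fnorm E g) \<and>
     (\<forall>f\<in>funs E. \<forall>c. (\<lambda>t. c * f t) \<in> funs E \<and> fnorm E (\<lambda>t. c * f t) = \<bar>c\<bar> * fnorm E f) \<and>
     (\<forall>f\<in>funs E. 0 \<le> fnorm E f \<and> (fnorm E f = 0 \<longleftrightarrow> (AE t in leb01. f t = 0))) \<and>
     (\<forall>s. cauchy_in E s \<longrightarrow> (\<exists>g. converges_in E s g))"

definition L1 :: "(real \<Rightarrow> real) set" where
  "L1 = {f. integrable leb01 f}"

definition Linfty :: "(real \<Rightarrow> real) set" where
  "Linfty = {f \<in> borel_measurable leb01. \<exists>C. AE t in leb01. \<bar>f t\<bar> \<le> C}"

definition closure_in :: "fspace \<Rightarrow> (real \<Rightarrow> real) set \<Rightarrow> fspace" where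
  "closure_in E S =
     \<lparr>funs = {f \<in> funs E. \<forall>e>0. \<exists>g\<in>S \<inter> funs E. fnorm E (\<lambda>t. f t - g t) < e},
      fnorm = fnorm E\<rparr>"

text \<open>On Banach function lattices the suprema in \<open>kothe_dual\<close> and, below, in \<open>multiplicator\<close> are
  taken over bounded sets, so the real-valued \<^const>\<open>Sup\<close> is the genuine supremum there.\<close>

definition kothe_dual :: "fspace \<Rightarrow> fspace" where
  "kothe_dual E =
     \<lparr>funs = {y \<in> borel_measurable leb01. \<forall>x\<in>funs E. integrable leb01 (\<lambda>t. x t * y t)},
      fnorm = (\<lambda>y. SUP x\<in>{x \<in> funs E. fnorm E x \<le> 1}. LINT t|leb01. x t * y t)\<rparr>"

definition weighted :: "fspace \<Rightarrow> (real \<Rightarrow> real) \<Rightarrow> fspace" where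
  "weighted X w =
     \<lparr>funs = {f \<in> borel_measurable leb01. (\<lambda>t. f t * w t) \<in> funs X},
      fnorm = (\<lambda>f. fnorm X (\<lambda>t. f t * w t))\<rparr>"


section \<open>Symmetric spaces\<close>

definition distr_fun :: "(real \<Rightarrow> real) \<Rightarrow> real \<Rightarrow> real" where
  "distr_fun x \<tau> = measure leb01 {t \<in> {0..1}. \<bar>x t\<bar> > \<tau>}"

text \<open>The decreasing rearrangement; meaningful for \<open>t > 0\<close> only, since at \<open>t = 0\<close> an unbounded \<open>x\<close>
  would give the infimum of the empty set.\<close>

definition rearr :: "(real \<Rightarrow> real) \<Rightarrow> real \<Rightarrow> real" where
  "rearr x t = Inf {\<tau>. 0 \<le> \<tau> \<and> distr_fun x \<tau> \<le> t}"

definition symmetric_space :: "fspace \<Rightarrow> bool" where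
  "symmetric_space X \<longleftrightarrow>
     banach_function_space X \<and>
     (\<exists>x\<in>funs X. \<not> (AE t in leb01. x t = 0)) \<and>
     (\<forall>x\<in>funs X. \<forall>y\<in>borel_measurable leb01.
        (\<forall>t\<in>{0<..1}. rearr y t \<le> rearr x t) \<longrightarrow> y \<in> funs X \<and> fnorm X y \<le> fnorm X x)"

definition isometric_in_bidual :: "fspace \<Rightarrow> bool" where
  "isometric_in_bidual X \<longleftrightarrow>
     (\<forall>x\<in>funs X. x \<in> funs (kothe_dual (kothe_dual X)) \<and>
        fnorm (kothe_dual (kothe_dual X)) x = fnorm X x)"


section \<open>Orlicz spaces\<close>

definition orlicz_function :: "(real \<Rightarrow> real) \<Rightarrow> bool" where
  "orlicz_function N \<longleftrightarrow>
     convex_on {0..} N \<and> continuous_on {0..} N \<and> mono_on {0..} N \<and> N 0 = 0 \<and>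
     filterlim N at_top at_top"

text \<open>On a finite measure space only the behaviour of an Orlicz function at infinity matters.\<close>

definition orlicz_equivalent :: "(real \<Rightarrow> real) \<Rightarrow> (real \<Rightarrow> real) \<Rightarrow> bool" where
  "orlicz_equivalent M N \<longleftrightarrow>
     (\<exists>C>0. \<exists>t0\<ge>0. \<forall>t\<ge>t0. N (t / C) \<le> M t \<and> M t \<le> N (C * t))"

definition orlicz_space :: "(real \<Rightarrow> real) \<Rightarrow> fspace" where
  "orlicz_space N =
     \<lparr>funs = {f \<in> borel_measurable leb01.
                \<exists>l>0. (\<integral>\<^sup>+ t. ennreal (N (\<bar>f t\<bar> / l)) \<partial>leb01) \<le> 1},
      fnorm = (\<lambda>f. Inf {l. l > 0 \<and> (\<integral>\<^sup>+ t. ennreal (N (\<bar>f t\<bar> / l)) \<partial>leb01) \<le> 1})\<rparr>"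

definition G_space :: "(real \<Rightarrow> real) \<Rightarrow> fspace" where
  "G_space N2 = closure_in (orlicz_space N2) Linfty"


section \<open>Rademacher functions\<close>

definition rademacher :: "nat \<Rightarrow> real \<Rightarrow> real" where
  "rademacher k t = sgn (sin (2 ^ k * pi * t))"

definition rademacher_sums :: "(real \<Rightarrow> real) set" where
  "rademacher_sums = {g \<in> borel_measurable leb01.
     \<exists>a :: nat \<Rightarrow> real. AE t in leb01. (\<lambda>n. \<Sum>k=1..n. a k * rademacher k t) \<longlonglongrightarrow> g t}"

definition multiplicator :: "fspace \<Rightarrow> fspace" where
  "multiplicator X =
     \<lparr>funs = {f \<in> borel_measurable leb01.
                \<forall>g\<in>rademacher_sums \<inter> funs X. (\<lambda>t. f t * g t) \<in> funs X},
      fnorm = (\<lambda>f. SUP g\<in>{g \<in> rademacher_sums \<inter> funs X. fnorm X g \<le> 1}.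
                 fnorm X (\<lambda>t. f t * g t))\<rparr>"

definition rad_coeff :: "(real \<Rightarrow> real) \<Rightarrow> nat \<Rightarrow> real" where
  "rad_coeff f k = (LINT u|leb01. f u * rademacher k u)"

text \<open>\<open>g = P f\<close>, with the series converging in \<open>E\<close>; this determines \<open>g\<close> up to equality a.e.\<close>

definition is_rad_projection :: "fspace \<Rightarrow> (real \<Rightarrow> real) \<Rightarrow> (real \<Rightarrow> real) \<Rightarrow> bool" where
  "is_rad_projection E f g \<longleftrightarrow>
     converges_in E (\<lambda>n t. \<Sum>k=1..n. rad_coeff f k * rademacher k t) g"

definition rad_projection_bounded :: "fspace \<Rightarrow> bool" where
  "rad_projection_bounded E \<longleftrightarrow>
     (\<forall>f\<in>funs E. \<exists>g. is_rad_projection E f g) \<and>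
     (\<exists>C. \<forall>f\<in>funs E. \<forall>g. is_rad_projection E f g \<longrightarrow> fnorm E g \<le> C * fnorm E f)"

end

theory Submission
  imports Defs
begin

text \<open>Write \<open>R\<^sub>a = \<Sum>a\<^sub>kr\<^sub>k\<close>. By duality \<open>P\<close> is bounded in \<open>X(w)\<close> as soon as
  \<open>\<parallel>R\<^sub>a w\<parallel> \<le> C \<parallel>a\<parallel>\<close> in \<open>X\<close> and \<open>\<parallel>R\<^sub>a / w\<parallel> \<le> C \<parallel>a\<parallel>\<close> in \<open>X'\<close>, for finite \<open>a\<close> and
  the \<open>\<ell>\<^sub>2\<close> norm. These estimates also follow from boundedness of \<open>P\<close>: up to an error whose coefficients
  have norm at most \<open>\<parallel>a\<parallel> / 2\<close>, \<open>R\<^sub>a\<close> is the projection of a truncation \<open>f\<close> of \<open>R\<^sub>a\<close> with \<open>f w\<close> bounded; the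
  situation is symmetric under \<open>(X, w) \<leftrightarrow> (X', 1/w)\<close>. On a set where \<open>w \<ge> \<delta>\<close> a normalised block
  \<open>n\<^sup>-\<^sup>1\<^sup>/\<^sup>2(r\<^sub>j\<^sub>+\<^sub>1 + \<dots> + r\<^sub>j\<^sub>+\<^sub>n)\<close> far out is nearly independent of the set and has Gaussian tails, so the
  first estimate bounds \<open>\<integral> y\<^sup>*(t) log\<^sup>1\<^sup>/\<^sup>2(e/t) dt\<close> by \<open>C \<parallel>y\<parallel>\<close> for \<open>y\<close> in \<open>X'\<close>, which yields \<open>G \<subseteq> X\<close>; the
  second one yields \<open>X \<subseteq> G'\<close> in the same way. In the other direction \<open>R\<^sub>a\<close> lies in \<open>G\<close> for
  square-summable \<open>a\<close>, and uniform boundedness on \<open>\<ell>\<^sub>2\<close> turns the multiplicator conditions into the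
  two estimates. The last claim uses \<open>R\<^sub>a\<^sup>*(t) \<le> C \<parallel>a\<parallel> log\<^sup>1\<^sup>/\<^sup>2(e/t)\<close>.\<close>

section \<open>Rearrangements\<close>

text \<open>\<open>X\<close> embeds isometrically in its bidual but may be smaller. A bound on all
  pairings with \<open>X'\<close> therefore only places a function in the bidual; approximation by
  bounded functions brings it back into \<open>X\<close>, and this is why \<open>G\<close>, a
  closure of \<open>Linfty\<close>, occurs. Membership in \<open>X'\<close> is always tested by
  integrability against \<open>X\<close>, so norm limits are taken in \<open>X\<close> alone.
  Exchanging the two sides requires \<open>X'\<close> to be rearrangement invariant as well; this
  rests on the attained form of the Hardy-Littlewood inequality, for which the ranking functions are
  built. The error of the truncation can be absorbed because some constant depending on the number
  of terms exists trivially, and each round halves it up to a summand free of that number. The tails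
  on a fixed set have a poor constant 3/2 in the exponent, but this changes log^(1/2)(e/t) only by a
  factor, so exponential moments are precise enough. Finally, a Rademacher series that converges
  a.e. has square-summable coefficients, which links the multiplicator spaces with the l2
  estimates.\<close>

interpretation leb01: finite_measure leb01
  by (rule finite_measure_lebesgue_on) simp

lemma space_leb01 [simp]: "space leb01 = {0..1}"
  by (simp add: space_restrict_space)

lemma sets_leb01_iff: "A \<in> sets leb01 \<longleftrightarrow> A \<in> sets lebesgue \<and> A \<subseteq> {0..1}"
  by (auto simp: sets_restrict_space_iff)

lemma sets_leb01_borel: "A \<in> sets borel \<Longrightarrow> A \<subseteq> {0..1} \<Longrightarrow> A \<in> sets leb01"
  by (auto simp: sets_leb01_iff)

lemma measure_leb01: "A \<in> sets leb01 \<Longrightarrow> measure leb01 A = measure lebesgue A"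
  by (subst measure_restrict_space) (auto simp: sets_leb01_iff)

lemma measure_leb01_le_1: "measure leb01 A \<le> 1"
proof -
  have "measure leb01 (space leb01) = 1"
    by (subst measure_leb01) (auto simp: sets_leb01_iff)
  then show ?thesis using leb01.bounded_measure[of A] by simp
qed

lemma measure_leb01_Icc: "0 \<le> a \<Longrightarrow> a \<le> b \<Longrightarrow> b \<le> 1 \<Longrightarrow> measure leb01 {a..b} = b - a"
  by (subst measure_leb01) (auto simp: sets_leb01_iff)

lemma measure_leb01_UNIV [simp]: "measure leb01 {0..1} = 1"
  by (simp add: measure_leb01_Icc)

lemma emeasure_leb01_UNIV [simp]: "emeasure leb01 {0..1} = 1"
  by (simp add: leb01.emeasure_eq_measure measure_leb01_UNIV)

lemma measure_leb01_Ioo: "0 \<le> a \<Longrightarrow> a \<le> b \<Longrightarrow> b \<le> 1 \<Longrightarrow> measure leb01 {a<..<b} = b - a"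
  by (subst measure_leb01) (auto simp: sets_leb01_iff)

lemma AE_leb01_pos: "AE t in leb01. 0 < t \<and> t \<le> 1"
proof -
  have "{0::real} \<in> null_sets leb01"
    using measure_leb01_Icc[of 0 0] by (simp add: null_sets_def leb01.emeasure_eq_measure sets_leb01_iff)
  from AE_not_in[OF this] show ?thesis
    using AE_space[of leb01] by eventually_elim auto
qed

lemma not_AE_leb01_False: "\<not> (AE t in leb01. False)"
proof
  assume "AE t in leb01. False"
  moreover have "{t \<in> space leb01. \<not> False} = space leb01" by blast
  ultimately have "emeasure leb01 (space leb01) = 0"
    using AE_iff_measurable[OF sets.top[of leb01], of "\<lambda>_. False"] by blast
  then show False by simp
qed

lemma borel_measurable_leb01: "f \<in> borel_measurable borel \<Longrightarrow> f \<in> borel_measurable leb01"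
  by (simp add: borel_measurable_if_D measurable_completion measurable_restrict_space1)

lemma distr_set_sets:
  fixes x :: "real \<Rightarrow> real"
  assumes [measurable]: "x \<in> borel_measurable leb01"
  shows "{t \<in> {0..1}. \<bar>x t\<bar> > \<tau>} \<in> sets leb01"
proof -
  have "(\<lambda>t. \<bar>x t\<bar>) \<in> borel_measurable leb01" by measurable
  then show ?thesis by (simp add: borel_measurable_iff_greater)
qed

lemma distr_fun_nonneg [simp]: "0 \<le> distr_fun x \<tau>"
  by (simp add: distr_fun_def)

lemma distr_fun_le_1: "distr_fun x \<tau> \<le> 1"
  by (simp add: distr_fun_def measure_leb01_le_1)

lemma distr_fun_antimono:
  assumes "x \<in> borel_measurable leb01" "\<tau> \<le> \<tau>'"
  shows "distr_fun x \<tau>' \<le> distr_fun x \<tau>"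
  unfolding distr_fun_def using assms(2)
  by (intro leb01.finite_measure_mono distr_set_sets assms) auto

text \<open>The sets where |x| exceeds \<tau> + 1/(n+1) increase to the set where it exceeds \<tau>.
  This is what makes the infimum in \<open>rearr\<close> attained.\<close>

lemma distr_fun_right_continuous:
  assumes x: "x \<in> borel_measurable leb01" and "t < distr_fun x \<tau>"
  shows "\<exists>\<tau>'>\<tau>. t < distr_fun x \<tau>'"
proof -
  let ?A = "\<lambda>n. {s \<in> {0..1}. \<bar>x s\<bar> > \<tau> + 1 / real (Suc n)}"
  have "incseq ?A"
    by (rule incseq_SucI) (auto elim!: order.strict_trans1[rotated] intro!: divide_left_mono)
  moreover have "(\<Union>n. ?A n) = {s \<in> {0..1}. \<bar>x s\<bar> > \<tau>}"
  proof (intro equalityI subsetI)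
    fix s assume s: "s \<in> {s \<in> {0..1}. \<bar>x s\<bar> > \<tau>}"
    then obtain n where "1 / real (Suc n) < \<bar>x s\<bar> - \<tau>"
      using nat_approx_posE[of "\<bar>x s\<bar> - \<tau>"] by auto
    then show "s \<in> (\<Union>n. ?A n)" using s by (auto intro!: exI[of _ n])
  next
    fix s assume "s \<in> (\<Union>n. ?A n)"
    then obtain n where n: "s \<in> {0..1}" "\<bar>x s\<bar> > \<tau> + 1 / real (Suc n)" by auto
    have "1 / real (Suc n) > 0" by simp
    with n have "\<bar>x s\<bar> > \<tau>" by linarith
    then show "s \<in> {s \<in> {0..1}. \<bar>x s\<bar> > \<tau>}" using n by blast
  qed
  ultimately have "(\<lambda>n. measure leb01 (?A n)) \<longlonglongrightarrow> distr_fun x \<tau>"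
    unfolding distr_fun_def
    using leb01.finite_Lim_measure_incseq[of ?A] distr_set_sets[OF x] by auto
  then have "eventually (\<lambda>n. t < measure leb01 (?A n)) sequentially"
    using assms(2) by (rule order_tendstoD)
  then obtain n where "t < measure leb01 (?A n)"
    by (auto simp: eventually_sequentially)
  then show ?thesis
    by (intro exI[of _ "\<tau> + 1 / real (Suc n)"]) (auto simp: distr_fun_def)
qed

text \<open>Functions are real-valued, so the level sets decrease to the empty set, and the measure
  is finite. Hence the infimum in \<open>rearr x t\<close> ranges over a nonempty set for every t >
  0.\<close>

lemma distr_fun_tendsto_0:
  assumes x: "x \<in> borel_measurable leb01" and "t > 0"
  shows "\<exists>\<tau>\<ge>0. distr_fun x \<tau> \<le> t"
proof -
  let ?A = "\<lambda>n. {s \<in> {0..1}. \<bar>x s\<bar> > real n}"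
  have "decseq ?A" by (rule decseq_SucI) auto
  moreover have "(\<Inter>n. ?A n) = {}"
  proof -
    have "\<exists>n. \<not> \<bar>x s\<bar> > real n" for s
      using reals_Archimedean2[of "\<bar>x s\<bar>"] by (auto simp: not_less intro: less_imp_le)
    then show ?thesis by blast
  qed
  ultimately have "(\<lambda>n. measure leb01 (?A n)) \<longlonglongrightarrow> 0"
    using leb01.finite_Lim_measure_decseq[of ?A] distr_set_sets[OF x] by auto
  then have "eventually (\<lambda>n. measure leb01 (?A n) < t) sequentially"
    using assms(2) by (rule order_tendstoD)
  then obtain n where "measure leb01 (?A n) < t"
    by (auto simp: eventually_sequentially)
  then show ?thesis
    by (intro exI[of _ "real n"]) (auto simp: distr_fun_def)
qed

lemma rearr_le:
  assumes "0 \<le> \<tau>" "distr_fun x \<tau> \<le> t"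
  shows "rearr x t \<le> \<tau>"
  unfolding rearr_def using assms by (intro cInf_lower) (auto simp: bdd_below_def)

lemma rearr_ge:
  assumes "x \<in> borel_measurable leb01" "t > 0" "\<And>\<tau>. 0 \<le> \<tau> \<Longrightarrow> distr_fun x \<tau> \<le> t \<Longrightarrow> c \<le> \<tau>"
  shows "c \<le> rearr x t"
  unfolding rearr_def
  using distr_fun_tendsto_0[OF assms(1,2)] by (intro cInf_greatest) (auto intro: assms(3))

lemma rearr_nonneg: "x \<in> borel_measurable leb01 \<Longrightarrow> t > 0 \<Longrightarrow> 0 \<le> rearr x t"
  by (rule rearr_ge)

text \<open>The Galois connection between a distribution function and its generalised inverse. The
  strict form depends on right continuity; comparisons of rearrangements are reduced to comparisons
  of distribution functions by it.\<close>

lemma rearr_gt_iff: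
  assumes x: "x \<in> borel_measurable leb01" and "t > 0" "\<tau> \<ge> 0"
  shows "\<tau> < rearr x t \<longleftrightarrow> t < distr_fun x \<tau>"
proof
  assume "\<tau> < rearr x t"
  then show "t < distr_fun x \<tau>" using rearr_le[OF assms(3), of x t] by linarith
next
  assume "t < distr_fun x \<tau>"
  then obtain \<tau>' where "\<tau>' > \<tau>" "t < distr_fun x \<tau>'"
    using distr_fun_right_continuous[OF x] by blast
  moreover from this have "\<tau>' \<le> rearr x t"
    using distr_fun_antimono[OF x] by (intro rearr_ge[OF x \<open>t > 0\<close>]) (metis linorder_not_le nle_le order_trans)
  ultimately show "\<tau> < rearr x t" by linarith
qed

lemma distr_fun_rearr_le:
  assumes "x \<in> borel_measurable leb01" "t > 0"
  shows "distr_fun x (rearr x t) \<le> t"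
  using rearr_gt_iff[OF assms rearr_nonneg[OF assms]] by simp

lemma rearr_mono_distr:
  assumes "x \<in> borel_measurable leb01" "\<And>\<tau>. 0 \<le> \<tau> \<Longrightarrow> distr_fun y \<tau> \<le> distr_fun x \<tau>" "t > 0"
  shows "rearr y t \<le> rearr x t"
  using assms by (intro rearr_ge rearr_le) (auto intro: order_trans)

lemma distr_fun_mono:
  assumes "x \<in> borel_measurable leb01"  "AE t in leb01. \<bar>y t\<bar> \<le> \<bar>x t\<bar>" "y \<in> borel_measurable leb01"
  shows "distr_fun y \<tau> \<le> distr_fun x \<tau>"
  unfolding distr_fun_def using assms
  by (intro leb01.finite_measure_mono_AE distr_set_sets) (auto elim!: eventually_mono)

lemma rearr_mono_AE:
  assumes "x \<in> borel_measurable leb01" "y \<in> borel_measurable leb01"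
    "AE t in leb01. \<bar>y t\<bar> \<le> \<bar>x t\<bar>" "t > 0"
  shows "rearr y t \<le> rearr x t"
  using assms by (intro rearr_mono_distr distr_fun_mono)

lemma rearr_measurable [measurable (raw)]:
  assumes x: "x \<in> borel_measurable leb01"
  shows "rearr x \<in> borel_measurable leb01"
proof (rule borel_measurableI_greater)
  fix \<tau> :: real
  let ?S = "{t \<in> space leb01. \<tau> < rearr x t}"
  \<comment> \<open>Superlevel sets are intervals only as far as t > 0 is concerned. The value at 0
    is arbitrary, hence the two candidates at the end, with and without the point 0.\<close>
  define I where "I = (if \<tau> < 0 then {0<..1} else {0<..<distr_fun x \<tau>})"
  have "t \<in> ?S \<longleftrightarrow> t \<in> I" if "t > 0" for t
  proof (cases "\<tau> < 0")
    case True
    then show ?thesis using rearr_nonneg[OF x that] that by (auto simp: I_def)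
  next
    case False
    then show ?thesis using rearr_gt_iff[OF x that, of \<tau>] that distr_fun_le_1[of x \<tau>]
      by (auto simp: I_def)
  qed
  note iff = this
  have "?S - {0} = I"
  proof (rule set_eqI)
    fix t
    show "t \<in> ?S - {0} \<longleftrightarrow> t \<in> I"
      by (cases "t > 0") (simp_all only: Diff_iff iff, auto simp: I_def)
  qed
  then have "?S = I \<or> ?S = insert 0 I" by blast
  moreover have "I \<in> sets leb01" "insert 0 I \<in> sets leb01"
    using distr_fun_le_1[of x \<tau>] by (auto simp: I_def intro!: sets_leb01_borel)
  ultimately show "?S \<in> sets leb01" by auto
qed

lemma distr_fun_rearr:
  assumes x: "x \<in> borel_measurable leb01" and "\<tau> \<ge> 0"
  shows "distr_fun (rearr x) \<tau> = distr_fun x \<tau>"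
proof -
  have [measurable]: "rearr x \<in> borel_measurable leb01" by (rule rearr_measurable[OF x])
  have "distr_fun (rearr x) \<tau> = measure leb01 {0<..<distr_fun x \<tau>}"
    unfolding distr_fun_def[of "rearr x"]
  proof (rule leb01.finite_measure_eq_AE)
    show "AE t in leb01. (t \<in> {t \<in> {0..1}. \<tau> < \<bar>rearr x t\<bar>}) = (t \<in> {0<..<distr_fun x \<tau>})"
      using AE_leb01_pos
    proof eventually_elim
      case (elim t)
      then show ?case using rearr_gt_iff[OF x, of t \<tau>] rearr_nonneg[OF x, of t] assms(2) by auto
    qed
    show "{t \<in> {0..1}. \<tau> < \<bar>rearr x t\<bar>} \<in> sets leb01" by (rule distr_set_sets) simp
    show "{0<..<distr_fun x \<tau>} \<in> sets leb01"
      using distr_fun_le_1[of x \<tau>] by (intro sets_leb01_borel) auto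
  qed
  also have "\<dots> = distr_fun x \<tau>" by (simp add: measure_leb01_Ioo distr_fun_le_1)
  finally show ?thesis .
qed

lemma rearr_rearr:
  assumes x: "x \<in> borel_measurable leb01" and "t > 0"
  shows "rearr (rearr x) t = rearr x t"
  by (intro antisym rearr_mono_distr rearr_measurable x assms(2)) (auto simp: distr_fun_rearr[OF x])

section \<open>Layer-cake formula and Hardy-Littlewood inequalities\<close>

lemma ennreal_layer_cake:
  assumes "c \<ge> 0"
  shows "ennreal c = (\<integral>\<^sup>+\<tau>. indicator {0..} \<tau> * indicator {..<c} \<tau> \<partial>lborel)"
proof -
  have "(\<integral>\<^sup>+\<tau>. indicator {0..} \<tau> * indicator {..<c} \<tau> \<partial>lborel) = (\<integral>\<^sup>+\<tau>. indicator {0..<c} \<tau> \<partial>lborel)"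
    by (intro nn_integral_cong) (auto split: split_indicator)
  then show ?thesis using assms by simp
qed

text \<open>One step of the Hardy--Littlewood inequality; iterating it from \<open>\<phi> = \<Phi> = 1\<close> handles
  products of any number of functions.\<close>

lemma rearr_dominated_step:
  fixes \<phi> \<Phi> :: "real \<Rightarrow> ennreal"
  assumes [measurable]: "\<phi> \<in> borel_measurable leb01" "\<Phi> \<in> borel_measurable leb01"
    and f [measurable]: "f \<in> borel_measurable leb01"
    and dom: "\<And>A. A \<in> sets leb01 \<Longrightarrow>
      (\<integral>\<^sup>+t. \<phi> t * indicator A t \<partial>leb01) \<le> (\<integral>\<^sup>+t. \<Phi> t * indicator {0<..<measure leb01 A} t \<partial>leb01)"
    and A [measurable]: "A \<in> sets leb01"
  shows "(\<integral>\<^sup>+t. ennreal \<bar>f t\<bar> * \<phi> t * indicator A t \<partial>leb01)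
    \<le> (\<integral>\<^sup>+t. ennreal (rearr f t) * \<Phi> t * indicator {0<..<measure leb01 A} t \<partial>leb01)"
proof -
  interpret pair_sigma_finite leb01 lborel
    by (intro pair_sigma_finite.intro sigma_finite_lborel leb01.sigma_finite_measure_axioms)
  let ?I = "{0<..<measure leb01 A}"
  have I [measurable]: "?I \<in> sets leb01"
    using measure_leb01_le_1[of A] by (intro sets_leb01_borel) auto
  have rf [measurable]: "rearr f \<in> borel_measurable leb01" by (rule rearr_measurable[OF f])
  \<comment> \<open>|f| is the integral over the levels \<tau> \<ge> 0 of the indicator of \<tau> <
    |f|. After the exchange of integrals a single level set of f remains, and to it the hypothesis
    on \<open>\<phi>\<close> applies.\<close>
  have "(\<integral>\<^sup>+t. ennreal \<bar>f t\<bar> * \<phi> t * indicator A t \<partial>leb01) =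
     (\<integral>\<^sup>+t. (\<integral>\<^sup>+\<tau>. indicator {0..} \<tau> * indicator {..<\<bar>f t\<bar>} \<tau> * (\<phi> t * indicator A t) \<partial>lborel) \<partial>leb01)"
    by (intro nn_integral_cong, subst nn_integral_multc, measurable)
       (simp add: ennreal_layer_cake mult.assoc)
  also have "\<dots> = (\<integral>\<^sup>+\<tau>. (\<integral>\<^sup>+t. indicator {0..} \<tau> * indicator {..<\<bar>f t\<bar>} \<tau> * (\<phi> t * indicator A t) \<partial>leb01) \<partial>lborel)"
    by (rule Fubini'[symmetric]) (simp add: indicator_def[of "{..<_}"], measurable)
  also have "\<dots> \<le> (\<integral>\<^sup>+\<tau>. (\<integral>\<^sup>+t. indicator {0..} \<tau> * indicator {..<rearr f t} \<tau> * (\<Phi> t * indicator ?I t) \<partial>leb01) \<partial>lborel)"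
  proof (rule nn_integral_mono)
    fix \<tau> :: real
    show "(\<integral>\<^sup>+t. indicator {0..} \<tau> * indicator {..<\<bar>f t\<bar>} \<tau> * (\<phi> t * indicator A t) \<partial>leb01)
      \<le> (\<integral>\<^sup>+t. indicator {0..} \<tau> * indicator {..<rearr f t} \<tau> * (\<Phi> t * indicator ?I t) \<partial>leb01)"
    proof (cases "\<tau> \<ge> 0")
      case True
      \<comment> \<open>The measure of this set is at most \<open>measure leb01 A\<close> and at
        most \<open>distr_fun f \<tau>\<close>. So the initial interval produced by
        \<open>dom\<close> lies inside the one belonging to A and inside the region where
        \<open>rearr f\<close> exceeds \<tau>.\<close>
      let ?B = "A \<inter> {t \<in> {0..1}. \<tau> < \<bar>f t\<bar>}"
      have B: "?B \<in> sets leb01" using A distr_set_sets[OF f] by blast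
      have "(\<integral>\<^sup>+t. indicator {0..} \<tau> * indicator {..<\<bar>f t\<bar>} \<tau> * (\<phi> t * indicator A t) \<partial>leb01)
         = (\<integral>\<^sup>+t. \<phi> t * indicator ?B t \<partial>leb01)"
        using True by (intro nn_integral_cong) (auto split: split_indicator)
      also have "\<dots> \<le> (\<integral>\<^sup>+t. \<Phi> t * indicator {0<..<measure leb01 ?B} t \<partial>leb01)"
        by (rule dom[OF B])
      also have "\<dots> \<le> (\<integral>\<^sup>+t. indicator {0..} \<tau> * indicator {..<rearr f t} \<tau> * (\<Phi> t * indicator ?I t) \<partial>leb01)"
      proof (rule nn_integral_mono)
        fix t
        have "measure leb01 ?B \<le> measure leb01 A" "measure leb01 ?B \<le> distr_fun f \<tau>"
          unfolding distr_fun_def by (intro leb01.finite_measure_mono A distr_set_sets f; blast)+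
        then show "\<Phi> t * indicator {0<..<measure leb01 ?B} t
           \<le> indicator {0..} \<tau> * indicator {..<rearr f t} \<tau> * (\<Phi> t * indicator ?I t)"
          using True rearr_gt_iff[OF f _ True, of t] by (auto split: split_indicator)
      qed
      finally show ?thesis .
    qed simp
  qed
  also have "\<dots> = (\<integral>\<^sup>+t. (\<integral>\<^sup>+\<tau>. indicator {0..} \<tau> * indicator {..<rearr f t} \<tau> * (\<Phi> t * indicator ?I t) \<partial>lborel) \<partial>leb01)"
    by (rule Fubini') (simp add: indicator_def[of "{..<_}"], measurable)
  also have "\<dots> = (\<integral>\<^sup>+t. ennreal (rearr f t) * \<Phi> t * indicator ?I t \<partial>leb01)"
  proof (rule nn_integral_cong)
    fix t
    show "(\<integral>\<^sup>+\<tau>. indicator {0..} \<tau> * indicator {..<rearr f t} \<tau> * (\<Phi> t * indicator ?I t) \<partial>lborel)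
       = ennreal (rearr f t) * \<Phi> t * indicator ?I t"
    proof (cases "t > 0")
      case True
      then show ?thesis
        by (subst nn_integral_multc, measurable)
           (simp add: ennreal_layer_cake[OF rearr_nonneg[OF f True]] mult.assoc)
    qed simp
  qed
  finally show ?thesis .
qed

lemma rearr_dominated_one:
  assumes "A \<in> sets leb01"
  shows "(\<integral>\<^sup>+t. 1 * indicator A t \<partial>leb01) \<le> (\<integral>\<^sup>+t. 1 * indicator {0<..<measure leb01 A} t \<partial>leb01)"
proof -
  have "{0<..<measure leb01 A} \<in> sets leb01"
    using measure_leb01_le_1[of A] by (intro sets_leb01_borel) auto
  then show ?thesis
    using assms measure_leb01_le_1[of A] by (simp add: leb01.emeasure_eq_measure measure_leb01_Ioo)
qed

lemma nn_integral_rearr_Ioo: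
  assumes "f \<in> borel_measurable leb01"
  shows "(\<integral>\<^sup>+t. f t * indicator {0<..<measure leb01 {0..1}} t \<partial>leb01) \<le> (\<integral>\<^sup>+t. f t \<partial>leb01)"
  by (rule nn_integral_mono) (auto split: split_indicator)

lemma Hardy_Littlewood:
  assumes f [measurable]: "f \<in> borel_measurable leb01" and g [measurable]: "g \<in> borel_measurable leb01"
  shows "(\<integral>\<^sup>+t. ennreal \<bar>f t * g t\<bar> \<partial>leb01) \<le> (\<integral>\<^sup>+t. ennreal (rearr f t * rearr g t) \<partial>leb01)"
proof -
  note [measurable] = rearr_measurable[OF f] rearr_measurable[OF g]
  note s1 = rearr_dominated_step[where \<phi> = "\<lambda>_. 1" and \<Phi> = "\<lambda>_. 1", OF _ _ g rearr_dominated_one]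
  note s2 = rearr_dominated_step[OF _ _ f s1]
  have *: "{0..1::real} \<in> sets leb01" using sets.top[of leb01] by simp
  have "(\<integral>\<^sup>+t. ennreal \<bar>f t * g t\<bar> \<partial>leb01)
    = (\<integral>\<^sup>+t. ennreal \<bar>f t\<bar> * (ennreal \<bar>g t\<bar> * 1) * indicator {0..1} t \<partial>leb01)"
    by (intro nn_integral_cong) (auto simp: abs_mult ennreal_mult)
  also have "\<dots> \<le> (\<integral>\<^sup>+t. ennreal (rearr f t) * (ennreal (rearr g t) * 1) * indicator {0<..<measure leb01 {0..1}} t \<partial>leb01)"
    by (rule s2) (simp_all add: * )
  also have "\<dots> \<le> (\<integral>\<^sup>+t. ennreal (rearr f t) * (ennreal (rearr g t) * 1) \<partial>leb01)"
    by (rule nn_integral_rearr_Ioo) simp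
  also have "\<dots> = (\<integral>\<^sup>+t. ennreal (rearr f t * rearr g t) \<partial>leb01)"
    using AE_leb01_pos
    by (intro nn_integral_cong_AE) (auto elim!: eventually_mono simp: ennreal_mult rearr_nonneg f g)
  finally show ?thesis .
qed

lemma Hardy_Littlewood_3:
  assumes f [measurable]: "f \<in> borel_measurable leb01" and g [measurable]: "g \<in> borel_measurable leb01"
    and h [measurable]: "h \<in> borel_measurable leb01"
  shows "(\<integral>\<^sup>+t. ennreal \<bar>f t * g t * h t\<bar> \<partial>leb01) \<le> (\<integral>\<^sup>+t. ennreal (rearr f t * rearr g t * rearr h t) \<partial>leb01)"
proof -
  note [measurable] = rearr_measurable[OF f] rearr_measurable[OF g] rearr_measurable[OF h]
  note s1 = rearr_dominated_step[where \<phi> = "\<lambda>_. 1" and \<Phi> = "\<lambda>_. 1", OF _ _ h rearr_dominated_one]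
  note s2 = rearr_dominated_step[OF _ _ g s1]
  note s3 = rearr_dominated_step[OF _ _ f s2]
  have *: "{0..1::real} \<in> sets leb01" using sets.top[of leb01] by simp
  have "(\<integral>\<^sup>+t. ennreal \<bar>f t * g t * h t\<bar> \<partial>leb01)
    = (\<integral>\<^sup>+t. ennreal \<bar>f t\<bar> * (ennreal \<bar>g t\<bar> * (ennreal \<bar>h t\<bar> * 1)) * indicator {0..1} t \<partial>leb01)"
    by (intro nn_integral_cong) (auto simp: abs_mult ennreal_mult mult.assoc)
  also have "\<dots> \<le> (\<integral>\<^sup>+t. ennreal (rearr f t) * (ennreal (rearr g t) * (ennreal (rearr h t) * 1))
      * indicator {0<..<measure leb01 {0..1}} t \<partial>leb01)"
    by (rule s3) (simp_all add: * )
  also have "\<dots> \<le> (\<integral>\<^sup>+t. ennreal (rearr f t) * (ennreal (rearr g t) * (ennreal (rearr h t) * 1)) \<partial>leb01)"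
    by (rule nn_integral_rearr_Ioo) simp
  also have "\<dots> = (\<integral>\<^sup>+t. ennreal (rearr f t * rearr g t * rearr h t) \<partial>leb01)"
    using AE_leb01_pos
    by (intro nn_integral_cong_AE)
       (auto elim!: eventually_mono simp: ennreal_mult rearr_nonneg f g h mult.assoc)
  finally show ?thesis .
qed

section \<open>Rank functions and equality in the Hardy-Littlewood inequality\<close>

lemma null_sets_leb01_subset:
  assumes "N \<in> null_sets leb01" "A \<subseteq> N"
  shows "A \<in> sets leb01"
proof -
  have "negligible N" "N \<subseteq> {0..1}"
    using assms(1) by (auto simp: negligible_iff_null_sets null_sets_restrict_space)
  then have "negligible A" "A \<subseteq> {0..1}"
    using assms(2) negligible_subset by blast+
  then show ?thesis
    by (auto simp: sets_leb01_iff negligible_imp_sets)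
qed

text \<open>\<open>\<rho> t\<close> is the rank of \<open>t\<close> when \<open>[0,1]\<close> is sorted by decreasing \<open>\<bar>y\<bar>\<close>, ties being broken by \<open>t\<close> itself.\<close>

lemma ranking_map:
  assumes y: "y \<in> borel_measurable leb01"
  obtains \<rho> where "\<rho> \<in> borel_measurable leb01"
    "\<And>u. 0 \<le> u \<Longrightarrow> u \<le> 1 \<Longrightarrow> measure leb01 {t \<in> {0..1}. \<rho> t < u} = u"
    "\<And>t. distr_fun y \<bar>y t\<bar> \<le> \<rho> t"
proof -
  define E where "E \<tau> = {s \<in> {0..1}. \<bar>y s\<bar> = \<tau>}" for \<tau>
  \<comment> \<open>The measure of the ties at level \<tau> up to the place t. It is nondecreasing
    and 1-Lipschitz in t, so the intermediate value theorem can cut a tie set at any prescribed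
    proportion.\<close>
  define \<phi> where "\<phi> \<tau> t = measure leb01 (E \<tau> \<inter> {..t})" for \<tau> t
  define \<rho> where "\<rho> t = distr_fun y \<bar>y t\<bar> + \<phi> \<bar>y t\<bar> t" for t
  have E: "E \<tau> \<in> sets leb01" for \<tau>
  proof -
    have "(\<lambda>t. \<bar>y t\<bar>) \<in> borel_measurable leb01" using y by measurable
    from measurable_sets[OF this, of "{\<tau>}"] show ?thesis
      by (simp add: E_def vimage_def Int_def conj_commute)
  qed
  have Ic: "E \<tau> \<inter> {..t} \<in> sets leb01" for \<tau> t
    using E[of \<tau>] by (auto simp: sets_leb01_iff)
  have \<phi>_mono: "\<phi> \<tau> s \<le> \<phi> \<tau> t" if "s \<le> t" for \<tau> s t
    unfolding \<phi>_def using that by (intro leb01.finite_measure_mono Ic) auto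
  have \<phi>_lip: "\<phi> \<tau> t - \<phi> \<tau> s \<le> t - s" if "0 \<le> s" "s \<le> t" "t \<le> 1" for \<tau> s t
  proof -
    have "\<phi> \<tau> t \<le> measure leb01 ((E \<tau> \<inter> {..s}) \<union> {s..t})"
      unfolding \<phi>_def using that Ic
      by (intro leb01.finite_measure_mono sets.Un sets_leb01_borel[of "{s..t}"]) auto
    also have "\<dots> \<le> \<phi> \<tau> s + measure leb01 {s..t}"
      unfolding \<phi>_def using that by (intro measure_Un_le Ic sets_leb01_borel) auto
    finally show ?thesis using that by (simp add: measure_leb01_Icc)
  qed
  have \<phi>_cont: "continuous_on {0..1} (\<phi> \<tau>)" for \<tau>
  proof (rule continuous_onI)
    fix s e :: real assume s: "s \<in> {0..1}" and e: "0 < e"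
    have "dist (\<phi> \<tau> t) (\<phi> \<tau> s) \<le> dist t s" if "t \<in> {0..1}" for t
      using that s \<phi>_mono[of s t \<tau>] \<phi>_mono[of t s \<tau>] \<phi>_lip[of s t \<tau>] \<phi>_lip[of t s \<tau>]
      by (cases "s \<le> t") (auto simp: dist_real_def)
    then show "\<exists>d>0. \<forall>x'\<in>{0..1}. dist x' s < d \<longrightarrow> dist (\<phi> \<tau> x') (\<phi> \<tau> s) \<le> e"
      using e by (intro exI[of _ e]) force
  qed
  have \<phi>_0: "\<phi> \<tau> 0 = 0" for \<tau>
  proof -
    have "\<phi> \<tau> 0 \<le> measure leb01 {0..0}"
      unfolding \<phi>_def by (intro leb01.finite_measure_mono sets_leb01_borel) (auto simp: E_def)
    then show ?thesis using measure_leb01_Icc[of 0 0] by (simp add: \<phi>_def measure_nonneg antisym)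
  qed
  have \<phi>_1: "\<phi> \<tau> 1 = measure leb01 (E \<tau>)" for \<tau>
    unfolding \<phi>_def by (rule arg_cong[where f = "measure leb01"]) (auto simp: E_def)
  have ge_eq: "measure leb01 {s \<in> {0..1}. \<tau> \<le> \<bar>y s\<bar>} = distr_fun y \<tau> + measure leb01 (E \<tau>)" for \<tau>
    unfolding distr_fun_def
  proof -
    have "{s \<in> {0..1}. \<tau> \<le> \<bar>y s\<bar>} = {s \<in> {0..1}. \<tau> < \<bar>y s\<bar>} \<union> E \<tau>" by (auto simp: E_def)
    then show "measure leb01 {s \<in> {0..1}. \<tau> \<le> \<bar>y s\<bar>}
        = measure leb01 {t \<in> {0..1}. \<tau> < \<bar>y t\<bar>} + measure leb01 (E \<tau>)"
      using leb01.finite_measure_Union[OF distr_set_sets[OF y] E, of \<tau> \<tau>] by (auto simp: E_def)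
  qed
  \<comment> \<open>Measurability of \<open>\<rho>\<close> is not yet available, so its sublevel
    sets are squeezed by measurable sets W of known measure. Unions of these W along u - 1/(n+1)
    then give measurability and the exact measure at once.\<close>
  have sandwich: "\<exists>W\<in>sets leb01. {t \<in> {0..1}. \<rho> t < u} \<subseteq> W \<and> W \<subseteq> {t \<in> {0..1}. \<rho> t \<le> u}
      \<and> measure leb01 W = max 0 u" if "u \<le> 1" for u
  proof (cases "u > 0")
    case False
    have "0 \<le> \<rho> t" for t unfolding \<rho>_def \<phi>_def by (intro add_nonneg_nonneg) simp_all
    then have "\<not> \<rho> t < u" for t using False by (metis not_less order_trans)
    then have "{t \<in> {0..1}. \<rho> t < u} = {}" by blast
    then show ?thesis using False by (intro bexI[of _ "{}"]) auto
  next
    case True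
    define \<tau> where "\<tau> = rearr y u"
    have \<tau>0: "0 \<le> \<tau>" unfolding \<tau>_def by (rule rearr_nonneg[OF y True])
    have d\<tau>: "distr_fun y \<tau> \<le> u" unfolding \<tau>_def by (rule distr_fun_rearr_le[OF y True])
    have lt: "u < distr_fun y \<sigma>" if "0 \<le> \<sigma>" "\<sigma> < \<tau>" for \<sigma>
      using that rearr_gt_iff[OF y True] by (simp add: \<tau>_def)
    \<comment> \<open>Every level below \<tau> is exceeded on a set of measure above u, so the left
      limit of the distribution function at \<tau> is at least u. The ties at \<tau> therefore
      suffice to fill up to u.\<close>
    have "u \<le> measure leb01 {s \<in> {0..1}. \<tau> \<le> \<bar>y s\<bar>}"
    proof (cases "\<tau> = 0")
      case True
      then have "{s \<in> {0..1}. \<tau> \<le> \<bar>y s\<bar>} = {0..1}" by auto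
      then show ?thesis using \<open>u \<le> 1\<close> by (simp add: measure_leb01_UNIV)
    next
      case False
      then have \<tau>pos: "\<tau> > 0" using \<tau>0 by simp
      let ?A = "\<lambda>n. {s \<in> {0..1}. \<bar>y s\<bar> > \<tau> - \<tau> / real (Suc n)}"
      have "decseq ?A"
      proof (intro decseq_SucI subsetI)
        fix n s assume "s \<in> {s \<in> {0..1}. \<bar>y s\<bar> > \<tau> - \<tau> / real (Suc (Suc n))}"
        moreover have "\<tau> / real (Suc (Suc n)) \<le> \<tau> / real (Suc n)"
          using \<tau>pos by (intro divide_left_mono) auto
        ultimately show "s \<in> {s \<in> {0..1}. \<bar>y s\<bar> > \<tau> - \<tau> / real (Suc n)}"
          by (simp del: of_nat_Suc)
      qed
      moreover have "(\<Inter>n. ?A n) = {s \<in> {0..1}. \<tau> \<le> \<bar>y s\<bar>}"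
      proof (intro equalityI subsetI)
        fix s assume s: "s \<in> (\<Inter>n. ?A n)"
        have "(\<lambda>n. \<tau> - \<tau> / real (Suc n)) \<longlonglongrightarrow> \<tau> - 0"
          by (intro tendsto_intros LIMSEQ_Suc[OF lim_const_over_n])
        then have "\<tau> - 0 \<le> \<bar>y s\<bar>"
          by (rule LIMSEQ_le_const2) (use s in \<open>auto intro: less_imp_le\<close>)
        then show "s \<in> {s \<in> {0..1}. \<tau> \<le> \<bar>y s\<bar>}" using s by auto
      next
        fix s assume s: "s \<in> {s \<in> {0..1}. \<tau> \<le> \<bar>y s\<bar>}"
        have "\<tau> / real (Suc n) > 0" for n using \<tau>pos by simp
        then have "\<tau> - \<tau> / real (Suc n) < \<tau>" for n by simp
        then show "s \<in> (\<Inter>n. ?A n)" using s by (blast intro: less_le_trans)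
      qed
      ultimately have "(\<lambda>n. measure leb01 (?A n)) \<longlonglongrightarrow> measure leb01 {s \<in> {0..1}. \<tau> \<le> \<bar>y s\<bar>}"
        using leb01.finite_Lim_measure_decseq[of ?A] distr_set_sets[OF y] by auto
      moreover have "u \<le> measure leb01 (?A n)" for n
      proof -
        have "0 \<le> \<tau> - \<tau> / real (Suc n)" "\<tau> - \<tau> / real (Suc n) < \<tau>"
          using \<tau>pos by (auto simp: field_simps)
        from lt[OF this] show ?thesis by (simp add: distr_fun_def)
      qed
      ultimately show ?thesis by (intro LIMSEQ_le_const) auto
    qed
    then have "u - distr_fun y \<tau> \<le> \<phi> \<tau> 1" unfolding ge_eq \<phi>_1 by linarith
    then obtain c where c: "\<phi> \<tau> c = u - distr_fun y \<tau>"
      using IVT'[of "\<phi> \<tau>" 0 "u - distr_fun y \<tau>" 1] \<phi>_cont[of \<tau>] \<phi>_0[of \<tau>] d\<tau> by auto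
    let ?W = "{s \<in> {0..1}. \<tau> < \<bar>y s\<bar>} \<union> (E \<tau> \<inter> {..c})"
    have "measure leb01 ?W = distr_fun y \<tau> + \<phi> \<tau> c"
      unfolding distr_fun_def \<phi>_def
      by (intro leb01.finite_measure_Union distr_set_sets y Ic) (auto simp: E_def)
    moreover have "?W \<in> sets leb01" by (intro sets.Un distr_set_sets y Ic)
    moreover have "{t \<in> {0..1}. \<rho> t < u} \<subseteq> ?W"
    proof (intro subsetI, rule ccontr)
      fix t assume t: "t \<in> {t \<in> {0..1}. \<rho> t < u}" "t \<notin> ?W"
      then consider "\<bar>y t\<bar> = \<tau>" "c < t" | "\<bar>y t\<bar> < \<tau>" by (force simp: E_def)
      then show False
      proof cases
        case 1
        then show False using \<phi>_mono[of c t \<tau>] c t by (simp add: \<rho>_def)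
      next
        case 2
        then have "u < distr_fun y \<bar>y t\<bar>" by (intro lt) auto
        moreover have "distr_fun y \<bar>y t\<bar> \<le> \<rho> t" by (simp add: \<rho>_def \<phi>_def)
        ultimately show False using t by simp
      qed
    qed
    moreover have "?W \<subseteq> {t \<in> {0..1}. \<rho> t \<le> u}"
    proof (intro subsetI)
      fix t assume t: "t \<in> ?W"
      then consider "\<bar>y t\<bar> > \<tau>" "t \<in> {0..1}" | "\<bar>y t\<bar> = \<tau>" "t \<le> c" "t \<in> {0..1}" by (auto simp: E_def)
      then show "t \<in> {t \<in> {0..1}. \<rho> t \<le> u}"
      proof cases
        case 1
        have "\<rho> t \<le> distr_fun y \<bar>y t\<bar> + \<phi> \<bar>y t\<bar> 1" using 1 by (simp add: \<rho>_def \<phi>_mono)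
        also have "\<dots> = measure leb01 {s \<in> {0..1}. \<bar>y t\<bar> \<le> \<bar>y s\<bar>}" unfolding ge_eq \<phi>_1 ..
        also have "\<dots> \<le> distr_fun y \<tau>"
          unfolding distr_fun_def using 1 by (intro leb01.finite_measure_mono distr_set_sets y) auto
        finally show ?thesis using 1 d\<tau> by simp
      next
        case 2
        then show ?thesis using \<phi>_mono[of t c \<tau>] c by (simp add: \<rho>_def)
      qed
    qed
    ultimately show ?thesis using c True by (intro bexI[of _ ?W]) auto
  qed
  then have "\<forall>u. \<exists>W. u \<le> 1 \<longrightarrow> W \<in> sets leb01 \<and> {t \<in> {0..1}. \<rho> t < u} \<subseteq> W
      \<and> W \<subseteq> {t \<in> {0..1}. \<rho> t \<le> u} \<and> measure leb01 W = max 0 u"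
    by blast
  from choice[OF this] obtain W where
    W': "\<And>u. u \<le> 1 \<Longrightarrow> W u \<in> sets leb01 \<and> {t \<in> {0..1}. \<rho> t < u} \<subseteq> W u
      \<and> W u \<subseteq> {t \<in> {0..1}. \<rho> t \<le> u} \<and> measure leb01 (W u) = max 0 u"
    by blast
  have W: "u \<le> 1 \<Longrightarrow> W u \<in> sets leb01" "u \<le> 1 \<Longrightarrow> {t \<in> {0..1}. \<rho> t < u} \<subseteq> W u"
    "u \<le> 1 \<Longrightarrow> W u \<subseteq> {t \<in> {0..1}. \<rho> t \<le> u}" "u \<le> 1 \<Longrightarrow> measure leb01 (W u) = max 0 u" for u
    using W'[of u] by blast+
  have lt_eq: "{t \<in> {0..1}. \<rho> t < u} = (\<Union>n. W (u - 1 / real (Suc n)))" if "u \<le> 1" for u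
  proof (intro equalityI subsetI)
    fix t assume t: "t \<in> {t \<in> {0..1}. \<rho> t < u}"
    then obtain n where "1 / real (Suc n) < u - \<rho> t" using nat_approx_posE[of "u - \<rho> t"] by auto
    then have "t \<in> {t \<in> {0..1}. \<rho> t < u - 1 / real (Suc n)}" using t by auto
    moreover have "u - 1 / real (Suc n) \<le> 1" using that by (simp add: add_increasing2 diff_le_eq)
    ultimately show "t \<in> (\<Union>n. W (u - 1 / real (Suc n)))" using W(2) by blast
  next
    fix t assume "t \<in> (\<Union>n. W (u - 1 / real (Suc n)))"
    then obtain n where n: "t \<in> W (u - 1 / real (Suc n))" by auto
    have p: "1 / real (Suc n) > 0" by simp
    then have "u - 1 / real (Suc n) \<le> 1" using that by linarith
    from W(3)[OF this] n have "t \<in> {0..1}" "\<rho> t \<le> u - 1 / real (Suc n)" by blast+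
    moreover from this p have "\<rho> t < u" by linarith
    ultimately show "t \<in> {t \<in> {0..1}. \<rho> t < u}" by blast
  qed
  have le1: "u - 1 / real (Suc n) \<le> 1" if "u \<le> 1" for u n
    using that by (simp add: add_increasing2 diff_le_eq)
  have sets_lt: "{t \<in> {0..1}. \<rho> t < u} \<in> sets leb01" if "u \<le> 1" for u
    unfolding lt_eq[OF that] using W(1) le1[OF that] by blast
  have meas: "measure leb01 {t \<in> {0..1}. \<rho> t < u} = u" if u: "0 \<le> u" "u \<le> 1" for u
  proof (rule antisym)
    show "measure leb01 {t \<in> {0..1}. \<rho> t < u} \<le> u"
      using leb01.finite_measure_mono[OF W(2) W(1), OF u(2) u(2)] W(4)[OF u(2)] u by simp
    have "u - 1 / real (Suc n) \<le> measure leb01 {t \<in> {0..1}. \<rho> t < u}" for n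
    proof -
      have "u - 1 / real (Suc n) \<le> measure leb01 (W (u - 1 / real (Suc n)))"
        using W(4)[OF le1[OF u(2)]] by simp
      also have "\<dots> \<le> measure leb01 {t \<in> {0..1}. \<rho> t < u}"
        by (rule leb01.finite_measure_mono[OF _ sets_lt[OF u(2)]]) (use lt_eq[OF u(2)] in blast)
      finally show ?thesis .
    qed
    moreover have "(\<lambda>n. u - 1 / real (Suc n)) \<longlonglongrightarrow> u - 0"
      by (intro tendsto_intros LIMSEQ_Suc[OF lim_const_over_n])
    ultimately show "u \<le> measure leb01 {t \<in> {0..1}. \<rho> t < u}"
      using LIMSEQ_le_const2[of "\<lambda>n. u - 1 / real (Suc n)" "u - 0"] by auto
  qed
  show ?thesis
  proof (rule that)
    have "{t \<in> {0..1}. \<rho> t < u} \<in> sets leb01" for u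
    proof (cases "u \<le> 1")
      case False
      have "measure leb01 ({0..1} - {t \<in> {0..1}. \<rho> t < 1}) = 0"
        using leb01.finite_measure_compl[OF sets_lt[of 1]] meas[of 1] by (simp add: measure_leb01_UNIV)
      then have "{0..1} - {t \<in> {0..1}. \<rho> t < 1} \<in> null_sets leb01"
        using sets.compl_sets[OF sets_lt[of 1]] by (simp add: null_sets_def leb01.emeasure_eq_measure)
      moreover have "{t \<in> {0..1}. u \<le> \<rho> t} \<subseteq> {0..1} - {t \<in> {0..1}. \<rho> t < 1}" using False by auto
      \<comment> \<open>Completeness of Lebesgue measure: for u > 1 the set lies in the null set
        where \<open>\<rho>\<close> is at least 1, and so it is measurable.\<close>
      ultimately have "{t \<in> {0..1}. u \<le> \<rho> t} \<in> sets leb01"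
        by (rule null_sets_leb01_subset)
      then have "space leb01 - {t \<in> {0..1}. u \<le> \<rho> t} \<in> sets leb01" by blast
      moreover have "space leb01 - {t \<in> {0..1}. u \<le> \<rho> t} = {t \<in> {0..1}. \<rho> t < u}" by auto
      ultimately show ?thesis by simp
    qed (rule sets_lt)
    then show "\<rho> \<in> borel_measurable leb01" by (simp add: borel_measurable_iff_less)
    show "distr_fun y \<bar>y t\<bar> \<le> \<rho> t" for t by (simp add: \<rho>_def \<phi>_def)
  qed (rule meas)
qed

text \<open>z is the composition of \<open>rearr x\<close> with the rank \<open>\<rho>\<close> of
  |y|. As \<open>\<rho>\<close> is uniformly distributed, z has the distribution of |x| and is large
  where |y| is large; and \<open>rearr y\<close> at \<open>\<rho> t\<close> is at most |y t|,
  because \<open>distr_fun y \<bar>y t\<bar>\<close> is at most \<open>\<rho> t\<close>.\<close>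

lemma Hardy_Littlewood_attained:
  assumes x: "x \<in> borel_measurable leb01" and y: "y \<in> borel_measurable leb01"
  obtains z where "z \<in> borel_measurable leb01" "\<And>\<tau>. 0 \<le> \<tau> \<Longrightarrow> distr_fun z \<tau> \<le> distr_fun x \<tau>"
    "(\<integral>\<^sup>+t. ennreal (rearr x t * rearr y t) \<partial>leb01) \<le> (\<integral>\<^sup>+t. ennreal \<bar>z t * y t\<bar> \<partial>leb01)"
proof -
  obtain \<rho> where \<rho> [measurable]: "\<rho> \<in> borel_measurable leb01"
    and meas: "\<And>u. 0 \<le> u \<Longrightarrow> u \<le> 1 \<Longrightarrow> measure leb01 {t \<in> {0..1}. \<rho> t < u} = u"
    and ge: "\<And>t. distr_fun y \<bar>y t\<bar> \<le> \<rho> t"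
    by (rule ranking_map[OF y]) blast
  have \<rho>0: "0 \<le> \<rho> t" for t using ge[of t] distr_fun_nonneg[of y "\<bar>y t\<bar>"] by linarith
  have lt_sets: "{t \<in> {0..1}. \<rho> t < u} \<in> sets leb01" for u
    using \<rho> by (simp add: borel_measurable_iff_less)
  \<comment> \<open>Cutting to (0,1) removes the arbitrary values of \<open>rearr\<close> at t \<le>
    0 and gives a Borel function on the whole line, which can be integrated against the distribution
    of the rank.\<close>
  define F where "F x t = (if 0 < t \<and> t < 1 then rearr x t else 0)" for x :: "real \<Rightarrow> real" and t
  have F_gt: "{t. \<tau> < F x t} = (if \<tau> < 0 then UNIV else {0<..<distr_fun x \<tau>})"
    if "x \<in> borel_measurable leb01" for x \<tau>
  proof (rule set_eqI)
    fix t
    show "t \<in> {t. \<tau> < F x t} \<longleftrightarrow> t \<in> (if \<tau> < 0 then UNIV else {0<..<distr_fun x \<tau>})"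
      using rearr_gt_iff[OF that, of t \<tau>] rearr_nonneg[OF that, of t] distr_fun_le_1[of x \<tau>]
      by (cases "0 < t \<and> t < 1"; cases "\<tau> < 0") (auto simp: F_def)
  qed
  have F_meas: "F x \<in> borel_measurable borel" if "x \<in> borel_measurable leb01" for x
    by (rule borel_measurableI_greater) (simp add: F_gt[OF that])
  have F_nonneg: "0 \<le> F x t" if "x \<in> borel_measurable leb01" for x t
    using rearr_nonneg[OF that, of t] by (simp add: F_def)
  note [measurable] = F_meas[OF x] F_meas[OF y]
  have lt_sets': "{t \<in> {0..1}. t < u} \<in> sets leb01" for u :: real
    by (intro sets_leb01_borel) auto
  \<comment> \<open>Equality of distributions is tested on half-lines unbounded to the right, while
    the ranking lemma measures the sets where \<open>\<rho>\<close> is below u. The minus sign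
    converts one into the other.\<close>
  have distr: "distr leb01 borel (\<lambda>t. - \<rho> t) = distr leb01 borel uminus"
  proof (rule measure_eqI_lessThan)
    fix u :: real
    have "measure leb01 {t \<in> {0..1}. \<rho> t < v} = measure leb01 {t \<in> {0..1}. t < v}" for v
    proof -
      consider "v < 0" | "0 \<le> v" "v \<le> 1" | "1 < v" by linarith
      then show ?thesis
      proof cases
        case 1
        then have "{t \<in> {0..1}. \<rho> t < v} = {}" "{t \<in> {0..1}. t < v} = {}"
          by (auto simp: not_less intro: order_trans[OF less_imp_le \<rho>0])
        then show ?thesis by (simp only:)
      next
        case 2
        have "measure leb01 {t \<in> {0..1}. t < v} = v"
        proof (rule antisym)
          show "measure leb01 {t \<in> {0..1}. t < v} \<le> v"
            using 2 leb01.finite_measure_mono[of "{t \<in> {0..1}. t < v}" "{0..v}"]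
              sets_leb01_borel[of "{0..v}"] measure_leb01_Icc[of 0 v] by force
          show "v \<le> measure leb01 {t \<in> {0..1}. t < v}"
            using 2 leb01.finite_measure_mono[of "{0<..<v}" "{t \<in> {0..1}. t < v}", OF _ lt_sets']
              measure_leb01_Ioo[of 0 v] by force
        qed
        then show ?thesis using meas[OF 2] by linarith
      next
        case 3
        then have "{t \<in> {0..1}. t < v} = {0..1}" by auto
        moreover have "measure leb01 {t \<in> {0..1}. \<rho> t < 1} \<le> measure leb01 {t \<in> {0..1}. \<rho> t < v}"
          using 3 by (intro leb01.finite_measure_mono lt_sets) auto
        ultimately show ?thesis
          using meas[of 1] measure_leb01_le_1[of "{t \<in> {0..1}. \<rho> t < v}"] by (simp add: measure_leb01_UNIV)
      qed
    qed
    note eq = this[of "- u"]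
    have *: "u < - s \<longleftrightarrow> s < - u" for s by linarith
    from eq show "emeasure (distr leb01 borel (\<lambda>t. - \<rho> t)) {u<..} = emeasure (distr leb01 borel uminus) {u<..}"
      by (subst (1 2) emeasure_distr)
         (auto simp: leb01.emeasure_eq_measure vimage_def Int_def conj_commute *
            intro!: borel_measurable_leb01)
    show "emeasure (distr leb01 borel (\<lambda>t. - \<rho> t)) {u<..} < \<infinity>"
      by (subst emeasure_distr) (auto simp: leb01.emeasure_eq_measure)
  qed auto
  let ?z = "\<lambda>t. F x (\<rho> t)"
  have z: "?z \<in> borel_measurable leb01" by measurable
  show ?thesis
  proof (rule that[OF z])
    fix \<tau> :: real assume \<tau>: "0 \<le> \<tau>"
    have "distr_fun ?z \<tau> \<le> measure leb01 {t \<in> {0..1}. \<rho> t < distr_fun x \<tau>}"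
      unfolding distr_fun_def[of ?z]
    proof (intro leb01.finite_measure_mono lt_sets subsetI)
      fix t assume "t \<in> {t \<in> {0..1}. \<tau> < \<bar>?z t\<bar>}"
      then have "\<rho> t \<in> {s. \<tau> < F x s}" "t \<in> {0..1}" using F_nonneg[OF x] by auto
      then show "t \<in> {t \<in> {0..1}. \<rho> t < distr_fun x \<tau>}" using \<tau> by (simp add: F_gt[OF x])
    qed
    also have "\<dots> = distr_fun x \<tau>" by (intro meas distr_fun_nonneg distr_fun_le_1)
    finally show "distr_fun ?z \<tau> \<le> distr_fun x \<tau>" .
  next
    have "AE t in leb01. t \<noteq> 1"
    proof -
      have "{1::real} \<in> null_sets leb01"
        using measure_leb01_Icc[of 1 1] by (simp add: null_sets_def leb01.emeasure_eq_measure sets_leb01_iff)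
      from AE_not_in[OF this] show ?thesis by simp
    qed
    then have "(\<integral>\<^sup>+t. ennreal (rearr x t * rearr y t) \<partial>leb01) = (\<integral>\<^sup>+t. ennreal (F x t * F y t) \<partial>leb01)"
      using AE_leb01_pos by (intro nn_integral_cong_AE) (force elim: eventually_elim2 simp: F_def)
    also have "\<dots> = (\<integral>\<^sup>+t. ennreal (F x (- t) * F y (- t)) \<partial>distr leb01 borel uminus)"
      by (subst nn_integral_distr) (auto intro: borel_measurable_leb01)
    also have "\<dots> = (\<integral>\<^sup>+t. ennreal (F x (\<rho> t) * F y (\<rho> t)) \<partial>leb01)"
      unfolding distr[symmetric] by (subst nn_integral_distr) auto
    also have "\<dots> \<le> (\<integral>\<^sup>+t. ennreal \<bar>?z t * y t\<bar> \<partial>leb01)"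
    proof (intro nn_integral_mono ennreal_leI)
      fix t
      have "F y (\<rho> t) \<le> \<bar>y t\<bar>"
        using ge[of t] by (auto simp: F_def intro: rearr_le)
      then show "F x (\<rho> t) * F y (\<rho> t) \<le> \<bar>?z t * y t\<bar>"
        using F_nonneg[OF x, of "\<rho> t"] by (simp add: abs_mult mult_left_mono)
    qed
    finally show "(\<integral>\<^sup>+t. ennreal (rearr x t * rearr y t) \<partial>leb01) \<le> (\<integral>\<^sup>+t. ennreal \<bar>?z t * y t\<bar> \<partial>leb01)" .
  qed
qed

section \<open>Rademacher sums\<close>

lemma rademacher_borel [measurable]: "rademacher k \<in> borel_measurable borel"
  unfolding rademacher_def by measurable

lemma rademacher_leb01 [measurable]: "rademacher k \<in> borel_measurable leb01"
  by (intro borel_measurable_leb01 rademacher_borel)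

lemma abs_rademacher_le_1: "\<bar>rademacher k t\<bar> \<le> 1"
  by (simp add: rademacher_def abs_sgn_eq)

lemma integrable_leb01_bounded:
  fixes f :: "real \<Rightarrow> real"
  shows "f \<in> borel_measurable leb01 \<Longrightarrow> (\<And>t. \<bar>f t\<bar> \<le> B) \<Longrightarrow> integrable leb01 f"
  by (rule leb01.integrable_const_bound[where B = B]) auto

lemma rademacher_shift_same: "rademacher k (t + 1 / 2 ^ k) = - rademacher k t"
proof -
  have "2 ^ k * pi * (t + 1 / 2 ^ k) = 2 ^ k * pi * t + pi" by (simp add: field_simps)
  then show ?thesis by (simp add: rademacher_def sgn_minus)
qed

lemma sin_plus_of_nat_2pi: "sin (x + real n * (2 * pi)) = sin x"
proof (induction n)
  case (Suc n)
  have "x + real (Suc n) * (2 * pi) = (x + real n * (2 * pi)) + 2 * pi" by (simp add: algebra_simps)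
  then show ?case using Suc sin_periodic[of "x + real n * (2 * pi)"] by presburger
qed simp

lemma rademacher_shift_coarser:
  assumes "k < m"
  shows "rademacher m (t + 1 / 2 ^ k) = rademacher m t"
proof -
  have "(2::real) ^ m = 2 * 2 ^ (m - k - 1) * 2 ^ k"
    using assms by (simp flip: power_Suc power_add)
  then have "2 ^ m * pi * (t + 1 / 2 ^ k) = 2 ^ m * pi * t + real (2 ^ (m - k - 1)) * (2 * pi)"
    by (simp add: field_simps)
  then show ?thesis unfolding rademacher_def by (metis sin_plus_of_nat_2pi)
qed

lemma rademacher_period: "1 \<le> k \<Longrightarrow> rademacher k (t + 1) = rademacher k t"
  using rademacher_shift_coarser[of 0 k t] by simp

lemma AE_leb01_borel:
  assumes "AE t in lborel. P t"
  shows "AE t in leb01. P t"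
  using assms by (subst AE_restrict_space_iff) (auto intro: AE_completion elim: eventually_mono)

text \<open>The sign is 0 exactly where the sine vanishes, and these dyadic points are
  countable.\<close>

lemma AE_rademacher_sq: "AE t in leb01. rademacher k t * rademacher k t = 1"
proof (rule AE_leb01_borel)
  have "countable (range (\<lambda>i::int. of_int i / 2 ^ k :: real))" by auto
  moreover have "t \<in> range (\<lambda>i::int. of_int i / 2 ^ k)" if "rademacher k t = 0" for t
  proof -
    have "sin (2 ^ k * pi * t) = 0" using that by (simp add: rademacher_def sgn_0_0)
    then obtain i where "2 ^ k * pi * t = of_int i * pi" using sin_zero_iff_int2 by blast
    then have "t = of_int i / 2 ^ k" by (simp add: field_simps)
    then show ?thesis by blast
  qed
  ultimately have "AE t in lborel. rademacher k t \<noteq> 0"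
    by (intro AE_I'[of "range (\<lambda>i::int. of_int i / 2 ^ k :: real)"] countable_imp_null_set_lborel) auto
  then show "AE t in lborel. rademacher k t * rademacher k t = 1"
    by eventually_elim (auto simp: rademacher_def sgn_if split: if_splits)
qed

lemma AE_rademacher_sign: "AE t in leb01. \<forall>k. rademacher k t = 1 \<or> rademacher k t = -1"
  unfolding AE_all_countable using AE_rademacher_sq
  by (auto elim!: eventually_mono simp: square_eq_1_iff)

section \<open>Integrals of products of Rademacher functions\<close>

lemma LINT_leb01_lborel:
  fixes f :: "real \<Rightarrow> real"
  assumes [measurable]: "f \<in> borel_measurable borel"
  shows "(LINT t|leb01. f t) = (LINT t|lborel. indicator {0<..1} t * f t)"
proof -
  have "(LINT t|leb01. f t) = (LINT t|lebesgue. indicator {0..1} t * f t)"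
    by (subst integral_restrict_space) auto
  also have "\<dots> = (LINT t|lborel. indicator {0..1} t * f t)"
    by (rule integral_completion) measurable
  also have "\<dots> = (LINT t|lborel. indicator {0<..1} t * f t)"
    using AE_lborel_singleton[of 0]
    by (intro integral_cong_AE) (auto elim!: eventually_mono split: split_indicator)
  finally show ?thesis .
qed

text \<open>By periodicity the piece pushed beyond 1 reenters at 0. Translation is carried out for
  \<open>lborel\<close>, with half-open intervals so that the pieces are disjoint.\<close>

lemma LINT_leb01_periodic_shift:
  fixes f :: "real \<Rightarrow> real"
  assumes f [measurable]: "f \<in> borel_measurable borel" and bd: "\<And>t. \<bar>f t\<bar> \<le> B"
    and per: "\<And>t. f (t + 1) = f t" and c: "0 \<le> c" "c \<le> 1"
  shows "(LINT t|leb01. f (t + c)) = (LINT t|leb01. f t)"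
proof -
  have int: "integrable lborel (\<lambda>t. indicator {a<..b} t * g t)"
    if [measurable]: "g \<in> borel_measurable borel" and "\<And>t. \<bar>g t\<bar> \<le> B" for a b and g :: "real \<Rightarrow> real"
  proof (rule Bochner_Integration.integrable_bound)
    show "integrable lborel (\<lambda>t. indicator {a<..b} t * B)"
      by (intro integrable_mult_left) (cases "a \<le> b"; simp)
    show "AE t in lborel. norm (indicator {a<..b} t * g t) \<le> norm (indicator {a<..b} t * B)"
      using that(2) by (auto intro!: AE_I2 split: split_indicator intro: order_trans[OF _ abs_ge_self])
  qed measurable
  have "(LINT t|leb01. f (t + c)) = (LINT t|lborel. indicator {0<..1} t * f (t + c))"
    by (rule LINT_leb01_lborel) measurable
  also have "\<dots> = (LINT t|lborel. indicator {c<..1+c} t * f t)"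
    by (subst (2) lborel_integral_real_affine[where c = 1 and t = c])
       (auto intro!: Bochner_Integration.integral_cong split: split_indicator simp: add.commute)
  also have "\<dots> = (LINT t|lborel. indicator {c<..1} t * f t + indicator {1<..1+c} t * f t)"
    using c by (intro Bochner_Integration.integral_cong) (auto split: split_indicator)
  also have "\<dots> = (LINT t|lborel. indicator {c<..1} t * f t) + (LINT t|lborel. indicator {1<..1+c} t * f t)"
    by (intro Bochner_Integration.integral_add int f bd)
  also have "(LINT t|lborel. indicator {1<..1+c} t * f t) = (LINT t|lborel. indicator {0<..c} t * f t)"
    by (subst lborel_integral_real_affine[where c = 1 and t = 1])
       (auto intro!: Bochner_Integration.integral_cong split: split_indicator simp: add.commute per)
  also have "(LINT t|lborel. indicator {c<..1} t * f t) + (LINT t|lborel. indicator {0<..c} t * f t)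
      = (LINT t|lborel. indicator {c<..1} t * f t + indicator {0<..c} t * f t)"
    by (intro Bochner_Integration.integral_add[symmetric] int f bd)
  also have "\<dots> = (LINT t|lborel. indicator {0<..1} t * f t)"
    using c by (intro Bochner_Integration.integral_cong) (auto split: split_indicator)
  also have "\<dots> = (LINT t|leb01. f t)"
    by (rule LINT_leb01_lborel[symmetric]) measurable
  finally show ?thesis .
qed

lemma abs_prod_rademacher_le_1: "\<bar>\<Prod>k\<in>A. rademacher k t\<bar> \<le> 1"
  by (simp add: abs_prod abs_rademacher_le_1 prod_le_1)

text \<open>Shifting by \<open>2\<^sup>-\<^sup>k\<close> with \<open>k = Min A\<close> flips the sign of the whole product.\<close>

lemma LINT_prod_rademacher:
  assumes A: "finite A" "A \<noteq> {}" "A \<subseteq> {1..}"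
  shows "(LINT t|leb01. (\<Prod>k\<in>A. rademacher k t)) = 0"
proof -
  define k where "k = Min A"
  have k: "k \<in> A" unfolding k_def using A by simp
  let ?f = "\<lambda>t. \<Prod>k\<in>A. rademacher k t"
  have "?f (t + 1 / 2 ^ k) = - ?f t" for t
  proof -
    have "?f (t + 1 / 2 ^ k) = rademacher k (t + 1 / 2 ^ k) * (\<Prod>m\<in>A - {k}. rademacher m (t + 1 / 2 ^ k))"
      using A k by (simp add: prod.remove)
    also have "(\<Prod>m\<in>A - {k}. rademacher m (t + 1 / 2 ^ k)) = (\<Prod>m\<in>A - {k}. rademacher m t)"
    proof (rule prod.cong[OF refl])
      fix m assume "m \<in> A - {k}"
      then have "k < m" unfolding k_def using A by (auto simp: order_less_le)
      then show "rademacher m (t + 1 / 2 ^ k) = rademacher m t" by (rule rademacher_shift_coarser)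
    qed
    finally show ?thesis using A k by (simp add: rademacher_shift_same prod.remove)
  qed
  moreover have "(LINT t|leb01. ?f (t + 1 / 2 ^ k)) = (LINT t|leb01. ?f t)"
  proof (rule LINT_leb01_periodic_shift[OF _ abs_prod_rademacher_le_1])
    show "?f (t + 1) = ?f t" for t
      using A by (intro prod.cong) (auto simp: rademacher_period)
  qed auto
  ultimately show ?thesis by simp
qed

lemma LINT_leb01_const: "(LINT t|leb01. (c::real)) = c"
  by simp

text \<open>Independence of the Rademacher functions in the form used below: when the product is
  expanded, every nonempty subset contributes the integral of a Walsh product, which vanishes, and
  only the constant term survives.\<close>

lemma LINT_prod_affine_rademacher:
  assumes A: "finite A" "A \<subseteq> {1..}"
  shows "(LINT t|leb01. (\<Prod>k\<in>A. \<alpha> k + \<beta> k * rademacher k t)) = (\<Prod>k\<in>A. \<alpha> k)"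
proof -
  have int: "integrable leb01 (\<lambda>t. (\<Prod>k\<in>X. \<beta> k) * (\<Prod>k\<in>X. rademacher k t) * (\<Prod>k\<in>A-X. \<alpha> k))" for X
    by (intro integrable_mult_left integrable_mult_right integrable_leb01_bounded[OF _ abs_prod_rademacher_le_1])
       measurable
  have "(LINT t|leb01. (\<Prod>k\<in>A. \<alpha> k + \<beta> k * rademacher k t)) =
    (LINT t|leb01. (\<Sum>X\<in>Pow A. (\<Prod>k\<in>X. \<beta> k) * (\<Prod>k\<in>X. rademacher k t) * (\<Prod>k\<in>A-X. \<alpha> k)))"
    by (simp add: add.commute[of "\<alpha> _"] prod_add[OF A(1)] prod.distrib)
  also have "\<dots> = (\<Sum>X\<in>Pow A. (\<Prod>k\<in>X. \<beta> k) * (LINT t|leb01. (\<Prod>k\<in>X. rademacher k t)) * (\<Prod>k\<in>A-X. \<alpha> k))"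
    by (subst Bochner_Integration.integral_sum[OF int]) simp
  also have "\<dots> = (\<Sum>X\<in>Pow A. if X = {} then (\<Prod>k\<in>A. \<alpha> k) else 0)"
    using A by (intro sum.cong) (auto simp: LINT_leb01_const finite_subset intro!: LINT_prod_rademacher)
  also have "\<dots> = (\<Prod>k\<in>A. \<alpha> k)" using A by (simp add: sum.delta)
  finally show ?thesis .
qed

lemma LINT_rademacher_mult:
  assumes "1 \<le> i" "1 \<le> j"
  shows "(LINT t|leb01. rademacher i t * rademacher j t) = (if i = j then 1 else 0)"
proof (cases "i = j")
  case True
  then show ?thesis using LINT_leb01_const[of 1] integral_cong_AE[OF _ _ AE_rademacher_sq[of i]] by simp
next
  case False
  then show ?thesis using LINT_prod_rademacher[of "{i, j}"] assms by simp
qed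

text \<open>Squares of Rademacher functions are 1 a.e., so common factors cancel and the symmetric
  difference of the index sets remains.\<close>

lemma AE_prod_rademacher_mult:
  assumes "finite A" "finite B"
  shows "AE t in leb01. (\<Prod>k\<in>A. rademacher k t) * (\<Prod>k\<in>B. rademacher k t)
    = (\<Prod>k\<in>(A - B) \<union> (B - A). rademacher k t)"
  using AE_rademacher_sign
proof eventually_elim
  case (elim t)
  have "(\<Prod>k\<in>A. rademacher k t) = (\<Prod>k\<in>A \<inter> B. rademacher k t) * (\<Prod>k\<in>A - B. rademacher k t)"
    "(\<Prod>k\<in>B. rademacher k t) = (\<Prod>k\<in>A \<inter> B. rademacher k t) * (\<Prod>k\<in>B - A. rademacher k t)"
    "(\<Prod>k\<in>(A - B) \<union> (B - A). rademacher k t) = (\<Prod>k\<in>A - B. rademacher k t) * (\<Prod>k\<in>B - A. rademacher k t)"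
    using assms by (subst prod.union_disjoint[symmetric]; auto intro!: prod.cong)+
  moreover have "(\<Prod>k\<in>A \<inter> B. rademacher k t) * (\<Prod>k\<in>A \<inter> B. rademacher k t) = 1"
    unfolding prod.distrib[symmetric] using elim by (intro prod.neutral ballI) (metis mult_minus1 mult_1 minus_minus)
  ultimately show ?case by (simp add: algebra_simps)
qed

lemma LINT_prod_rademacher_mult:
  assumes "finite A" "A \<subseteq> {1..}" "finite B" "B \<subseteq> {1..}"
  shows "(LINT t|leb01. (\<Prod>k\<in>A. rademacher k t) * (\<Prod>k\<in>B. rademacher k t)) = (if A = B then 1 else 0)"
proof -
  have "(LINT t|leb01. (\<Prod>k\<in>A. rademacher k t) * (\<Prod>k\<in>B. rademacher k t))
    = (LINT t|leb01. (\<Prod>k\<in>(A - B) \<union> (B - A). rademacher k t))"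
    using AE_prod_rademacher_mult[OF assms(1,3)] by (intro integral_cong_AE) measurable
  also have "\<dots> = (if A = B then 1 else 0)"
  proof (cases "A = B")
    case False
    then have "(A - B) \<union> (B - A) \<noteq> {}" by blast
    then show ?thesis using assms False LINT_prod_rademacher[of "(A - B) \<union> (B - A)"] by auto
  qed (simp add: LINT_leb01_const)
  finally show ?thesis .
qed

section \<open>Bessel's inequality and second moments\<close>

lemma integrable_of_square:
  fixes f :: "real \<Rightarrow> real"
  assumes [measurable]: "f \<in> borel_measurable leb01" and "integrable leb01 (\<lambda>t. (f t)\<^sup>2)"
  shows "integrable leb01 f"
proof (rule Bochner_Integration.integrable_bound)
  show "integrable leb01 (\<lambda>t. 1 + (f t)\<^sup>2)" by (intro Bochner_Integration.integrable_add assms) simp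
  have "\<bar>x\<bar> \<le> \<bar>1 + x\<^sup>2\<bar>" for x :: real
    using zero_le_power2[of "\<bar>x\<bar> - 1"] zero_le_power2[of x] by (simp add: power2_diff del: zero_le_power2)
  then show "AE t in leb01. norm (f t) \<le> norm (1 + (f t)\<^sup>2)" by simp
qed measurable

lemma integrable_mult_bounded:
  fixes f g :: "real \<Rightarrow> real"
  assumes "integrable leb01 f" and [measurable]: "g \<in> borel_measurable leb01" and "\<And>t. \<bar>g t\<bar> \<le> B"
  shows "integrable leb01 (\<lambda>t. f t * g t)"
proof (rule Bochner_Integration.integrable_bound)
  show "integrable leb01 (\<lambda>t. f t * B)" using assms(1) by simp
  have "0 \<le> B" using assms(3)[of 0] by linarith
  then show "AE t in leb01. norm (f t * g t) \<le> norm (f t * B)"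
    using assms(3) by (auto simp: abs_mult intro!: mult_left_mono)
qed (use assms(1) in measurable)

text \<open>Expand the integral of (f - S)^2, where S is the orthogonal projection of f onto the
  span. The bound |e_i| \<le> 1 makes all products integrable by domination.\<close>

lemma Bessel_leb01:
  fixes e :: "'i \<Rightarrow> real \<Rightarrow> real"
  assumes I: "finite I" and e [measurable]: "\<And>i. e i \<in> borel_measurable leb01" and e1: "\<And>i t. \<bar>e i t\<bar> \<le> 1"
    and orth: "\<And>i j. i \<in> I \<Longrightarrow> j \<in> I \<Longrightarrow> (LINT t|leb01. e i t * e j t) = (if i = j then 1 else 0)"
    and f [measurable]: "f \<in> borel_measurable leb01" and f2: "integrable leb01 (\<lambda>t. (f t)\<^sup>2)"
  shows "(\<Sum>i\<in>I. (LINT t|leb01. f t * e i t)\<^sup>2) \<le> (LINT t|leb01. (f t)\<^sup>2)"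
proof -
  define c where "c i = (LINT t|leb01. f t * e i t)" for i
  have fe: "integrable leb01 (\<lambda>t. f t * e i t)" for i
    by (rule integrable_mult_bounded[OF integrable_of_square[OF f f2] e e1])
  have ee: "integrable leb01 (\<lambda>t. e i t * e j t)" for i j
    by (rule integrable_mult_bounded[OF integrable_leb01_bounded[OF e e1] e e1])
  let ?S = "\<lambda>t. \<Sum>i\<in>I. c i * e i t"
  have fS: "(LINT t|leb01. f t * ?S t) = (\<Sum>i\<in>I. (c i)\<^sup>2)" "integrable leb01 (\<lambda>t. f t * ?S t)"
  proof -
    have eq: "f t * ?S t = (\<Sum>i\<in>I. c i * (f t * e i t))" for t
      by (simp add: sum_distrib_left algebra_simps)
    show "(LINT t|leb01. f t * ?S t) = (\<Sum>i\<in>I. (c i)\<^sup>2)"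
      unfolding eq by (subst Bochner_Integration.integral_sum) (auto simp: fe c_def power2_eq_square)
    show "integrable leb01 (\<lambda>t. f t * ?S t)" unfolding eq by (intro Bochner_Integration.integrable_sum integrable_mult_right fe)
  qed
  have SS: "(LINT t|leb01. (?S t)\<^sup>2) = (\<Sum>i\<in>I. (c i)\<^sup>2)" "integrable leb01 (\<lambda>t. (?S t)\<^sup>2)"
  proof -
    have eq: "(?S t)\<^sup>2 = (\<Sum>i\<in>I. \<Sum>j\<in>I. c i * c j * (e i t * e j t))" for t
      by (simp add: power2_eq_square sum_product algebra_simps)
    have "(LINT t|leb01. (?S t)\<^sup>2) = (\<Sum>i\<in>I. \<Sum>j\<in>I. c i * c j * (LINT t|leb01. e i t * e j t))"
      unfolding eq
      by (subst Bochner_Integration.integral_sum, intro Bochner_Integration.integrable_sum integrable_mult_right ee,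
          intro sum.cong refl, subst Bochner_Integration.integral_sum) (auto intro: ee)
    also have "\<dots> = (\<Sum>i\<in>I. \<Sum>j\<in>I. if j = i then (c i)\<^sup>2 else 0)"
      by (intro sum.cong refl) (auto simp: orth power2_eq_square)
    finally show "(LINT t|leb01. (?S t)\<^sup>2) = (\<Sum>i\<in>I. (c i)\<^sup>2)" using I by simp
    show "integrable leb01 (\<lambda>t. (?S t)\<^sup>2)"
      unfolding eq by (intro Bochner_Integration.integrable_sum integrable_mult_right ee)
  qed
  have "0 \<le> (LINT t|leb01. (f t - ?S t)\<^sup>2)" by simp
  also have "\<dots> = (LINT t|leb01. (f t)\<^sup>2 - 2 * (f t * ?S t) + (?S t)\<^sup>2)"
    by (simp add: power2_diff algebra_simps)
  also have "\<dots> = (LINT t|leb01. (f t)\<^sup>2) - 2 * (\<Sum>i\<in>I. (c i)\<^sup>2) + (\<Sum>i\<in>I. (c i)\<^sup>2)"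
    using f2 fS SS by simp
  finally show ?thesis by (simp add: c_def)
qed

definition rad_sum :: "(nat \<Rightarrow> real) \<Rightarrow> nat set \<Rightarrow> real \<Rightarrow> real" where
  "rad_sum a F t = (\<Sum>k\<in>F. a k * rademacher k t)"

lemma rad_sum_borel [measurable]: "rad_sum a F \<in> borel_measurable borel"
  unfolding rad_sum_def by measurable

lemma rad_sum_leb01 [measurable]: "rad_sum a F \<in> borel_measurable leb01"
  by (intro borel_measurable_leb01 rad_sum_borel)

lemma abs_rad_sum_le: "\<bar>rad_sum a F t\<bar> \<le> (\<Sum>k\<in>F. \<bar>a k\<bar>)"
  unfolding rad_sum_def
  by (rule order_trans[OF sum_abs])
     (auto intro!: sum_mono simp: abs_mult mult_left_le abs_rademacher_le_1)

lemma integrable_rad_sum_power: "integrable leb01 (\<lambda>t. (rad_sum a F t) ^ m)"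
proof (rule integrable_leb01_bounded)
  show "\<bar>(rad_sum a F t) ^ m\<bar> \<le> (\<Sum>k\<in>F. \<bar>a k\<bar>) ^ m" for t
    unfolding power_abs by (intro power_mono abs_rad_sum_le) simp
qed measurable

lemma LINT_rad_sum_rademacher:
  assumes "finite F" "F \<subseteq> {1..}" "1 \<le> k"
  shows "(LINT t|leb01. rad_sum a F t * rademacher k t) = (if k \<in> F then a k else 0)"
proof -
  have int: "integrable leb01 (\<lambda>t. a i * (rademacher i t * rademacher k t))" for i
    by (intro integrable_mult_right integrable_mult_bounded[where B = 1] integrable_leb01_bounded[where B = 1])
       (auto simp: abs_rademacher_le_1)
  have "(LINT t|leb01. rad_sum a F t * rademacher k t)
      = (LINT t|leb01. (\<Sum>i\<in>F. a i * (rademacher i t * rademacher k t)))"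
    by (simp add: rad_sum_def sum_distrib_right mult.assoc)
  also have "\<dots> = (\<Sum>i\<in>F. a i * (LINT t|leb01. rademacher i t * rademacher k t))"
    by (subst Bochner_Integration.integral_sum[OF int]) simp
  also have "\<dots> = (\<Sum>i\<in>F. if i = k then a k else 0)"
    using assms by (intro sum.cong) (auto simp: LINT_rademacher_mult)
  finally show ?thesis using assms by simp
qed

lemma LINT_rad_sum_sq:
  assumes F: "finite F" "F \<subseteq> {1..}"
  shows "(LINT t|leb01. (rad_sum a F t)\<^sup>2) = (\<Sum>k\<in>F. (a k)\<^sup>2)"
proof -
  have int: "integrable leb01 (\<lambda>t. a k * (rad_sum a F t * rademacher k t))" for k
    using integrable_rad_sum_power[of a F 1]
    by (intro integrable_mult_right integrable_mult_bounded[where B = 1]) (auto simp: abs_rademacher_le_1)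
  have "(LINT t|leb01. (rad_sum a F t)\<^sup>2)
      = (LINT t|leb01. (\<Sum>k\<in>F. a k * (rad_sum a F t * rademacher k t)))"
    by (simp add: rad_sum_def power2_eq_square sum_distrib_left algebra_simps)
  also have "\<dots> = (\<Sum>k\<in>F. a k * (LINT t|leb01. rad_sum a F t * rademacher k t))"
    by (subst Bochner_Integration.integral_sum[OF int]) simp
  also have "\<dots> = (\<Sum>k\<in>F. (a k)\<^sup>2)"
    using F by (intro sum.cong refl) (auto simp: LINT_rad_sum_rademacher power2_eq_square subset_iff)
  finally show ?thesis .
qed

section \<open>Exponential moments and Gaussian tails of Rademacher sums\<close>

lemma cosh_sums_even: "(\<lambda>n. x ^ (2 * n) / fact (2 * n)) sums cosh (x::real)"
proof -
  let ?f = "\<lambda>n. if even n then x ^ n /\<^sub>R fact n else 0"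
  have "(\<lambda>n. ?f (2 * n)) sums cosh x \<longleftrightarrow> ?f sums cosh x"
    by (rule sums_mono_reindex) (auto simp: strict_mono_def image_iff elim!: evenE)
  then show ?thesis using cosh_converges[of x] by (simp add: divide_inverse mult.commute)
qed

lemma power_even_le_cosh: "x ^ (2 * n) \<le> fact (2 * n) * cosh (x::real)"
proof -
  have "(\<Sum>i\<in>{n}. x ^ (2 * i) / fact (2 * i)) \<le> cosh x"
    unfolding sums_unique[OF cosh_sums_even[of x]]
    by (intro sum_le_suminf sums_summable[OF cosh_sums_even]) (auto simp: power_mult)
  then show ?thesis by (simp add: field_simps)
qed

lemma two_power_fact_le: "2 ^ n * fact n \<le> (fact (2 * n) :: real)"
proof (induction n)
  case (Suc n)
  have "2 ^ Suc n * fact (Suc n) = real (2 * n + 2) * (2 ^ n * fact n)" by (simp add: algebra_simps)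
  also have "\<dots> \<le> real (2 * n + 2) * fact (2 * n)" by (intro mult_left_mono Suc) simp
  also have "\<dots> \<le> real (2 * n + 2) * (real (2 * n + 1) * fact (2 * n))"
    by (intro mult_left_mono) (simp_all add: field_simps)
  also have "\<dots> = fact (2 * Suc n)" by (simp add: algebra_simps)
  finally show ?case .
qed simp

text \<open>The power series are compared term by term, using (2n)! \<ge> 2^n n!. The Gaussian upper
  bounds below originate here.\<close>

lemma cosh_le_exp_sq: "cosh (x::real) \<le> exp (x\<^sup>2 / 2)"
proof -
  have "x ^ (2 * n) / fact (2 * n) \<le> (x\<^sup>2 / 2) ^ n /\<^sub>R fact n" for n
  proof -
    have "x ^ (2 * n) / fact (2 * n) \<le> x ^ (2 * n) / (2 ^ n * fact n)"
      by (intro divide_left_mono two_power_fact_le) (auto simp: power_mult)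
    also have "\<dots> = (x\<^sup>2 / 2) ^ n /\<^sub>R fact n"
      unfolding power_mult power_divide real_scaleR_def divide_inverse inverse_mult_distrib
        power_mult_distrib power_inverse
      by (simp only: mult_ac)
    finally show ?thesis .
  qed
  then show ?thesis by (rule sums_le[OF _ cosh_sums_even exp_converges])
qed

text \<open>For a sign e one has exp(x e) = cosh x + e sinh x. This turns the exponential of the sum
  into a product of affine functions of the individual signs.\<close>

lemma LINT_exp_rad_sum:
  assumes F: "finite F" "F \<subseteq> {1..}"
  shows "(LINT t|leb01. exp (l * rad_sum a F t)) = (\<Prod>k\<in>F. cosh (l * a k))"
proof -
  have "(LINT t|leb01. exp (l * rad_sum a F t))
    = (LINT t|leb01. (\<Prod>k\<in>F. cosh (l * a k) + sinh (l * a k) * rademacher k t))"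
  proof (rule integral_cong_AE)
    show "AE t in leb01. exp (l * rad_sum a F t) = (\<Prod>k\<in>F. cosh (l * a k) + sinh (l * a k) * rademacher k t)"
      using AE_rademacher_sign
    proof eventually_elim
      case (elim t)
      have "exp (l * rad_sum a F t) = (\<Prod>k\<in>F. exp (l * a k * rademacher k t))"
        using F by (simp add: rad_sum_def sum_distrib_left exp_sum mult.assoc)
      also have "\<dots> = (\<Prod>k\<in>F. cosh (l * a k) + sinh (l * a k) * rademacher k t)"
      proof (rule prod.cong[OF refl])
        fix k
        show "exp (l * a k * rademacher k t) = cosh (l * a k) + sinh (l * a k) * rademacher k t"
          using elim[rule_format, of k] cosh_plus_sinh[of "l * a k"] cosh_minus_sinh[of "l * a k"] by auto
      qed
      finally show ?case .
    qed
  qed measurable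
  then show ?thesis using LINT_prod_affine_rademacher[OF F] by simp
qed

lemma LINT_exp_rad_sum_le:
  assumes F: "finite F" "F \<subseteq> {1..}"
  shows "(LINT t|leb01. exp (l * rad_sum a F t)) \<le> exp (l\<^sup>2 * (\<Sum>k\<in>F. (a k)\<^sup>2) / 2)"
proof -
  have "(LINT t|leb01. exp (l * rad_sum a F t)) \<le> (\<Prod>k\<in>F. exp ((l * a k)\<^sup>2 / 2))"
    unfolding LINT_exp_rad_sum[OF F] by (intro prod_mono) (simp add: cosh_le_exp_sq)
  also have "\<dots> = exp (l\<^sup>2 * (\<Sum>k\<in>F. (a k)\<^sup>2) / 2)"
    using F by (simp add: power_mult_distrib sum_distrib_left sum_divide_distrib flip: exp_sum)
  finally show ?thesis .
qed

lemma integrable_exp_rad_sum: "integrable leb01 (\<lambda>t. exp (l * rad_sum a F t))"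
proof (rule integrable_leb01_bounded)
  show "\<bar>exp (l * rad_sum a F t)\<bar> \<le> exp (\<bar>l\<bar> * (\<Sum>k\<in>F. \<bar>a k\<bar>))" for t
  proof -
    have "l * rad_sum a F t \<le> \<bar>l\<bar> * \<bar>rad_sum a F t\<bar>" by (simp flip: abs_mult)
    also have "\<dots> \<le> \<bar>l\<bar> * (\<Sum>k\<in>F. \<bar>a k\<bar>)" by (intro mult_left_mono abs_rad_sum_le) simp
    finally show ?thesis by simp
  qed
qed measurable

text \<open>The pointwise bound (l S)^(2m) \<le> (2m)! cosh(l S) is integrated, with l adapted to m.
  The shape m! (e V)^m is made for the exponential series of S^2, whose m-th term carries m! in the
  denominator.\<close>

lemma rad_sum_moment:
  assumes F: "finite F" "F \<subseteq> {1..}"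
  shows "(LINT t|leb01. (rad_sum a F t) ^ (2 * m)) \<le> fact m * (exp 1 * (\<Sum>k\<in>F. (a k)\<^sup>2)) ^ m"
proof -
  define V where "V = (\<Sum>k\<in>F. (a k)\<^sup>2)"
  have V0: "0 \<le> V" by (simp add: V_def sum_nonneg)
  consider "m = 0" | "V = 0" "m > 0" | "V > 0" "m > 0" using V0 by fastforce
  then show ?thesis
  proof cases
    case 2
    then have "a k = 0" if "k \<in> F" for k
      using that F by (auto simp: V_def sum_nonneg_eq_0_iff)
    then have "rad_sum a F t = 0" for t by (simp add: rad_sum_def)
    then show ?thesis using 2 by (simp add: power_0_left V_def[symmetric])
  next
    case 3
    \<comment> \<open>With this l the exponential moment exp(l^2 V / 2) becomes exp m, and the
      estimate (2m)! \<le> m! (2m)^m lets the factor (2m)^m of l^(2m) cancel.\<close>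
    define l where "l = sqrt (2 * real m / V)"
    have l2: "l\<^sup>2 = 2 * real m / V" using 3 by (simp add: l_def)
    have lm: "l ^ (2 * m) = (2 * real m / V) ^ m" by (simp add: power_mult l2)
    have "l ^ (2 * m) * (LINT t|leb01. (rad_sum a F t) ^ (2 * m))
        = (LINT t|leb01. (l * rad_sum a F t) ^ (2 * m))"
      by (simp add: power_mult_distrib)
    also have "\<dots> \<le> (LINT t|leb01. fact (2 * m) * ((exp (l * rad_sum a F t) + exp (- l * rad_sum a F t)) / 2))"
    proof (rule integral_mono)
      show "integrable leb01 (\<lambda>t. (l * rad_sum a F t) ^ (2 * m))"
        by (simp add: power_mult_distrib integrable_rad_sum_power)
      show "integrable leb01 (\<lambda>t. fact (2 * m) * ((exp (l * rad_sum a F t) + exp (- l * rad_sum a F t)) / 2))"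
        by (intro integrable_mult_right Bochner_Integration.integrable_add integrable_divide
             integrable_exp_rad_sum)
      show "(l * rad_sum a F t) ^ (2 * m)
          \<le> fact (2 * m) * ((exp (l * rad_sum a F t) + exp (- l * rad_sum a F t)) / 2)" for t
        using power_even_le_cosh[of "l * rad_sum a F t" m] by (simp add: cosh_field_def)
    qed
    also have "\<dots> = fact (2 * m) * (((LINT t|leb01. exp (l * rad_sum a F t)) + (LINT t|leb01. exp (- l * rad_sum a F t))) / 2)"
      by (simp only: integral_mult_right_zero integral_divide_zero
           Bochner_Integration.integral_add[OF integrable_exp_rad_sum integrable_exp_rad_sum])
    also have "\<dots> \<le> fact (2 * m) * ((exp (l\<^sup>2 * V / 2) + exp (l\<^sup>2 * V / 2)) / 2)"
      using LINT_exp_rad_sum_le[OF F, of l a] LINT_exp_rad_sum_le[OF F, of "- l" a]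
      by (intro mult_left_mono divide_right_mono add_mono) (simp_all add: V_def)
    also have "\<dots> = fact (2 * m) * exp (real m)" using 3 by (simp add: l2)
    also have "\<dots> \<le> (fact m * (2 * real m) ^ m) * exp (real m)"
    proof (intro mult_right_mono)
      have "fact (2 * m) div fact (2 * m - m) \<le> (2 * m) ^ m" by (rule fact_div_fact_le_pow) simp
      moreover have "fact (2 * m) = fact m * (fact (2 * m) div fact m :: nat)"
        by (simp add: fact_dvd)
      ultimately have "fact (2 * m) \<le> fact m * (2 * m) ^ m"
        by (metis mult_2 add_diff_cancel_right' mult_le_mono2)
      then have "real (fact (2 * m)) \<le> real (fact m * (2 * m) ^ m)" by (rule of_nat_mono)
      then show "fact (2 * m) \<le> fact m * (2 * real m) ^ m" by simp
    qed simp
    finally have "(2 * real m) ^ m / V ^ m * (LINT t|leb01. (rad_sum a F t) ^ (2 * m))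
        \<le> fact m * (2 * real m) ^ m * exp (real m)" by (simp add: lm power_divide)
    moreover have "exp (real m) = exp 1 ^ m" by (simp flip: exp_of_nat_mult)
    ultimately show ?thesis using 3 by (simp add: field_simps power_mult_distrib V_def[symmetric])
  qed simp
qed

text \<open>In the exponential series of S^2 / s^2 the m-th term has integral at most (e V / s^2)^m,
  and the assumption on s bounds this by 2^(-m).\<close>

lemma rad_sum_exp_sq:
  assumes F: "finite F" "F \<subseteq> {1..}" and s: "s > 0" "2 * exp 1 * (\<Sum>k\<in>F. (a k)\<^sup>2) \<le> s\<^sup>2"
  shows "(\<integral>\<^sup>+t. ennreal (exp ((rad_sum a F t)\<^sup>2 / s\<^sup>2)) \<partial>leb01) \<le> 2"
proof -
  let ?g = "\<lambda>m t. ((rad_sum a F t)\<^sup>2 / s\<^sup>2) ^ m / fact m"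
  have "ennreal (exp ((rad_sum a F t)\<^sup>2 / s\<^sup>2)) = (\<Sum>m. ennreal (?g m t))" for t
    using exp_converges[of "(rad_sum a F t)\<^sup>2 / s\<^sup>2"]
    by (intro suminf_ennreal_eq[symmetric]) (simp_all add: divide_inverse mult.commute)
  then have "(\<integral>\<^sup>+t. ennreal (exp ((rad_sum a F t)\<^sup>2 / s\<^sup>2)) \<partial>leb01) = (\<Sum>m. \<integral>\<^sup>+t. ennreal (?g m t) \<partial>leb01)"
    by (simp add: nn_integral_suminf)
  also have "\<dots> \<le> (\<Sum>m. ennreal ((1 / 2) ^ m))"
  proof (rule suminf_le)
    fix m
    have eq: "?g m t = (rad_sum a F t) ^ (2 * m) / (s ^ (2 * m) * fact m)" for t
      by (simp add: power_divide power_mult)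
    have "(\<integral>\<^sup>+t. ennreal (?g m t) \<partial>leb01) = ennreal (LINT t|leb01. ?g m t)"
      by (rule nn_integral_eq_integral) (auto simp only: eq intro!: integrable_divide integrable_rad_sum_power AE_I2,
          simp add: power_mult)
    also have "(LINT t|leb01. ?g m t) = (LINT t|leb01. (rad_sum a F t) ^ (2 * m)) / (s ^ (2 * m) * fact m)"
      by (simp only: eq integral_divide_zero)
    also have "\<dots> \<le> (fact m * (exp 1 * (\<Sum>k\<in>F. (a k)\<^sup>2)) ^ m) / (s ^ (2 * m) * fact m)"
      using s by (intro divide_right_mono rad_sum_moment F) simp
    also have "\<dots> = ((exp 1 * (\<Sum>k\<in>F. (a k)\<^sup>2)) / s\<^sup>2) ^ m" by (simp add: power_divide power_mult)
    also have "\<dots> \<le> (1 / 2) ^ m"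
      using s by (intro power_mono) (simp_all add: field_simps sum_nonneg)
    finally show "(\<integral>\<^sup>+t. ennreal (?g m t) \<partial>leb01) \<le> ennreal ((1 / 2) ^ m)" by (simp add: ennreal_leI)
  qed auto
  also have "\<dots> = 2"
  proof -
    have "(\<lambda>m. (1 / 2 :: real) ^ m) sums 2" using geometric_sums[of "1/2 :: real"] by simp
    then have "(\<Sum>m. ennreal ((1 / 2) ^ m)) = ennreal 2" by (intro suminf_ennreal_eq) simp_all
    then show ?thesis by (simp only: ennreal_numeral)
  qed
  finally show ?thesis .
qed

text \<open>The moment bound with m = 2, where e^2 is estimated by 9. The factor 18 decides the
  truncation levels in the small-ball estimate and in the error bound for weighted sums.\<close>

lemma rad_sum_fourth_moment:
  assumes F: "finite F" "F \<subseteq> {1..}"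
  shows "(LINT t|leb01. (rad_sum a F t) ^ 4) \<le> 18 * (\<Sum>k\<in>F. (a k)\<^sup>2)\<^sup>2"
proof -
  have "exp 1 * exp 1 \<le> (9::real)"
    using mult_mono[OF exp_le exp_le] by simp
  moreover have "(LINT t|leb01. (rad_sum a F t) ^ 4) \<le> 2 * (exp 1 * exp 1) * (\<Sum>k\<in>F. (a k)\<^sup>2)\<^sup>2"
    using rad_sum_moment[OF F, of a 2] by (simp add: power2_eq_square algebra_simps)
  moreover from calculation(1) have "2 * (exp 1 * exp 1) * (\<Sum>k\<in>F. (a k)\<^sup>2)\<^sup>2 \<le> 2 * 9 * (\<Sum>k\<in>F. (a k)\<^sup>2)\<^sup>2"
    by (intro mult_right_mono mult_left_mono) simp_all
  ultimately show ?thesis by linarith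
qed

text \<open>Markov's inequality: on the exceptional set exp(f^2 / s^2) is at least e / t, so its
  measure is at most 2 t / e, and 2 \<le> e.\<close>

lemma rearr_le_of_exp_sq:
  assumes f [measurable]: "f \<in> borel_measurable leb01" and s: "s > 0"
    and ex: "(\<integral>\<^sup>+t. ennreal (exp ((f t)\<^sup>2 / s\<^sup>2)) \<partial>leb01) \<le> 2" and t: "0 < t" "t \<le> 1"
  shows "rearr f t \<le> s * sqrt (ln (exp 1 / t))"
proof (rule rearr_le)
  have ln: "ln (exp 1 / t) = 1 - ln t" using t by (simp add: ln_div)
  have ln0: "0 \<le> ln (exp 1 / t)" using ln_bound[of t] t by (simp add: ln)
  then show "0 \<le> s * sqrt (ln (exp 1 / t))" using s by simp
  let ?B = "{u \<in> {0..1}. \<bar>f u\<bar> > s * sqrt (ln (exp 1 / t))}"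
  have B: "?B \<in> sets leb01" by (rule distr_set_sets) simp
  have "ennreal (exp 1 / t) * emeasure leb01 ?B = (\<integral>\<^sup>+u. ennreal (exp 1 / t) * indicator ?B u \<partial>leb01)"
    using B by (simp add: nn_integral_cmult_indicator)
  also have "\<dots> \<le> (\<integral>\<^sup>+u. ennreal (exp ((f u)\<^sup>2 / s\<^sup>2)) \<partial>leb01)"
  proof (rule nn_integral_mono)
    fix u
    show "ennreal (exp 1 / t) * indicator ?B u \<le> ennreal (exp ((f u)\<^sup>2 / s\<^sup>2))"
    proof (cases "u \<in> ?B")
      case True
      then have "s * sqrt (ln (exp 1 / t)) \<le> \<bar>f u\<bar>" by simp
      then have "(s * sqrt (ln (exp 1 / t)))\<^sup>2 \<le> \<bar>f u\<bar>\<^sup>2"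
        using s ln0 by (intro power_mono) auto
      then have "s\<^sup>2 * ln (exp 1 / t) \<le> (f u)\<^sup>2" using ln0 by (simp add: power_mult_distrib)
      then have "ln (exp 1 / t) \<le> (f u)\<^sup>2 / s\<^sup>2" using s by (simp add: pos_le_divide_eq mult.commute)
      then have "exp (ln (exp 1 / t)) \<le> exp ((f u)\<^sup>2 / s\<^sup>2)" by simp
      then show ?thesis using True t by (simp add: ennreal_leI)
    qed simp
  qed
  also have "\<dots> \<le> ennreal 2" using ex by simp
  finally have "exp 1 / t * distr_fun f (s * sqrt (ln (exp 1 / t))) \<le> 2"
    using t by (simp add: leb01.emeasure_eq_measure distr_fun_def flip: ennreal_mult ennreal_numeral)
  moreover have "2 \<le> exp (1::real)" using exp_ge_add_one_self[of 1] by simp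
  ultimately have "exp 1 / t * distr_fun f (s * sqrt (ln (exp 1 / t))) \<le> exp 1" by linarith
  then show "distr_fun f (s * sqrt (ln (exp 1 / t))) \<le> t" using t by (simp add: field_simps)
qed

text \<open>The shifted Walsh products form an orthonormal sequence, so by Bessel's inequality their
  coefficients against the indicator of D are square-summable.\<close>

lemma LINT_indicator_prod_rademacher_tendsto:
  assumes D: "D \<in> sets leb01" and X: "finite X" "X \<noteq> {}" "X \<subseteq> {1..}"
  shows "(\<lambda>j. LINT t|leb01. indicator D t * (\<Prod>k\<in>X. rademacher (k + j) t)) \<longlonglongrightarrow> 0"
proof -
  define e where "e j t = (\<Prod>k\<in>X. rademacher (k + j) t)" for j t
  define c where "c j = (LINT t|leb01. indicator D t * e j t)" for j
  have e_meas [measurable]: "e j \<in> borel_measurable leb01" for j unfolding e_def by measurable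
  have e_le: "\<bar>e j t\<bar> \<le> 1" for j t
    by (simp add: e_def abs_prod abs_rademacher_le_1 prod_le_1)
  have e_eq: "e j t = (\<Prod>m\<in>(\<lambda>k. k + j) ` X. rademacher m t)" for j t
    by (simp add: e_def prod.reindex inj_on_def)
  have orth: "(LINT t|leb01. e i t * e j t) = (if i = j then 1 else 0)" for i j
  proof -
    \<comment> \<open>Distinct shifts give distinct index sets: the sums of the elements differ by
      the cardinality of X times the difference of the shifts.\<close>
    have "(\<lambda>k. k + i) ` X = (\<lambda>k. k + j) ` X \<longleftrightarrow> i = j"
    proof
      assume eq: "(\<lambda>k. k + i) ` X = (\<lambda>k. k + j) ` X"
      have "\<Sum> ((\<lambda>k. k + l) ` X) = \<Sum> X + card X * l" for l
        by (simp add: sum.reindex inj_on_def sum.distrib)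
      with eq have "card X * i = card X * j" by (metis add_left_cancel)
      then show "i = j" using X by simp
    qed simp
    then show ?thesis
      unfolding e_eq using X by (subst LINT_prod_rademacher_mult) auto
  qed
  have Dm: "(\<lambda>t. indicator D t :: real) \<in> borel_measurable leb01" using D by simp
  have "(\<Sum>j\<in>J. (c j)\<^sup>2) \<le> 1" if "finite J" for J
  proof -
    have "(\<Sum>j\<in>J. (c j)\<^sup>2) \<le> (LINT t|leb01. (indicator D t :: real)\<^sup>2)"
      unfolding c_def
      by (rule Bessel_leb01[OF that e_meas e_le orth Dm])
         (use D in \<open>auto simp: power2_eq_square intro!: integrable_leb01_bounded[where B = 1] split: split_indicator\<close>)
    also have "\<dots> = measure leb01 D"
      using D by (simp add: power2_eq_square sets_leb01_iff Int_absorb2 flip: indicator_inter_arith)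
    finally show ?thesis using measure_leb01_le_1[of D] by simp
  qed
  then have "summable (\<lambda>j. (c j)\<^sup>2)" by (intro summableI_nonneg_bounded[where x = 1]) auto
  then have "(\<lambda>j. sqrt ((c j)\<^sup>2)) \<longlonglongrightarrow> sqrt 0" by (intro tendsto_real_sqrt summable_LIMSEQ_zero)
  then show ?thesis by (simp add: c_def e_def tendsto_rabs_zero_iff)
qed

text \<open>Far out, a block of fixed length becomes independent of a fixed set D. Only finitely
  many Walsh products occur in the expansion, so the limit may be taken in each of them.\<close>

lemma LINT_indicator_prod_affine_tendsto:
  assumes D: "D \<in> sets leb01" and A: "finite A" "A \<subseteq> {1..}"
  shows "(\<lambda>j. LINT t|leb01. indicator D t * (\<Prod>k\<in>A. \<alpha> k + \<beta> k * rademacher (k + j) t))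
    \<longlonglongrightarrow> measure leb01 D * (\<Prod>k\<in>A. \<alpha> k)"
proof -
  define W where "W X j = (LINT t|leb01. indicator D t * (\<Prod>k\<in>X. rademacher (k + j) t))" for X j
  have [measurable]: "D \<in> sets leb01" by (rule D)
  have bd: "\<bar>indicator D t * (\<Prod>k\<in>X. rademacher (k + j) t)\<bar> \<le> 1" for X j t
    by (auto simp: abs_mult abs_prod abs_rademacher_le_1 prod_le_1 split: split_indicator)
  have int: "integrable leb01 (\<lambda>t. (\<Prod>k\<in>X. \<beta> k) * (indicator D t * (\<Prod>k\<in>X. rademacher (k + j) t)) * (\<Prod>k\<in>A-X. \<alpha> k))" for X j
    by (intro integrable_mult_left integrable_mult_right integrable_leb01_bounded[OF _ bd]) measurable
  have eq: "(LINT t|leb01. indicator D t * (\<Prod>k\<in>A. \<alpha> k + \<beta> k * rademacher (k + j) t))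
    = (\<Sum>X\<in>Pow A. (\<Prod>k\<in>X. \<beta> k) * W X j * (\<Prod>k\<in>A-X. \<alpha> k))" for j
  proof -
    have "(LINT t|leb01. indicator D t * (\<Prod>k\<in>A. \<alpha> k + \<beta> k * rademacher (k + j) t))
      = (LINT t|leb01. (\<Sum>X\<in>Pow A. (\<Prod>k\<in>X. \<beta> k) * (indicator D t * (\<Prod>k\<in>X. rademacher (k + j) t)) * (\<Prod>k\<in>A-X. \<alpha> k)))"
      by (simp add: add.commute[of "\<alpha> _"] prod_add[OF A(1)] prod.distrib sum_distrib_left mult.assoc mult.left_commute)
    also have "\<dots> = (\<Sum>X\<in>Pow A. (\<Prod>k\<in>X. \<beta> k) * W X j * (\<Prod>k\<in>A-X. \<alpha> k))"
      by (subst Bochner_Integration.integral_sum[OF int]) (simp add: W_def)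
    finally show ?thesis .
  qed
  have lim: "W X \<longlonglongrightarrow> (if X = {} then measure leb01 D else 0)" if "X \<in> Pow A" for X
  proof (cases "X = {}")
    case True
    have "W {} = (\<lambda>_. measure leb01 D)"
      using D by (simp add: W_def fun_eq_iff sets_leb01_iff Int_absorb2)
    then show ?thesis using True by simp
  next
    case False
    then show ?thesis
      using LINT_indicator_prod_rademacher_tendsto[OF D, of X] that A finite_subset[of X A]
      by (auto simp: W_def[abs_def])
  qed
  have "(\<lambda>j. \<Sum>X\<in>Pow A. (\<Prod>k\<in>X. \<beta> k) * W X j * (\<Prod>k\<in>A-X. \<alpha> k))
    \<longlonglongrightarrow> (\<Sum>X\<in>Pow A. (\<Prod>k\<in>X. \<beta> k) * (if X = {} then measure leb01 D else 0) * (\<Prod>k\<in>A-X. \<alpha> k))"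
    by (intro tendsto_sum tendsto_mult tendsto_const lim)
  also have "(\<Sum>X\<in>Pow A. (\<Prod>k\<in>X. \<beta> k) * (if X = {} then measure leb01 D else 0) * (\<Prod>k\<in>A-X. \<alpha> k))
    = (\<Sum>X\<in>Pow A. if X = {} then measure leb01 D * (\<Prod>k\<in>A. \<alpha> k) else 0)"
    by (intro sum.cong) auto
  also have "\<dots> = measure leb01 D * (\<Prod>k\<in>A. \<alpha> k)" using A by (simp add: sum.delta)
  finally show ?thesis by (simp add: eq)
qed

text \<open>A Paley--Zygmund argument for \<open>exp (\<lambda> S)\<close> in place of the central limit theorem.\<close>

lemma rad_sum_tail_on_set:
  fixes l :: real
  assumes D: "D \<in> sets leb01" and mD: "measure leb01 D > 0" and l: "4 \<le> l" "l\<^sup>2 \<le> 4 * real n"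
  shows "eventually (\<lambda>j. measure leb01 {t \<in> D. l / 8 \<le> rad_sum (\<lambda>_. 1 / sqrt (real n)) {1 + j..n + j} t}
    \<ge> (measure leb01 D)\<^sup>2 / 64 * exp (- (3 / 2) * l\<^sup>2)) sequentially"
proof -
  define \<mu> where "\<mu> = measure leb01 D"
  define S where "S j = rad_sum (\<lambda>_. 1 / sqrt (real n)) {1 + j..n + j}" for j
  define x where "x = l / sqrt (real n)"
  define E where "E = cosh x ^ n"
  have [measurable]: "D \<in> sets leb01" "S j \<in> borel_measurable leb01" for j by (auto simp: D S_def)
  have n: "n > 0" using l by (cases n) (auto simp: power2_eq_square mult_le_0_iff)
  have x2: "x\<^sup>2 = l\<^sup>2 / real n" using n by (simp add: x_def power_divide)
  \<comment> \<open>With u = x^2 / 2 one has cosh x \<ge> 1 + u. The assumption l^2 \<le> 4 n says u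
    \<le> 2, which gives exp(u / 2) \<le> 1 + u; the n-th power of exp(u / 2) is exp(l^2 /
    4).\<close>
  have E: "exp (l\<^sup>2 / 4) \<le> E"
  proof -
    define u where "u = l\<^sup>2 / (2 * real n)"
    have u: "0 \<le> u" "u \<le> 2" using l n by (auto simp: u_def field_simps)
    have "exp (u / 2) \<le> 1 + u / 2 + (u / 2)\<^sup>2" using u by (intro exp_bound) auto
    also have "\<dots> \<le> 1 + u" using mult_right_mono[OF u(2,1)] by (simp add: power2_eq_square)
    also have "1 + u \<le> cosh x"
    proof -
      have "(\<Sum>i\<in>{0,1}. x ^ (2 * i) / fact (2 * i)) \<le> cosh x"
        unfolding sums_unique[OF cosh_sums_even[of x]]
        by (intro sum_le_suminf sums_summable[OF cosh_sums_even]) (auto simp: power_mult)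
      then show ?thesis by (simp add: u_def x2)
    qed
    finally have "exp (u / 2) ^ n \<le> cosh x ^ n" by (intro power_mono) auto
    then show ?thesis using n by (simp add: E_def u_def flip: exp_of_nat_mult)
  qed
  have E0: "E > 0" by (simp add: E_def)
  have expS: "(LINT t|leb01. indicator D t * exp (l * S j t))
      = (LINT t|leb01. indicator D t * (\<Prod>k\<in>{1..n}. cosh x + sinh x * rademacher (k + j) t))" for j
  proof (rule integral_cong_AE)
    show "AE t in leb01. indicator D t * exp (l * S j t)
        = indicator D t * (\<Prod>k\<in>{1..n}. cosh x + sinh x * rademacher (k + j) t)"
      using AE_rademacher_sign
    proof eventually_elim
      case (elim t)
      have "l * S j t = (\<Sum>k\<in>{1..n}. x * rademacher (k + j) t)"
        unfolding S_def rad_sum_def x_def sum_distrib_left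
        by (rule sum.reindex_bij_witness[of _ "\<lambda>k. k + j" "\<lambda>k. k - j"]) auto
      then have "exp (l * S j t) = (\<Prod>k\<in>{1..n}. exp (x * rademacher (k + j) t))"
        by (simp add: exp_sum)
      also have "\<dots> = (\<Prod>k\<in>{1..n}. cosh x + sinh x * rademacher (k + j) t)"
      proof (rule prod.cong[OF refl])
        fix k
        show "exp (x * rademacher (k + j) t) = cosh x + sinh x * rademacher (k + j) t"
          using elim[rule_format, of "k + j"] cosh_plus_sinh[of x] cosh_minus_sinh[of x] by auto
      qed
      finally show ?case by simp
    qed
  qed measurable
  have "(\<lambda>j. LINT t|leb01. indicator D t * exp (l * S j t)) \<longlonglongrightarrow> \<mu> * E"
    unfolding expS \<mu>_def E_def
    using LINT_indicator_prod_affine_tendsto[OF D, of "{1..n}" "\<lambda>_. cosh x" "\<lambda>_. sinh x"] by simp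
  then have "eventually (\<lambda>j. \<mu> * E / 2 < (LINT t|leb01. indicator D t * exp (l * S j t))) sequentially"
    by (rule order_tendstoD) (use mD E0 in \<open>simp add: \<mu>_def\<close>)
  then show ?thesis
  proof eventually_elim
    case (elim j)
    let ?B = "{t \<in> D. l / 8 \<le> S j t}"
    have DB: "D \<subseteq> {0..1}" using D by (simp add: sets_leb01_iff)
    have B [measurable]: "?B \<in> sets leb01"
    proof -
      have "D \<inter> {t \<in> space leb01. l / 8 \<le> S j t} \<in> sets leb01" by measurable
      moreover have "D \<inter> {t \<in> space leb01. l / 8 \<le> S j t} = ?B" using DB by auto
      ultimately show ?thesis by simp
    qed
    \<comment> \<open>On D the exponential is at most exp(l^2 / 8) off \<open>?B\<close>, and at
      most K + exp(2 l S) / K on it. This K makes the integral of the last term at most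
      \<open>\<mu> * exp (l\<^sup>2 / 4) / 8\<close>, hence at most a quarter of the available
      \<open>\<mu> * E / 2\<close>.\<close>
    define K where "K = 8 * exp (2 * l\<^sup>2) / (\<mu> * exp (l\<^sup>2 / 4))"
    have K: "K > 0" using mD by (simp add: K_def \<mu>_def)
    have intD: "integrable leb01 (\<lambda>t. indicator D t * c :: real)" for c by (intro integrable_leb01_bounded[where B = "\<bar>c\<bar>"]) (auto split: split_indicator)
    have intB: "integrable leb01 (\<lambda>t. indicator ?B t * c :: real)" for c by (intro integrable_leb01_bounded[where B = "\<bar>c\<bar>"]) (auto split: split_indicator)
    have int2: "integrable leb01 (\<lambda>t. exp (2 * l * S j t) / K)"
      unfolding S_def by (intro integrable_divide integrable_exp_rad_sum)
    have "\<mu> * E / 2 < (LINT t|leb01. indicator D t * exp (l * S j t))" by (rule elim)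
    also have "\<dots> \<le> (LINT t|leb01. indicator D t * exp (l\<^sup>2 / 8) + (indicator ?B t * K + exp (2 * l * S j t) / K))"
    proof (rule integral_mono)
      show "integrable leb01 (\<lambda>t. indicator D t * exp (l * S j t))"
        using integrable_mult_bounded[OF integrable_exp_rad_sum, of "\<lambda>t. indicator D t" 1]
        by (simp add: S_def mult.commute)
      show "integrable leb01 (\<lambda>t. indicator D t * exp (l\<^sup>2 / 8) + (indicator ?B t * K + exp (2 * l * S j t) / K))"
        by (intro Bochner_Integration.integrable_add intD intB int2)
      fix t
      have pos: "0 < exp (2 * l * S j t) / K" using K by simp
      show "indicator D t * exp (l * S j t) \<le> indicator D t * exp (l\<^sup>2 / 8) + (indicator ?B t * K + exp (2 * l * S j t) / K)"
      proof (cases "t \<in> D")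
        case tD: True
        show ?thesis
        proof (cases "l / 8 \<le> S j t")
          case True
          have "exp (l * S j t) \<le> K + exp (2 * l * S j t) / K"
          proof (cases "exp (l * S j t) \<le> K")
            case False
            then have "K * exp (l * S j t) \<le> exp (l * S j t) * exp (l * S j t)" by simp
            also have "\<dots> = exp (2 * l * S j t)" by (simp flip: exp_add)
            finally have "exp (l * S j t) \<le> exp (2 * l * S j t) / K" using K by (simp add: field_simps)
            then show ?thesis using K by simp
          qed (use pos in simp)
          then show ?thesis using tD True by (simp add: add_increasing)
        next
          case False
          then have "l * S j t \<le> l\<^sup>2 / 8" using l by (simp add: power2_eq_square mult_left_mono)
          then have *: "exp (l * S j t) \<le> exp (l\<^sup>2 / 8)" by simp
          have ind: "indicator D t = (1::real)" "indicator ?B t = (0::real)" using tD False by auto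
          show ?thesis unfolding ind using * pos by linarith
        qed
      qed (use pos in simp)
    qed
    also have "\<dots> = \<mu> * exp (l\<^sup>2 / 8) + (measure leb01 ?B * K + (LINT t|leb01. exp (2 * l * S j t)) / K)"
      using DB B
      by (subst Bochner_Integration.integral_add[OF intD Bochner_Integration.integrable_add[OF intB int2]],
          subst Bochner_Integration.integral_add[OF intB int2])
         (simp add: \<mu>_def sets_leb01_iff Int_absorb2)
    also have "\<dots> \<le> \<mu> * exp (l\<^sup>2 / 8) + (measure leb01 ?B * K + exp (2 * l\<^sup>2) / K)"
    proof -
      have "(LINT t|leb01. exp (2 * l * S j t)) \<le> exp ((2 * l)\<^sup>2 * (\<Sum>k\<in>{1 + j..n + j}. (1 / sqrt (real n))\<^sup>2) / 2)"
        unfolding S_def by (rule LINT_exp_rad_sum_le) auto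
      also have "\<dots> = exp (2 * l\<^sup>2)" using n by (simp add: power_divide power_mult_distrib)
      finally show ?thesis using K by (simp add: divide_right_mono)
    qed
    also have "exp (2 * l\<^sup>2) / K = \<mu> * exp (l\<^sup>2 / 4) / 8" using mD by (simp add: K_def \<mu>_def)
    finally have main: "\<mu> * E / 2 < \<mu> * exp (l\<^sup>2 / 8) + (measure leb01 ?B * K + \<mu> * exp (l\<^sup>2 / 4) / 8)" .
    \<comment> \<open>Here l \<ge> 4 enters, through exp(l^2 / 8) \<ge> exp 2 \<ge> 5. It makes the
      contribution from below the threshold at most half of \<open>\<mu> * E / 2\<close>, so that a
      definite share is left for \<open>?B\<close>.\<close>
    have "4 \<le> exp (l\<^sup>2 / 8)"
    proof -
      have "4\<^sup>2 \<le> l\<^sup>2" using l by (intro power_mono) auto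
      then have "exp 2 \<le> exp (l\<^sup>2 / 8)" by simp
      moreover have "5 \<le> exp (2::real)" using exp_lower_Taylor_quadratic[of 2] by simp
      ultimately show ?thesis by linarith
    qed
    then have "4 * exp (l\<^sup>2 / 8) \<le> exp (l\<^sup>2 / 8) * exp (l\<^sup>2 / 8)" by simp
    also have "\<dots> = exp (l\<^sup>2 / 4)" by (simp flip: exp_add)
    finally have "\<mu> * (4 * exp (l\<^sup>2 / 8)) \<le> \<mu> * exp (l\<^sup>2 / 4)" "\<mu> * exp (l\<^sup>2 / 4) \<le> \<mu> * E"
      using mD E by (auto simp: \<mu>_def)
    with main have "\<mu> * exp (l\<^sup>2 / 4) / 8 \<le> measure leb01 ?B * K" by simp
    then have "\<mu> * exp (l\<^sup>2 / 4) / (8 * K) \<le> measure leb01 ?B" using K by (simp add: field_simps)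
    moreover have "\<mu> * exp (l\<^sup>2 / 4) / (8 * K) = \<mu>\<^sup>2 / 64 * (exp (l\<^sup>2 / 4) * exp (l\<^sup>2 / 4) / exp (2 * l\<^sup>2))"
      using mD by (simp add: K_def \<mu>_def power2_eq_square)
    moreover have "exp (l\<^sup>2 / 4) * exp (l\<^sup>2 / 4) / exp (2 * l\<^sup>2) = exp (- (3 / 2) * l\<^sup>2)"
      by (simp flip: exp_add exp_diff)
    ultimately show ?case by (simp add: S_def \<mu>_def)
  qed
qed

text \<open>A function of \<open>r\<^sub>1, \<dots>, r\<^sub>j\<close> is orthogonal to the later \<open>r\<^sub>k\<close>: expand it over the sign patterns,
  whose indicators are products of affine functions of the \<open>r\<^sub>i\<close>.\<close>

lemma LINT_adapted_rademacher:
  fixes \<Phi> :: "(nat \<Rightarrow> real) \<Rightarrow> real"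
  assumes k: "j < k" and u [measurable]: "u \<in> borel_measurable leb01"
    and u_eq: "\<And>t. t \<in> {0..1} \<Longrightarrow> u t = \<Phi> (restrict (\<lambda>i. rademacher i t) {1..j})"
  shows "(LINT t|leb01. u t * rademacher k t) = 0"
proof -
  define P where "P = PiE {1..j} (\<lambda>_. {-1, 1::real})"
  have P: "finite P" unfolding P_def by (intro finite_PiE) auto
  \<comment> \<open>For a sign pattern \<open>\<epsilon>\<close> this product is, up to a null set,
    the indicator of the points whose first j signs are given by \<open>\<epsilon>\<close>.\<close>
  define g where "g \<epsilon> t = (\<Prod>i\<in>{1..j}. 1 / 2 + \<epsilon> i / 2 * rademacher i t)" for \<epsilon> :: "nat \<Rightarrow> real" and t
  have g_le: "\<bar>g \<epsilon> t\<bar> \<le> 1" if "\<epsilon> \<in> P" for \<epsilon> t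
    unfolding g_def abs_prod
  proof (intro prod_le_1 conjI)
    fix i assume "i \<in> {1..j}"
    then have "\<epsilon> i = -1 \<or> \<epsilon> i = 1" using that by (auto simp: P_def)
    then show "\<bar>1 / 2 + \<epsilon> i / 2 * rademacher i t\<bar> \<le> 1" using abs_rademacher_le_1[of i t] by auto
  qed simp
  have g_meas [measurable]: "g \<epsilon> \<in> borel_measurable leb01" for \<epsilon> unfolding g_def by measurable
  have int: "integrable leb01 (\<lambda>t. \<Phi> \<epsilon> * (g \<epsilon> t * rademacher k t))" if "\<epsilon> \<in> P" for \<epsilon>
    by (intro integrable_mult_right integrable_mult_bounded[where B = 1]
        integrable_leb01_bounded[OF g_meas g_le[OF that]]) (auto simp: abs_rademacher_le_1)
  have "(LINT t|leb01. u t * rademacher k t) = (LINT t|leb01. (\<Sum>\<epsilon>\<in>P. \<Phi> \<epsilon> * (g \<epsilon> t * rademacher k t)))"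
  proof (rule integral_cong_AE)
    show "AE t in leb01. u t * rademacher k t = (\<Sum>\<epsilon>\<in>P. \<Phi> \<epsilon> * (g \<epsilon> t * rademacher k t))"
      using AE_rademacher_sign AE_space
    proof eventually_elim
      case (elim t)
      let ?\<rho> = "restrict (\<lambda>i. rademacher i t) {1..j}"
      have \<rho>: "?\<rho> \<in> P" unfolding P_def using elim(1) by (intro restrict_PiE_iff[THEN iffD2]) auto
      have "g \<epsilon> t = (if \<epsilon> = ?\<rho> then 1 else 0)" if "\<epsilon> \<in> P" for \<epsilon>
      proof (cases "\<epsilon> = ?\<rho>")
        case True
        have "1 / 2 + \<epsilon> i / 2 * rademacher i t = 1" if "i \<in> {1..j}" for i
          using elim(1)[rule_format, of i] that True by auto
        then show ?thesis using True by (simp add: g_def)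
      next
        case False
        then obtain i where i: "i \<in> {1..j}" "\<epsilon> i \<noteq> rademacher i t"
          using PiE_ext[OF \<open>\<epsilon> \<in> P\<close>[unfolded P_def] \<rho>[unfolded P_def]] by (metis restrict_apply')
        then have "\<epsilon> i = -1 \<or> \<epsilon> i = 1" using that by (auto simp: P_def)
        then have "1 / 2 + \<epsilon> i / 2 * rademacher i t = 0" using elim(1)[rule_format, of i] i by auto
        then show ?thesis using False i by (auto simp: g_def prod_zero_iff)
      qed
      then have "(\<Sum>\<epsilon>\<in>P. \<Phi> \<epsilon> * (g \<epsilon> t * rademacher k t)) = (\<Sum>\<epsilon>\<in>P. if \<epsilon> = ?\<rho> then \<Phi> ?\<rho> * rademacher k t else 0)"
        by (intro sum.cong) auto
      also have "\<dots> = u t * rademacher k t" using P \<rho> elim(2) by (simp add: u_eq)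
      finally show ?case by simp
    qed
  qed measurable
  also have "\<dots> = (\<Sum>\<epsilon>\<in>P. \<Phi> \<epsilon> * (LINT t|leb01. g \<epsilon> t * rademacher k t))"
    by (subst Bochner_Integration.integral_sum[OF int]) simp_all
  also have "\<dots> = 0"
  proof (intro sum.neutral ballI)
    fix \<epsilon> :: "nat \<Rightarrow> real"
    \<comment> \<open>Multiplication by r_k appends a factor with constant term 0, so the formula
      for products of affine functions gives the integral 0.\<close>
    let ?\<alpha> = "\<lambda>i. if i = k then 0 else 1 / 2 :: real" and ?\<beta> = "\<lambda>i. if i = k then 1 else \<epsilon> i / 2"
    have "g \<epsilon> t * rademacher k t = (\<Prod>i\<in>insert k {1..j}. ?\<alpha> i + ?\<beta> i * rademacher i t)" for t
    proof -
      have "g \<epsilon> t = (\<Prod>i\<in>{1..j}. ?\<alpha> i + ?\<beta> i * rademacher i t)"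
        unfolding g_def using k by (intro prod.cong) auto
      then show ?thesis using k by (subst prod.insert) (auto simp: mult.commute)
    qed
    then have "(LINT t|leb01. g \<epsilon> t * rademacher k t)
        = (LINT t|leb01. (\<Prod>i\<in>insert k {1..j}. ?\<alpha> i + ?\<beta> i * rademacher i t))"
      by (simp only:)
    also have "\<dots> = (\<Prod>i\<in>insert k {1..j}. ?\<alpha> i)"
      by (rule LINT_prod_affine_rademacher) (use k in auto)
    also have "\<dots> = 0" using k by (subst prod.insert) auto
    finally show "\<Phi> \<epsilon> * (LINT t|leb01. g \<epsilon> t * rademacher k t) = 0" by simp
  qed
  finally show ?thesis .
qed

text \<open>Kolmogorov's maximal inequality. The event is split according to the first index j at
  which the partial sum exceeds \<tau>. That piece is determined by the first j signs, so on it S_n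
  - S_j is orthogonal to S_j.\<close>

lemma Kolmogorov_rademacher:
  assumes \<tau>: "\<tau> > 0"
  shows "measure leb01 {t \<in> {0..1}. \<exists>j\<in>{1..n}. \<tau> < \<bar>rad_sum a {1..j} t\<bar>} \<le> (\<Sum>k=1..n. (a k)\<^sup>2) / \<tau>\<^sup>2"
proof -
  define S where "S j = rad_sum a {1..j}" for j
  have S_meas [measurable]: "S j \<in> borel_measurable leb01" for j by (simp add: S_def)
  define B where "B j = {t \<in> {0..1}. \<tau> < \<bar>S j t\<bar> \<and> (\<forall>i\<in>{1..<j}. \<bar>S i t\<bar> \<le> \<tau>)}" for j
  have B [measurable]: "B j \<in> sets leb01" for j
  proof -
    have "{t \<in> space leb01. \<tau> < \<bar>S j t\<bar> \<and> (\<forall>i\<in>{1..<j}. \<bar>S i t\<bar> \<le> \<tau>)} \<in> sets leb01" by measurable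
    then show ?thesis by (simp add: B_def)
  qed
  have disj: "disjoint_family_on B {1..n}"
  proof (unfold disjoint_family_on_def, intro ballI impI)
    have *: "B i \<inter> B j = {}" if "i < j" "i \<in> {1..n}" for i j
      using that by (force simp: B_def not_less[symmetric])
    fix i j assume "i \<in> {1..n}" "j \<in> {1..n}" "i \<noteq> j"
    then show "B i \<inter> B j = {}" using *[of i j] *[of j i] by (cases i j rule: linorder_cases) auto
  qed
  have U: "{t \<in> {0..1}. \<exists>j\<in>{1..n}. \<tau> < \<bar>S j t\<bar>} = (\<Union>j\<in>{1..n}. B j)"
  proof (intro equalityI subsetI)
    fix t assume t: "t \<in> {t \<in> {0..1}. \<exists>j\<in>{1..n}. \<tau> < \<bar>S j t\<bar>}"
    define j where "j = (LEAST j. j \<in> {1..n} \<and> \<tau> < \<bar>S j t\<bar>)"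
    have j: "j \<in> {1..n} \<and> \<tau> < \<bar>S j t\<bar>" unfolding j_def by (rule LeastI_ex) (use t in auto)
    have "\<bar>S i t\<bar> \<le> \<tau>" if "i \<in> {1..<j}" for i
      using not_less_Least[of i "\<lambda>j. j \<in> {1..n} \<and> \<tau> < \<bar>S j t\<bar>"] that j by (auto simp: j_def)
    then show "t \<in> (\<Union>j\<in>{1..n}. B j)" using j t by (auto simp: B_def)
  qed (auto simp: B_def)
  have int: "integrable leb01 (\<lambda>t. indicator (B j) t * (S i t * S l t))" for i j l
  proof (rule integrable_leb01_bounded)
    show "\<bar>indicator (B j) t * (S i t * S l t)\<bar> \<le> (\<Sum>k\<in>{1..i}. \<bar>a k\<bar>) * (\<Sum>k\<in>{1..l}. \<bar>a k\<bar>)" for t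
      using mult_mono[OF abs_rad_sum_le[of a "{1..i}" t] abs_rad_sum_le[of a "{1..l}" t]]
      by (auto simp: S_def abs_mult sum_nonneg split: split_indicator)
  qed measurable
  have orth: "(LINT t|leb01. indicator (B j) t * (S j t * S n t)) = (LINT t|leb01. indicator (B j) t * (S j t * S j t))"
    if "j \<in> {1..n}" for j
  proof -
    have split: "S n t = S j t + (\<Sum>k\<in>{j<..n}. a k * rademacher k t)" for t
    proof -
      have *: "{1..n} = {1..j} \<union> {j<..n}" using that by auto
      show ?thesis unfolding S_def rad_sum_def * by (subst sum.union_disjoint) auto
    qed
    have zero: "(LINT t|leb01. (indicator (B j) t * S j t) * rademacher k t) = 0" if "k \<in> {j<..n}" for k
    proof (rule LINT_adapted_rademacher)
      let ?s = "\<lambda>i \<rho>. \<Sum>k\<in>{1..i}. a k * \<rho> k"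
      let ?\<Phi> = "\<lambda>\<rho>. if \<tau> < \<bar>?s j \<rho>\<bar> \<and> (\<forall>i\<in>{1..<j}. \<bar>?s i \<rho>\<bar> \<le> \<tau>) then ?s j \<rho> else 0"
      show "j < k" using that by simp
      show "(\<lambda>t. indicator (B j) t * S j t) \<in> borel_measurable leb01" by measurable
      fix t :: real assume t: "t \<in> {0..1}"
      have "?s i (restrict (\<lambda>i. rademacher i t) {1..j}) = S i t" if "i \<le> j" for i
        unfolding S_def rad_sum_def using that by (intro sum.cong) auto
      then show "indicator (B j) t * S j t = ?\<Phi> (restrict (\<lambda>i. rademacher i t) {1..j})"
        using t by (auto simp: B_def split: split_indicator)
    qed
    have intr: "integrable leb01 (\<lambda>t. a k * (indicator (B j) t * S j t * rademacher k t))" for k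
    proof (intro integrable_mult_right integrable_leb01_bounded)
      show "\<bar>indicator (B j) t * S j t * rademacher k t\<bar> \<le> (\<Sum>k\<in>{1..j}. \<bar>a k\<bar>) * 1" for t
        using mult_mono[OF abs_rad_sum_le[of a "{1..j}" t] abs_rademacher_le_1[of k t]]
        by (auto simp: S_def abs_mult sum_nonneg split: split_indicator)
    qed measurable
    have "(LINT t|leb01. indicator (B j) t * (S j t * S n t))
      = (LINT t|leb01. indicator (B j) t * (S j t * S j t)
          + (\<Sum>k\<in>{j<..n}. a k * (indicator (B j) t * S j t * rademacher k t)))"
      by (simp add: split sum_distrib_left algebra_simps)
    also have "\<dots> = (LINT t|leb01. indicator (B j) t * (S j t * S j t))
          + (\<Sum>k\<in>{j<..n}. a k * (LINT t|leb01. (indicator (B j) t * S j t) * rademacher k t))"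
      by (subst Bochner_Integration.integral_add[OF int Bochner_Integration.integrable_sum[OF intr]],
          subst Bochner_Integration.integral_sum[OF intr]) simp
    also have "\<dots> = (LINT t|leb01. indicator (B j) t * (S j t * S j t))"
      by (simp add: zero)
    finally show ?thesis .
  qed
  have "\<tau>\<^sup>2 * measure leb01 (\<Union>j\<in>{1..n}. B j) = (\<Sum>j\<in>{1..n}. \<tau>\<^sup>2 * measure leb01 (B j))"
    using disj by (subst leb01.finite_measure_finite_Union) (auto simp: sum_distrib_left)
  also have "\<dots> \<le> (\<Sum>j\<in>{1..n}. LINT t|leb01. indicator (B j) t * (S n t * S n t))"
  proof (rule sum_mono)
    fix j assume j: "j \<in> {1..n}"
    have "\<tau>\<^sup>2 * measure leb01 (B j) = (LINT t|leb01. indicator (B j) t * \<tau>\<^sup>2)"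
      using B[of j] by (simp add: sets_leb01_iff Int_absorb2)
    also have "\<dots> \<le> (LINT t|leb01. indicator (B j) t * (S j t * S j t))"
    proof (rule integral_mono[OF _ int])
      show "integrable leb01 (\<lambda>t. indicator (B j) t * \<tau>\<^sup>2)"
        by (intro integrable_leb01_bounded[where B = "\<tau>\<^sup>2"]) (auto split: split_indicator)
      fix t
      show "indicator (B j) t * \<tau>\<^sup>2 \<le> indicator (B j) t * (S j t * S j t)"
        using \<tau> power_mono[of \<tau> "\<bar>S j t\<bar>" 2]
        by (auto simp: B_def power2_eq_square split: split_indicator)
    qed
    \<comment> \<open>By orthogonality the integral of S_j^2 over the piece equals that of 2 S_j S_n
      - S_j^2, and this integrand is at most S_n^2.\<close>
    also have "\<dots> = (LINT t|leb01. 2 * (indicator (B j) t * (S j t * S n t)) - indicator (B j) t * (S j t * S j t))"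
      by (subst Bochner_Integration.integral_diff[OF integrable_mult_right[OF int] int]) (simp add: orth[OF j])
    also have "\<dots> \<le> (LINT t|leb01. indicator (B j) t * (S n t * S n t))"
    proof (rule integral_mono[OF _ int])
      show "integrable leb01 (\<lambda>t. 2 * (indicator (B j) t * (S j t * S n t)) - indicator (B j) t * (S j t * S j t))"
        by (intro Bochner_Integration.integrable_diff integrable_mult_right int)
      fix t
      show "2 * (indicator (B j) t * (S j t * S n t)) - indicator (B j) t * (S j t * S j t)
          \<le> indicator (B j) t * (S n t * S n t)"
        using zero_le_square[of "S j t - S n t"] by (auto simp: algebra_simps split: split_indicator)
    qed
    finally show "\<tau>\<^sup>2 * measure leb01 (B j) \<le> (LINT t|leb01. indicator (B j) t * (S n t * S n t))" .
  qed
  also have "\<dots> = (LINT t|leb01. (\<Sum>j\<in>{1..n}. indicator (B j) t * (S n t * S n t)))"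
    by (rule Bochner_Integration.integral_sum[symmetric, OF int])
  also have "\<dots> \<le> (LINT t|leb01. (S n t)\<^sup>2)"
  proof (rule integral_mono)
    show "integrable leb01 (\<lambda>t. (S n t)\<^sup>2)" unfolding S_def by (rule integrable_rad_sum_power)
    show "integrable leb01 (\<lambda>t. \<Sum>j\<in>{1..n}. indicator (B j) t * (S n t * S n t))"
      by (intro Bochner_Integration.integrable_sum int)
    fix t
    have "(\<Sum>j\<in>{1..n}. indicator (B j) t) = (indicator (\<Union>j\<in>{1..n}. B j) t :: real)"
      using disj by (subst indicator_UN_disjoint) auto
    then show "(\<Sum>j\<in>{1..n}. indicator (B j) t * (S n t * S n t)) \<le> (S n t)\<^sup>2"
      unfolding sum_distrib_right[symmetric] by (auto simp: power2_eq_square split: split_indicator)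
  qed
  also have "\<dots> = (\<Sum>k=1..n. (a k)\<^sup>2)" unfolding S_def by (rule LINT_rad_sum_sq) auto
  finally show ?thesis unfolding U[unfolded S_def] using \<tau> by (simp add: pos_le_divide_eq mult.commute)
qed

text \<open>Sequences are indexed from \<open>1\<close>; the value at \<open>0\<close> plays no role.\<close>

definition l2_seqs :: "(nat \<Rightarrow> real) set" where
  "l2_seqs = {a. bdd_above (range (\<lambda>n. L2_set a {1..n}))}"

definition l2_norm :: "(nat \<Rightarrow> real) \<Rightarrow> real" where
  "l2_norm a = (SUP n. L2_set a {1..n})"

lemma L2_set_sq: "(L2_set a F)\<^sup>2 = (\<Sum>k\<in>F. (a k)\<^sup>2)"
  by (simp add: L2_set_def sum_nonneg)

lemma L2_set_le_l2_norm:
  assumes "a \<in> l2_seqs"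
  shows "L2_set a {1..n} \<le> l2_norm a"
  unfolding l2_norm_def using assms by (intro cSUP_upper) (auto simp: l2_seqs_def)

lemma l2_norm_nonneg: "a \<in> l2_seqs \<Longrightarrow> 0 \<le> l2_norm a"
  using L2_set_le_l2_norm[of a 0] by simp

lemma l2_seqsI: "(\<And>n. L2_set a {1..n} \<le> C) \<Longrightarrow> a \<in> l2_seqs"
  unfolding l2_seqs_def mem_Collect_eq by (rule bdd_aboveI2)

lemma l2_norm_le: "(\<And>n. L2_set a {1..n} \<le> C) \<Longrightarrow> l2_norm a \<le> C"
  unfolding l2_norm_def by (rule cSUP_least) auto

lemma l2_summable:
  assumes "a \<in> l2_seqs"
  shows "summable (\<lambda>k. (a (Suc k))\<^sup>2)"
proof (rule summableI_nonneg_bounded)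
  fix n
  have "(\<Sum>k<n. (a (Suc k))\<^sup>2) = (L2_set a {1..n})\<^sup>2"
    unfolding L2_set_sq by (rule sum.reindex_bij_witness[of _ "\<lambda>k. k - 1" Suc]) auto
  also have "\<dots> \<le> (l2_norm a)\<^sup>2" by (intro power_mono L2_set_le_l2_norm assms) simp
  finally show "(\<Sum>k<n. (a (Suc k))\<^sup>2) \<le> (l2_norm a)\<^sup>2" .
qed simp

lemma l2_tail:
  assumes a: "a \<in> l2_seqs" and "e > 0"
  shows "\<exists>N. \<forall>m\<ge>N. \<forall>n. (\<Sum>k\<in>{m<..n}. (a k)\<^sup>2) < e"
proof -
  obtain N where N: "\<And>m n. N \<le> m \<Longrightarrow> norm (\<Sum>k = m..<n. (a (Suc k))\<^sup>2) < e"
    using l2_summable[OF a, unfolded summable_Cauchy] \<open>e > 0\<close> by blast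
  have "(\<Sum>k\<in>{m<..n}. (a k)\<^sup>2) < e" if "N \<le> m" for m n
  proof -
    have "(\<Sum>k\<in>{m<..n}. (a k)\<^sup>2) = (\<Sum>k = m..<n. (a (Suc k))\<^sup>2)"
      by (rule sum.reindex_bij_witness[of _ Suc "\<lambda>k. k - 1"]) auto
    then show ?thesis using N[OF that, of n] by simp
  qed
  then show ?thesis by blast
qed

text \<open>The maximal inequality is applied to the tails: beyond m the partial sums move by more
  than \<tau> only on a set whose measure is controlled by the tail of the square sum. Intersecting
  over m leaves a null set, and \<tau> = 1/(p+1) yields the Cauchy property.\<close>

lemma AE_rad_sum_convergent:
  assumes a: "a \<in> l2_seqs"
  shows "AE t in leb01. convergent (\<lambda>n. rad_sum a {1..n} t)"
proof -
  have bad: "AE t in leb01. \<exists>m. \<forall>n\<ge>m. \<bar>rad_sum a {1..n} t - rad_sum a {1..m} t\<bar> \<le> \<tau>" if \<tau>: "\<tau> > 0" for \<tau>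
  proof -
    define E where "E m n = {t \<in> {0..1}. \<exists>j\<in>{1..n}. \<tau> < \<bar>rad_sum (\<lambda>k. if m < k then a k else 0) {1..j} t\<bar>}" for m n
    have E [measurable]: "E m n \<in> sets leb01" for m n
    proof -
      have "{t \<in> space leb01. \<exists>j\<in>{1..n}. \<tau> < \<bar>rad_sum (\<lambda>k. if m < k then a k else 0) {1..j} t\<bar>} \<in> sets leb01"
        by measurable
      then show ?thesis by (simp add: E_def)
    qed
    have diff: "rad_sum (\<lambda>k. if m < k then a k else 0) {1..n} t = rad_sum a {1..n} t - rad_sum a {1..m} t"
      if "m \<le> n" for m n t
    proof -
      have *: "{1..n} = {1..m} \<union> {m<..n}" using that by auto
      show ?thesis unfolding rad_sum_def * by (subst (1 2) sum.union_disjoint) auto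
    qed
    define N where "N = (\<Inter>m. \<Union>n. E m n)"
    have N [measurable]: "N \<in> sets leb01" unfolding N_def by measurable
    have "measure leb01 N \<le> e / \<tau>\<^sup>2" if "e > 0" for e
    proof -
      obtain m where m: "\<And>n. (\<Sum>k\<in>{m<..n}. (a k)\<^sup>2) < e" using l2_tail[OF a \<open>e > 0\<close>] by blast
      have "measure leb01 (E m n) \<le> e / \<tau>\<^sup>2" for n
      proof -
        have "measure leb01 (E m n) \<le> (\<Sum>k=1..n. (if m < k then a k else 0)\<^sup>2) / \<tau>\<^sup>2"
          unfolding E_def by (rule Kolmogorov_rademacher[OF \<tau>])
        also have "(\<Sum>k=1..n. (if m < k then a k else 0)\<^sup>2) = (\<Sum>k\<in>{m<..n}. (a k)\<^sup>2)"
          by (rule sum.mono_neutral_cong_right) auto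
        also have "\<dots> / \<tau>\<^sup>2 \<le> e / \<tau>\<^sup>2" using m[of n] by (intro divide_right_mono) auto
        finally show ?thesis .
      qed
      moreover have "(\<lambda>n. measure leb01 (E m n)) \<longlonglongrightarrow> measure leb01 (\<Union>n. E m n)"
      proof (intro leb01.finite_Lim_measure_incseq incseq_SucI)
        show "E m n \<subseteq> E m (Suc n)" for n unfolding E_def by (intro subsetI) (auto intro: le_SucI)
      qed auto
      ultimately have "measure leb01 (\<Union>n. E m n) \<le> e / \<tau>\<^sup>2" by (intro LIMSEQ_le_const2) auto
      moreover have "measure leb01 N \<le> measure leb01 (\<Union>n. E m n)"
        by (intro leb01.finite_measure_mono) (auto simp: N_def)
      ultimately show ?thesis by linarith
    qed
    from this[of "e * \<tau>\<^sup>2" for e] have "measure leb01 N \<le> e" if "e > 0" for e using that \<tau> by simp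
    then have "measure leb01 N = 0" by (metis field_le_epsilon add_0 measure_le_0_iff)
    then have "N \<in> null_sets leb01" by (simp add: null_sets_def leb01.emeasure_eq_measure)
    then show ?thesis
    proof (rule AE_I', intro subsetI)
      fix t assume t: "t \<in> {t \<in> space leb01. \<not> (\<exists>m. \<forall>n\<ge>m. \<bar>rad_sum a {1..n} t - rad_sum a {1..m} t\<bar> \<le> \<tau>)}"
      have "\<exists>n. t \<in> E m n" for m
      proof -
        obtain n where n: "m \<le> n" "\<tau> < \<bar>rad_sum a {1..n} t - rad_sum a {1..m} t\<bar>" using t by (auto simp: not_le)
        then have "n \<noteq> 0" using \<tau> by (intro notI) simp
        moreover have "\<tau> < \<bar>rad_sum (\<lambda>k. if m < k then a k else 0) {1..n} t\<bar>"
          unfolding diff[OF n(1)] by (rule n(2))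
        moreover have "t \<in> {0..1}" using t by simp
        ultimately show ?thesis unfolding E_def by (intro exI[of _ n] CollectI conjI bexI[of _ n]) auto
      qed
      then show "t \<in> N" by (auto simp: N_def)
    qed
  qed
  have "AE t in leb01. \<forall>p::nat. \<exists>m. \<forall>n\<ge>m. \<bar>rad_sum a {1..n} t - rad_sum a {1..m} t\<bar> \<le> 1 / real (Suc p)"
    unfolding AE_all_countable by (intro allI bad) simp
  then show ?thesis
  proof eventually_elim
    case (elim t)
    have "Cauchy (\<lambda>n. rad_sum a {1..n} t)"
    proof (rule metric_CauchyI)
      fix e :: real assume "0 < e"
      then obtain p where p: "1 / real (Suc p) < e / 2" using nat_approx_posE[of "e / 2"] by auto
      obtain m where m: "\<And>n. n \<ge> m \<Longrightarrow> \<bar>rad_sum a {1..n} t - rad_sum a {1..m} t\<bar> \<le> 1 / real (Suc p)"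
        using elim by blast
      have "dist (rad_sum a {1..i} t) (rad_sum a {1..j} t) < e" if "m \<le> i" "m \<le> j" for i j
        using m[OF that(1)] m[OF that(2)] p unfolding dist_real_def by linarith
      then show "\<exists>M. \<forall>i\<ge>M. \<forall>j\<ge>M. dist (rad_sum a {1..i} t) (rad_sum a {1..j} t) < e" by blast
    qed
    then show ?case by (simp add: Cauchy_convergent_iff)
  qed
qed

text \<open>Paley--Zygmund, from the second and fourth moments.\<close>

lemma rad_sum_small_ball:
  assumes F: "finite F" "F \<subseteq> {1..}"
  shows "1 / 144 \<le> measure leb01 {t \<in> {0..1}. L2_set a F / 2 \<le> \<bar>rad_sum a F t\<bar>}"
proof -
  define V where "V = (\<Sum>k\<in>F. (a k)\<^sup>2)"
  let ?B = "{t \<in> {0..1}. L2_set a F / 2 \<le> \<bar>rad_sum a F t\<bar>}"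
  have B: "?B \<in> sets leb01"
  proof -
    have "{t \<in> space leb01. L2_set a F / 2 \<le> \<bar>rad_sum a F t\<bar>} \<in> sets leb01" by measurable
    then show ?thesis by simp
  qed
  have L: "L2_set a F = sqrt V" by (simp add: L2_set_def V_def)
  have V0: "0 \<le> V" by (simp add: V_def sum_nonneg)
  show ?thesis
  proof (cases "V = 0")
    case True
    then have "?B = {0..1}" by (auto simp: L)
    then show ?thesis by simp
  next
    case False
    then have Vp: "V > 0" using V0 by simp
    have intB: "integrable leb01 (\<lambda>t. 36 * V * indicator ?B t)"
      by (intro integrable_leb01_bounded[where B = "36 * V"]) (use B Vp in \<open>auto split: split_indicator\<close>)
    have int4: "integrable leb01 (\<lambda>t. (rad_sum a F t) ^ 4 / (36 * V))"
      by (intro integrable_divide integrable_rad_sum_power)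
    have "V = (LINT t|leb01. (rad_sum a F t)\<^sup>2)" by (simp add: LINT_rad_sum_sq[OF F] V_def)
    \<comment> \<open>Off \<open>?B\<close> one has S^2 \<le> V / 4, and on it S^2 \<le> 36 V + S^4
      / (36 V). The fourth moment bound 18 V^2 turns the last term into V / 2, so V \<le> V / 4 + 36
      V m(B) + V / 2; this is the origin of 1/144.\<close>
    also have "\<dots> \<le> (LINT t|leb01. V / 4 + (36 * V * indicator ?B t + (rad_sum a F t) ^ 4 / (36 * V)))"
    proof (rule integral_mono)
      show "integrable leb01 (\<lambda>t. V / 4 + (36 * V * indicator ?B t + (rad_sum a F t) ^ 4 / (36 * V)))"
        using intB int4 by simp
      fix t assume t: "t \<in> space leb01"
      define y where "y = (rad_sum a F t)\<^sup>2"
      have y4: "(rad_sum a F t) ^ 4 = y\<^sup>2" by (simp add: y_def)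
      have y0: "0 \<le> y\<^sup>2 / (36 * V)" using Vp by simp
      show "(rad_sum a F t)\<^sup>2 \<le> V / 4 + (36 * V * indicator ?B t + (rad_sum a F t) ^ 4 / (36 * V))"
        unfolding y4 y_def[symmetric]
      proof (cases "t \<in> ?B")
        case True
        have "y \<le> 36 * V + y\<^sup>2 / (36 * V)"
        proof (cases "y \<le> 36 * V")
          case False
          then have "36 * V * y \<le> y * y" using Vp by (intro mult_right_mono) auto
          then have "y \<le> y\<^sup>2 / (36 * V)" using Vp by (simp add: field_simps power2_eq_square)
          then show ?thesis using Vp by simp
        qed (use y0 in simp)
        then show "y \<le> V / 4 + (36 * V * indicator ?B t + y\<^sup>2 / (36 * V))" using True Vp by simp
      next
        case False
        then have "\<bar>rad_sum a F t\<bar> \<le> sqrt V / 2" using t by (simp add: L not_le)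
        then have "\<bar>rad_sum a F t\<bar>\<^sup>2 \<le> (sqrt V / 2)\<^sup>2" by (intro power_mono) auto
        then have "y \<le> V / 4" using Vp by (simp add: y_def power_divide)
        then show "y \<le> V / 4 + (36 * V * indicator ?B t + y\<^sup>2 / (36 * V))" using False y0 by simp
      qed
    qed (rule integrable_rad_sum_power)
    also have "\<dots> = V / 4 + (36 * V * measure leb01 ?B + (LINT t|leb01. (rad_sum a F t) ^ 4) / (36 * V))"
    proof -
      have "integrable leb01 (\<lambda>t. V / 4)" by simp
      from Bochner_Integration.integral_add[OF this Bochner_Integration.integrable_add[OF intB int4]]
        Bochner_Integration.integral_add[OF intB int4]
      show ?thesis using B by (simp add: sets_leb01_iff Int_absorb2)
    qed
    also have "\<dots> \<le> V / 4 + (36 * V * measure leb01 ?B + 18 * V\<^sup>2 / (36 * V))"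
      using rad_sum_fourth_moment[OF F, of a] Vp by (intro add_left_mono divide_right_mono) (auto simp: V_def)
    also have "18 * V\<^sup>2 / (36 * V) = V / 2" using Vp by (simp add: power2_eq_square)
    finally have "V * (1 / 144) \<le> V * measure leb01 ?B" by simp
    then show ?thesis using Vp by (simp only: mult_le_cancel_left_pos)
  qed
qed

text \<open>Convergent sequences are bounded, so on a set of measure above 1 - 1/144 one bound M
  serves for all n. For every n this set meets the one from the small-ball estimate, where the n-th
  partial sum is at least half the l2 norm of its coefficients.\<close>

lemma l2_of_AE_convergent:
  assumes conv: "AE t in leb01. convergent (\<lambda>n. rad_sum a {1..n} t)"
  shows "a \<in> l2_seqs"
proof -
  define E where "E M = {t \<in> {0..1}. \<forall>n. \<bar>rad_sum a {1..n} t\<bar> \<le> real M}" for M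
  have E [measurable]: "E M \<in> sets leb01" for M
  proof -
    have "{t \<in> space leb01. \<forall>n. \<bar>rad_sum a {1..n} t\<bar> \<le> real M} \<in> sets leb01" by measurable
    then show ?thesis by (simp add: E_def)
  qed
  have "(\<lambda>M. measure leb01 (E M)) \<longlonglongrightarrow> measure leb01 (\<Union>M. E M)"
  proof (intro leb01.finite_Lim_measure_incseq incseq_SucI subsetI)
    fix M t assume "t \<in> E M"
    moreover have "real M \<le> real (Suc M)" by simp
    ultimately show "t \<in> E (Suc M)" unfolding E_def by (blast intro: order_trans)
  qed auto
  also have "measure leb01 (\<Union>M. E M) = measure leb01 {0..1}"
  proof (rule leb01.finite_measure_eq_AE)
    show "AE t in leb01. t \<in> (\<Union>M. E M) \<longleftrightarrow> t \<in> {0..1}"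
      using conv AE_space
    proof eventually_elim
      case (elim t)
      then obtain K where K: "\<And>n. \<bar>rad_sum a {1..n} t\<bar> \<le> K"
        using convergent_imp_Bseq[of "\<lambda>n. rad_sum a {1..n} t"] by (auto simp: Bseq_def)
      obtain M where "K \<le> real M" using real_arch_simple by blast
      then have "t \<in> E M" using K elim(2) by (auto simp: E_def intro: order_trans)
      then show ?case using elim(2) by auto
    qed
  qed (auto intro: sets_leb01_borel)
  finally have "eventually (\<lambda>M. 1 - 1 / 144 < measure leb01 (E M)) sequentially"
    by (rule order_tendstoD) simp
  then obtain M where M: "1 - 1 / 144 < measure leb01 (E M)" by (auto simp: eventually_sequentially)
  show ?thesis
  proof (rule l2_seqsI)
    fix n
    let ?B = "{t \<in> {0..1}. L2_set a {1..n} / 2 \<le> \<bar>rad_sum a {1..n} t\<bar>}"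
    have B: "?B \<in> sets leb01"
    proof -
      have "{t \<in> space leb01. L2_set a {1..n} / 2 \<le> \<bar>rad_sum a {1..n} t\<bar>} \<in> sets leb01" by measurable
      then show ?thesis by simp
    qed
    have "E M \<inter> ?B \<noteq> {}"
    proof
      assume "E M \<inter> ?B = {}"
      then have "measure leb01 (E M \<union> ?B) = measure leb01 (E M) + measure leb01 ?B"
        by (intro leb01.finite_measure_Union E B)
      then show False
        using M rad_sum_small_ball[of "{1..n}" a] measure_leb01_le_1[of "E M \<union> ?B"] by simp
    qed
    then obtain t where "t \<in> E M" "t \<in> ?B" by blast
    then have "L2_set a {1..n} / 2 \<le> real M" by (auto simp: E_def intro: order_trans)
    then show "L2_set a {1..n} \<le> 2 * real M" by simp
  qed
qed

text \<open>Where the partial sums diverge, \<open>lim\<close> has an unspecified value; for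
  square-summable coefficients this happens on a null set only. As a total function it is measurable
  for every a.\<close>

definition rad_series :: "(nat \<Rightarrow> real) \<Rightarrow> real \<Rightarrow> real" where
  "rad_series a t = lim (\<lambda>n. rad_sum a {1..n} t)"

lemma rad_series_measurable [measurable]: "rad_series a \<in> borel_measurable leb01"
  unfolding rad_series_def[abs_def] by (rule borel_measurable_lim_metric) simp

lemma AE_rad_series:
  assumes "a \<in> l2_seqs"
  shows "AE t in leb01. (\<lambda>n. rad_sum a {1..n} t) \<longlonglongrightarrow> rad_series a t"
  using AE_rad_sum_convergent[OF assms] unfolding rad_series_def convergent_LIMSEQ_iff .

text \<open>Fatou's lemma, packaged for a uniform bound on the approximating integrals.\<close>

lemma nn_integral_limit_le:
  fixes f :: "nat \<Rightarrow> real \<Rightarrow> ennreal"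
  assumes f [measurable]: "\<And>n. f n \<in> borel_measurable leb01" "g \<in> borel_measurable leb01"
    and lim: "AE t in leb01. (\<lambda>n. f n t) \<longlonglongrightarrow> g t" and le: "\<And>n. (\<integral>\<^sup>+t. f n t \<partial>leb01) \<le> C"
  shows "(\<integral>\<^sup>+t. g t \<partial>leb01) \<le> C"
proof -
  have "(\<integral>\<^sup>+t. g t \<partial>leb01) = (\<integral>\<^sup>+t. liminf (\<lambda>n. f n t) \<partial>leb01)"
    using lim by (intro nn_integral_cong_AE) (auto elim!: eventually_mono simp: lim_imp_Liminf)
  also have "\<dots> \<le> liminf (\<lambda>n. \<integral>\<^sup>+t. f n t \<partial>leb01)" by (rule nn_integral_liminf) simp
  also have "\<dots> \<le> C" using le by (intro Liminf_le) auto
  finally show ?thesis .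
qed

text \<open>Fatou's lemma transfers the estimate for finite blocks to the tail beyond m. As m grows,
  smaller s become admissible, and this is how the bounded partial sums approximate the
  series.\<close>

lemma rad_series_exp_sq:
  assumes a: "a \<in> l2_seqs" and s: "s > 0" "\<And>n. 2 * exp 1 * (\<Sum>k\<in>{m<..n}. (a k)\<^sup>2) \<le> s\<^sup>2"
  shows "(\<integral>\<^sup>+t. ennreal (exp ((rad_series a t - rad_sum a {1..m} t)\<^sup>2 / s\<^sup>2)) \<partial>leb01) \<le> 2"
proof (rule nn_integral_limit_le)
  show "AE t in leb01. (\<lambda>n. ennreal (exp ((rad_sum a {m<..n+m} t)\<^sup>2 / s\<^sup>2)))
      \<longlonglongrightarrow> ennreal (exp ((rad_series a t - rad_sum a {1..m} t)\<^sup>2 / s\<^sup>2))"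
    using AE_rad_series[OF a]
  proof eventually_elim
    case (elim t)
    have eq: "rad_sum a {m<..n+m} t = rad_sum a {1..n+m} t - rad_sum a {1..m} t" for n
    proof -
      have *: "{1..n+m} = {1..m} \<union> {m<..n+m}" by auto
      show ?thesis unfolding rad_sum_def * by (subst sum.union_disjoint) auto
    qed
    have "(\<lambda>n. rad_sum a {1..n+m} t) \<longlonglongrightarrow> rad_series a t" using elim by (rule LIMSEQ_ignore_initial_segment)
    then show ?case unfolding eq by (intro tendsto_ennrealI tendsto_intros) (use s in auto)
  qed
  show "(\<integral>\<^sup>+t. ennreal (exp ((rad_sum a {m<..n+m} t)\<^sup>2 / s\<^sup>2)) \<partial>leb01) \<le> 2" for n
    by (rule rad_sum_exp_sq) (use s in auto)
qed measurable

section \<open>Symmetric spaces and their duals\<close>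

lemma distr_fun_pos:
  assumes fm: "f \<in> borel_measurable leb01" and nz: "\<not> (AE t in leb01. f t = 0)"
  shows "\<exists>\<delta>>0. 0 < distr_fun f \<delta>"
proof -
  have "\<exists>n. 0 < distr_fun f (1 / real (Suc n))"
  proof (rule ccontr)
    assume "\<nexists>n. 0 < distr_fun f (1 / real (Suc n))"
    then have "distr_fun f (1 / real (Suc n)) = 0" for n
      using antisym[OF _ distr_fun_nonneg[of f "1 / real (Suc n)"]] by (auto simp: not_less)
    then have "AE t in leb01. t \<notin> {t \<in> {0..1}. \<bar>f t\<bar> > 1 / real (Suc n)}" for n
      using distr_set_sets[OF fm] unfolding distr_fun_def
      by (intro AE_not_in) (auto simp: null_sets_def leb01.emeasure_eq_measure)
    then have "AE t in leb01. \<forall>n. t \<notin> {t \<in> {0..1}. \<bar>f t\<bar> > 1 / real (Suc n)}"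
      by (simp only: AE_all_countable) blast
    then have "AE t in leb01. f t = 0"
      using AE_space
    proof eventually_elim
      case (elim t)
      show "f t = 0"
      proof (rule ccontr)
        assume "f t \<noteq> 0"
        then obtain n where "1 / real (Suc n) < \<bar>f t\<bar>" using nat_approx_posE[of "\<bar>f t\<bar>"] by auto
        then show False using elim by auto
      qed
    qed
    then show False using nz by simp
  qed
  then obtain n where "0 < distr_fun f (1 / real (Suc n))" by blast
  then show ?thesis by (intro exI[of _ "1 / real (Suc n)"]) simp
qed

text \<open>Collects what is available for a symmetric space and for its dual alike, so that
  arguments can be run on either side of the duality. The norm is treated as a seminorm.\<close>

locale sym_space =
  fixes E :: fspace
  assumes meas: "f \<in> funs E \<Longrightarrow> f \<in> borel_measurable leb01"
    and add: "f \<in> funs E \<Longrightarrow> g \<in> funs E \<Longrightarrow> (\<lambda>t. f t + g t) \<in> funs E"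
    and triangle: "f \<in> funs E \<Longrightarrow> g \<in> funs E \<Longrightarrow> fnorm E (\<lambda>t. f t + g t) \<le> fnorm E f + fnorm E g"
    and scale: "f \<in> funs E \<Longrightarrow> (\<lambda>t. c * f t) \<in> funs E"
    and norm_scale: "f \<in> funs E \<Longrightarrow> fnorm E (\<lambda>t. c * f t) = \<bar>c\<bar> * fnorm E f"
    and norm_nonneg: "f \<in> funs E \<Longrightarrow> 0 \<le> fnorm E f"
    and rearr_mono: "f \<in> funs E \<Longrightarrow> g \<in> borel_measurable leb01 \<Longrightarrow>
      (\<And>t. 0 < t \<Longrightarrow> rearr g t \<le> rearr f t) \<Longrightarrow> g \<in> funs E \<and> fnorm E g \<le> fnorm E f"
    and nontrivial: "\<exists>f\<in>funs E. \<not> (AE t in leb01. f t = 0)"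
begin

lemma ideal:
  assumes "f \<in> funs E" "g \<in> borel_measurable leb01" "AE t in leb01. \<bar>g t\<bar> \<le> \<bar>f t\<bar>"
  shows "g \<in> funs E" "fnorm E g \<le> fnorm E f"
  using rearr_mono[OF assms(1,2) rearr_mono_AE[OF meas[OF assms(1)] assms(2,3)]] by auto

lemma norm_cong_AE:
  assumes "f \<in> funs E" "g \<in> borel_measurable leb01" "AE t in leb01. g t = f t"
  shows "g \<in> funs E" "fnorm E g = fnorm E f"
proof -
  have le: "AE t in leb01. \<bar>g t\<bar> \<le> \<bar>f t\<bar>" "AE t in leb01. \<bar>f t\<bar> \<le> \<bar>g t\<bar>"
    using assms(3) by (auto elim: eventually_mono)
  show g: "g \<in> funs E" by (rule ideal[OF assms(1,2) le(1)])
  show "fnorm E g = fnorm E f"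
    using ideal(2)[OF assms(1,2) le(1)] ideal(2)[OF g meas[OF assms(1)] le(2)] by simp
qed

lemma diff:
  assumes "f \<in> funs E" "g \<in> funs E"
  shows "(\<lambda>t. f t - g t) \<in> funs E" "fnorm E (\<lambda>t. f t - g t) \<le> fnorm E f + fnorm E g"
  using add[OF assms(1) scale[OF assms(2), of "-1"]] triangle[OF assms(1) scale[OF assms(2), of "-1"]]
    norm_scale[OF assms(2), of "-1"] by auto

lemma zero: "(\<lambda>t. 0) \<in> funs E" "fnorm E (\<lambda>t. 0) = 0"
proof -
  obtain f where "f \<in> funs E" using nontrivial by blast
  from scale[OF this, of 0] norm_scale[OF this, of 0]
  show "(\<lambda>t. 0) \<in> funs E" "fnorm E (\<lambda>t. 0) = 0" by auto
qed

lemma sum: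
  assumes "finite I" "\<And>i. i \<in> I \<Longrightarrow> f i \<in> funs E"
  shows "(\<lambda>t. \<Sum>i\<in>I. f i t) \<in> funs E \<and> fnorm E (\<lambda>t. \<Sum>i\<in>I. f i t) \<le> (\<Sum>i\<in>I. fnorm E (f i))"
  using assms
proof (induction I)
  case (insert i I)
  then have i: "f i \<in> funs E" and IH: "(\<lambda>t. \<Sum>i\<in>I. f i t) \<in> funs E"
    "fnorm E (\<lambda>t. \<Sum>i\<in>I. f i t) \<le> (\<Sum>i\<in>I. fnorm E (f i))" by auto
  show ?case using add[OF i IH(1)] triangle[OF i IH(1)] IH(2) insert(1,2) by auto
qed (simp add: zero)

text \<open>A nonzero element exceeds some \<delta> on a set of measure above 1/N for some N. By
  rearrangement monotonicity the indicators of N intervals of length 1/N belong to the space, and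
  these intervals cover (0,1].\<close>

lemma one: "(\<lambda>t. 1) \<in> funs E"
proof -
  obtain f where f: "f \<in> funs E" "\<not> (AE t in leb01. f t = 0)" using nontrivial by blast
  note fm = meas[OF f(1)]
  obtain \<delta> where \<delta>: "\<delta> > 0" "0 < distr_fun f \<delta>" using distr_fun_pos[OF fm f(2)] by blast
  obtain N where N: "1 / real (Suc N) < distr_fun f \<delta>" using nat_approx_posE[OF \<delta>(2)] by blast
  let ?N = "real (Suc N)"
  define g where "g i t = (indicator {real i / ?N..real (Suc i) / ?N} t :: real)" for i t
  have g_mem: "g i \<in> funs E" if i: "i < Suc N" for i
  proof -
    have sub: "{real i / ?N..real (Suc i) / ?N} \<subseteq> {0..1}"
      using i by (auto simp: field_simps simp del: of_nat_Suc)
    have gm: "(\<lambda>t. \<delta> * g i t) \<in> borel_measurable leb01"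
      unfolding g_def
      by (intro borel_measurable_times borel_measurable_indicator borel_measurable_const
          sets_leb01_borel[OF _ sub]) simp
    have "distr_fun (\<lambda>t. \<delta> * g i t) \<tau> \<le> distr_fun f \<tau>" if "0 \<le> \<tau>" for \<tau>
    proof (cases "\<tau> < \<delta>")
      case True
      have "distr_fun (\<lambda>t. \<delta> * g i t) \<tau> \<le> measure leb01 {real i / ?N..real (Suc i) / ?N}"
        unfolding distr_fun_def using sub that \<delta>(1)
        by (intro leb01.finite_measure_mono sets_leb01_borel) (auto simp: g_def split: split_indicator_asm)
      also have "\<dots> = 1 / ?N"
        using sub i by (subst measure_leb01_Icc) (auto simp: divide_right_mono field_simps)
      also have "\<dots> \<le> distr_fun f \<delta>" using N by simp
      also have "\<dots> \<le> distr_fun f \<tau>" using True by (intro distr_fun_antimono fm) simp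
      finally show ?thesis .
    next
      case False
      then have "{t \<in> {0..1}. \<tau> < \<bar>\<delta> * g i t\<bar>} = {}"
        using \<delta>(1) by (auto simp: g_def split: split_indicator)
      then show ?thesis
        by (simp only: distr_fun_def[of "\<lambda>t. \<delta> * g i t"] measure_empty distr_fun_nonneg)
    qed
    then have "(\<lambda>t. \<delta> * g i t) \<in> funs E"
      using rearr_mono[OF f(1) gm rearr_mono_distr[OF fm]] by blast
    from scale[OF this, of "1 / \<delta>"] show ?thesis using \<delta>(1) by simp
  qed
  have "(\<lambda>t. \<Sum>i<Suc N. g i t) \<in> funs E" using sum[of "{..<Suc N}" g] g_mem by auto
  then show ?thesis
  proof (rule ideal)
    show "AE t in leb01. \<bar>1::real\<bar> \<le> \<bar>\<Sum>i<Suc N. g i t\<bar>"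
      using AE_leb01_pos
    proof eventually_elim
      case (elim t)
      \<comment> \<open>The ceiling minus one is the index of an interval containing t; t > 0 keeps
        it nonnegative and t \<le> 1 keeps it below the number of intervals.\<close>
      define i where "i = nat (\<lceil>t * ?N\<rceil> - 1)"
      have c: "0 < t * ?N" "t * ?N \<le> ?N" using elim by (auto intro: mult_left_le_one_le)
      then have c1: "1 \<le> \<lceil>t * ?N\<rceil>" "\<lceil>t * ?N\<rceil> \<le> int (Suc N)"
        by (auto simp: ceiling_le_iff one_le_ceiling)
      then have i: "i < Suc N" "real i = of_int \<lceil>t * ?N\<rceil> - 1" by (auto simp: i_def)
      then have "real i \<le> t * ?N" "t * ?N \<le> real (Suc i)" by linarith+
      then have "g i t = 1" by (simp add: g_def field_simps del: of_nat_Suc)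
      moreover have "g i t \<le> (\<Sum>i<Suc N. g i t)"
        using i by (intro member_le_sum) (auto simp: g_def)
      ultimately show ?case by simp
    qed
  qed simp
qed

lemma bounded_mem:
  assumes f: "f \<in> borel_measurable leb01" "AE t in leb01. \<bar>f t\<bar> \<le> C"
  shows "f \<in> funs E" "fnorm E f \<le> \<bar>C\<bar> * fnorm E (\<lambda>t. 1)"
proof -
  have "AE t in leb01. \<bar>f t\<bar> \<le> \<bar>C * 1\<bar>" using f(2) by (auto elim: eventually_mono)
  from ideal[OF scale[OF one] f(1) this] norm_scale[OF one, of C]
  show "f \<in> funs E" "fnorm E f \<le> \<bar>C\<bar> * fnorm E (\<lambda>t. 1)" by auto
qed

lemma distr_mono:
  assumes "f \<in> funs E" "g \<in> borel_measurable leb01" "\<And>\<tau>. 0 \<le> \<tau> \<Longrightarrow> distr_fun g \<tau> \<le> distr_fun f \<tau>"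
  shows "g \<in> funs E" "fnorm E g \<le> fnorm E f"
  using rearr_mono[OF assms(1,2) rearr_mono_distr[OF meas[OF assms(1)] assms(3)]] by auto

lemma rearr_mem:
  assumes "f \<in> funs E"
  shows "rearr f \<in> funs E" "fnorm E (rearr f) \<le> fnorm E f"
  using rearr_mono[OF assms rearr_measurable[OF meas[OF assms]]] rearr_rearr[OF meas[OF assms]] by auto

end

lemma symmetric_space_sym:
  assumes X: "symmetric_space X"
  shows "sym_space X"
proof
  have B: "banach_function_space X" using X by (simp add: symmetric_space_def)
  note B' = B[unfolded banach_function_space_def]
  show "f \<in> funs X \<Longrightarrow> f \<in> borel_measurable leb01" for f using B' by blast
  show "f \<in> funs X \<Longrightarrow> g \<in> funs X \<Longrightarrow> (\<lambda>t. f t + g t) \<in> funs X"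
    "f \<in> funs X \<Longrightarrow> g \<in> funs X \<Longrightarrow> fnorm X (\<lambda>t. f t + g t) \<le> fnorm X f + fnorm X g" for f g
    using B' by blast+
  show "f \<in> funs X \<Longrightarrow> (\<lambda>t. c * f t) \<in> funs X"
    "f \<in> funs X \<Longrightarrow> fnorm X (\<lambda>t. c * f t) = \<bar>c\<bar> * fnorm X f" "f \<in> funs X \<Longrightarrow> 0 \<le> fnorm X f" for f c
    using B' by blast+
  show "\<exists>f\<in>funs X. \<not> (AE t in leb01. f t = 0)" using X by (simp add: symmetric_space_def)
  show "f \<in> funs X \<Longrightarrow> g \<in> borel_measurable leb01 \<Longrightarrow> (\<And>t. 0 < t \<Longrightarrow> rearr g t \<le> rearr f t) \<Longrightarrow>
      g \<in> funs X \<and> fnorm X g \<le> fnorm X f" for f g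
    using X unfolding symmetric_space_def by (auto simp: greaterThanAtMost_iff)
qed

text \<open>A weak form of completeness that, unlike norm completeness, is easy to transfer to the dual.\<close>

definition absorbs_sequences :: "fspace \<Rightarrow> bool" where
  "absorbs_sequences E \<longleftrightarrow> (\<forall>x::nat \<Rightarrow> real \<Rightarrow> real. (\<forall>n. x n \<in> funs E \<and> fnorm E (x n) \<le> 1) \<longrightarrow>
     (\<exists>g\<in>funs E. \<forall>n. AE t in leb01. \<bar>x n t\<bar> \<le> 2 ^ n * \<bar>g t\<bar>))"

lemma symmetric_space_null:
  assumes "symmetric_space X" "f \<in> funs X" "fnorm X f \<le> 0"
  shows "AE t in leb01. f t = 0"
proof -
  have "0 \<le> fnorm X f \<and> (fnorm X f = 0 \<longleftrightarrow> (AE t in leb01. f t = 0))"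
    using assms(1,2) unfolding symmetric_space_def banach_function_space_def by blast
  then show ?thesis using assms(3) by (metis antisym)
qed

lemma symmetric_space_complete:
  assumes "symmetric_space X" "cauchy_in X s"
  obtains g where "g \<in> funs X" "(\<lambda>n. fnorm X (\<lambda>t. s n t - g t)) \<longlonglongrightarrow> 0"
  using assms unfolding symmetric_space_def banach_function_space_def converges_in_def by blast

text \<open>g is the norm limit of the sums of 2^(-n) |x_n|, which exists by completeness. Norm
  convergence is not pointwise, so the domination a.e. is recovered from the lattice property and
  the definiteness of the norm.\<close>

lemma symmetric_space_absorbs:
  assumes X: "symmetric_space X"
  shows "absorbs_sequences X"
  unfolding absorbs_sequences_def
proof (intro allI impI)
  interpret sym_space X by (rule symmetric_space_sym[OF X])
  fix x :: "nat \<Rightarrow> real \<Rightarrow> real" assume x: "\<forall>n. x n \<in> funs X \<and> fnorm X (x n) \<le> 1"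
  define y where "y n t = (1 / 2 ^ n) * \<bar>x n t\<bar>" for n t
  have xabs: "(\<lambda>t. \<bar>x n t\<bar>) \<in> funs X" "fnorm X (\<lambda>t. \<bar>x n t\<bar>) \<le> 1" for n
  proof -
    have "(\<lambda>t. \<bar>x n t\<bar>) \<in> borel_measurable leb01" using meas[of "x n"] x by simp
    from ideal[OF _ this, of "x n"] x show "(\<lambda>t. \<bar>x n t\<bar>) \<in> funs X" "fnorm X (\<lambda>t. \<bar>x n t\<bar>) \<le> 1"
      by (auto intro: order_trans)
  qed
  have y: "y n \<in> funs X" "fnorm X (y n) \<le> 1 / 2 ^ n" for n
  proof -
    have eq: "y n = (\<lambda>t. (1 / 2 ^ n) * \<bar>x n t\<bar>)" by (simp add: y_def fun_eq_iff)
    show "y n \<in> funs X" unfolding eq by (rule scale[OF xabs(1)])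
    show "fnorm X (y n) \<le> 1 / 2 ^ n"
      unfolding eq norm_scale[OF xabs(1)] using xabs(2)[of n] by (simp add: divide_right_mono)
  qed
  define s where "s n t = (\<Sum>i<n. y i t)" for n t
  have s: "s n \<in> funs X" for n using sum[of "{..<n}" y] y by (auto simp: s_def[abs_def])
  have step: "fnorm X (\<lambda>t. s m t - s n t) \<le> 2 / 2 ^ n" if "n \<le> m" for m n
  proof -
    have "s m t - s n t = (\<Sum>i\<in>{n..<m}. y i t)" for t
      using that by (simp add: s_def sum_diff_nat_ivl flip: atLeast0LessThan)
    then have "fnorm X (\<lambda>t. s m t - s n t) \<le> (\<Sum>i\<in>{n..<m}. fnorm X (y i))"
      using sum[of "{n..<m}" y] y by simp
    also have "\<dots> \<le> (\<Sum>i\<in>{n..<m}. (1 / 2) ^ i)"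
      by (intro sum_mono) (use y in \<open>simp add: power_divide\<close>)
    also have "\<dots> \<le> 2 / 2 ^ n"
    proof -
      have "(\<Sum>i\<in>{n..<m}. (1 / 2 :: real) ^ i) = 2 / 2 ^ n - 2 / 2 ^ m" 
        using that
      proof (induction rule: dec_induct)
        case (step k)
        then have "(\<Sum>i\<in>{n..<Suc k}. (1 / 2 :: real) ^ i) = 2 / 2 ^ n - 2 / 2 ^ k + (1 / 2) ^ k" by simp
        then show ?case by (simp add: power_divide)
      qed simp
      then show ?thesis by simp
    qed
    finally show ?thesis .
  qed
  have "cauchy_in X s"
    unfolding cauchy_in_def
  proof (intro conjI allI impI s)
    fix e :: real assume "e > 0"
    then obtain N where "(1 / 2) ^ N < e / 2" using real_arch_pow_inv[of "e / 2" "1 / 2"] by auto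
    then have N: "2 / 2 ^ N < e" by (simp add: power_divide)
    have "fnorm X (\<lambda>t. s m t - s n t) < e" if "N \<le> m" "N \<le> n" for m n
    proof -
      have *: "fnorm X (\<lambda>t. s m t - s n t) < e" if "N \<le> n" "n \<le> m" for m n
      proof -
        have "2 / 2 ^ n \<le> 2 / (2 ^ N :: real)" using that by (intro divide_left_mono power_increasing) auto
        then show ?thesis using step[OF that(2)] N by linarith
      qed
      have sym: "fnorm X (\<lambda>t. s m t - s n t) = fnorm X (\<lambda>t. s n t - s m t)"
        using norm_scale[OF diff(1)[OF s s], of "-1" n m] by simp
      show ?thesis using *[of n m] *[of m n] that sym by (cases "n \<le> m") auto
    qed
    then show "\<exists>N. \<forall>m\<ge>N. \<forall>n\<ge>N. fnorm X (\<lambda>t. s m t - s n t) < e" by blast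
  qed
  then obtain g where g: "g \<in> funs X" "(\<lambda>n. fnorm X (\<lambda>t. s n t - g t)) \<longlonglongrightarrow> 0"
    by (rule symmetric_space_complete[OF X])
  have "AE t in leb01. y n t \<le> g t" for n
  proof -
    \<comment> \<open>The positive part of y_n - g is dominated by |s_N - g| for every N > n, since
      all terms of the sums are nonnegative. Its norm is therefore 0.\<close>
    define d where "d t = max 0 (y n t - g t)" for t
    have dm: "d \<in> borel_measurable leb01"
      using meas[OF y(1), of n] meas[OF g(1)] unfolding d_def[abs_def] by measurable
    have le: "d t \<le> \<bar>s N t - g t\<bar>" "0 \<le> d t" if "n < N" for N t
    proof -
      have "y n t \<le> s N t" unfolding s_def using that by (intro member_le_sum) (auto simp: y_def)
      then show "d t \<le> \<bar>s N t - g t\<bar>" "0 \<le> d t" by (auto simp: d_def)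
    qed
    have d: "d \<in> funs X" "fnorm X d \<le> fnorm X (\<lambda>t. s N t - g t)" if "n < N" for N
      using ideal[OF diff(1)[OF s[of N] g(1)] dm] le[OF that] by auto
    have "fnorm X d \<le> 0"
      using g(2) by (rule LIMSEQ_le_const) (use d(2) in \<open>auto intro!: exI[of _ "Suc n"]\<close>)
    from symmetric_space_null[OF X d(1) this, of "Suc n"] show ?thesis
      by (auto elim!: eventually_mono simp: d_def)
  qed
  note y_le = this
  have "AE t in leb01. \<bar>x n t\<bar> \<le> 2 ^ n * \<bar>g t\<bar>" for n
    using y_le[of n]
  proof eventually_elim
    case (elim t)
    then have "\<bar>x n t\<bar> \<le> 2 ^ n * g t" by (simp add: y_def field_simps)
    also have "\<dots> \<le> 2 ^ n * \<bar>g t\<bar>" by simp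
    finally show ?case .
  qed
  with g(1) show "\<exists>g\<in>funs X. \<forall>n. AE t in leb01. \<bar>x n t\<bar> \<le> 2 ^ n * \<bar>g t\<bar>" by blast
qed

section \<open>Koethe duals of symmetric spaces\<close>

lemma kothe_dual_mem:
  "y \<in> funs (kothe_dual E) \<longleftrightarrow> y \<in> borel_measurable leb01 \<and> (\<forall>x\<in>funs E. integrable leb01 (\<lambda>t. x t * y t))"
  by (simp add: kothe_dual_def)

lemma integrable_of_nn_integral_abs:
  fixes f g :: "real \<Rightarrow> real"
  assumes "f \<in> borel_measurable leb01" "(\<integral>\<^sup>+t. ennreal \<bar>f t\<bar> \<partial>leb01) < \<infinity>"
  shows "integrable leb01 f"
  using assms by (intro integrableI_bounded) auto

context sym_space
begin

text \<open>Integrability against every x already makes y a bounded functional: if x_n in the unit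
  ball had pairings above 4^n, an absorbing g would make the integral of |g y| at least 2^n for all
  n. Boundedness is what gives the real supremum in \<open>kothe_dual\<close> its meaning.\<close>

lemma kothe_bdd:
  assumes E: "absorbs_sequences E" and y: "y \<in> funs (kothe_dual E)"
  shows "\<exists>B. \<forall>x\<in>funs E. fnorm E x \<le> 1 \<longrightarrow> \<bar>LINT t|leb01. x t * y t\<bar> \<le> B"
proof (rule ccontr)
  assume "\<not> ?thesis"
  then have "\<forall>n::nat. \<exists>x. x \<in> funs E \<and> fnorm E x \<le> 1 \<and> 4 ^ n < \<bar>LINT t|leb01. x t * y t\<bar>"
    by (metis not_le)
  from choice[OF this] obtain x :: "nat \<Rightarrow> real \<Rightarrow> real" where
    x: "\<And>n. x n \<in> funs E \<and> fnorm E (x n) \<le> 1 \<and> 4 ^ n < \<bar>LINT t|leb01. x n t * y t\<bar>" by blast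
  then obtain g where g: "g \<in> funs E" "\<And>n. AE t in leb01. \<bar>x n t\<bar> \<le> 2 ^ n * \<bar>g t\<bar>"
    using E unfolding absorbs_sequences_def by metis
  have int: "integrable leb01 (\<lambda>t. g t * y t)" and intx: "integrable leb01 (\<lambda>t. x n t * y t)" for n
    using y g(1) x by (auto simp: kothe_dual_mem)
  have "2 ^ n \<le> (LINT t|leb01. \<bar>g t * y t\<bar>)" for n
  proof -
    have "4 ^ n \<le> \<bar>LINT t|leb01. x n t * y t\<bar>" using x[of n] by simp
    also have "\<dots> \<le> (LINT t|leb01. \<bar>x n t * y t\<bar>)" by (rule integral_abs_bound)
    also have "\<dots> \<le> (LINT t|leb01. 2 ^ n * \<bar>g t * y t\<bar>)"
    proof (rule integral_mono_AE)
      show "AE t in leb01. \<bar>x n t * y t\<bar> \<le> 2 ^ n * \<bar>g t * y t\<bar>"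
        using g(2)[of n] by eventually_elim (simp add: abs_mult mult_right_mono flip: mult.assoc)
    qed (use int intx in auto)
    finally have "2 ^ n * 2 ^ n \<le> 2 ^ n * (LINT t|leb01. \<bar>g t * y t\<bar>)"
      by (simp flip: power_mult_distrib)
    then show ?thesis by simp
  qed
  moreover obtain n :: nat where "(LINT t|leb01. \<bar>g t * y t\<bar>) < 2 ^ n"
    using real_arch_pow[of 2] by auto
  ultimately show False by (meson not_le)
qed

lemma kothe_upper:
  assumes E: "absorbs_sequences E" and y: "y \<in> funs (kothe_dual E)" and x: "x \<in> funs E" "fnorm E x \<le> 1"
  shows "(LINT t|leb01. x t * y t) \<le> fnorm (kothe_dual E) y"
proof -
  obtain B where "\<And>x. x \<in> funs E \<Longrightarrow> fnorm E x \<le> 1 \<Longrightarrow> \<bar>LINT t|leb01. x t * y t\<bar> \<le> B"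
    using kothe_bdd[OF E y] by blast
  then have "bdd_above ((\<lambda>x. LINT t|leb01. x t * y t) ` {x \<in> funs E. fnorm E x \<le> 1})"
    by (intro bdd_aboveI2[where M = B]) (auto simp: abs_le_iff)
  then show ?thesis
    using x unfolding kothe_dual_def fspace.simps by (intro cSUP_upper) auto
qed

lemma kothe_least:
  assumes "\<And>x. x \<in> funs E \<Longrightarrow> fnorm E x \<le> 1 \<Longrightarrow> (LINT t|leb01. x t * y t) \<le> C"
  shows "fnorm (kothe_dual E) y \<le> C"
  unfolding kothe_dual_def fspace.simps using assms zero by (intro cSUP_least) auto

lemma kothe_norm_nonneg:
  assumes E: "absorbs_sequences E" and y: "y \<in> funs (kothe_dual E)"
  shows "0 \<le> fnorm (kothe_dual E) y"
  using kothe_upper[OF E y zero(1)] zero(2) by simp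

text \<open>Scaling settles the case of positive norm. If x has norm 0, all its multiples lie in the
  unit ball, and this forces the integral to vanish.\<close>

lemma kothe_Holder:
  assumes E: "absorbs_sequences E" and y: "y \<in> funs (kothe_dual E)" and x: "x \<in> funs E"
  shows "\<bar>LINT t|leb01. x t * y t\<bar> \<le> fnorm E x * fnorm (kothe_dual E) y"
proof -
  let ?I = "LINT t|leb01. x t * y t"
  have main: "\<bar>c\<bar> * \<bar>?I\<bar> \<le> fnorm (kothe_dual E) y" if "\<bar>c\<bar> * fnorm E x \<le> 1" for c
  proof -
    have "(LINT t|leb01. (d * x t) * y t) \<le> fnorm (kothe_dual E) y" if "\<bar>d\<bar> = \<bar>c\<bar>" for d
      using kothe_upper[OF E y scale[OF x, of d]] norm_scale[OF x, of d] \<open>\<bar>c\<bar> * fnorm E x \<le> 1\<close> that by simp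
    from this[of c] this[of "-c"] have "\<bar>c * ?I\<bar> \<le> fnorm (kothe_dual E) y"
      by (simp add: mult.assoc abs_le_iff)
    then show ?thesis by (simp add: abs_mult)
  qed
  show ?thesis
  proof (cases "fnorm E x = 0")
    case True
    have "\<bar>?I\<bar> = 0"
    proof (rule ccontr)
      assume "\<bar>?I\<bar> \<noteq> 0"
      define c where "c = (fnorm (kothe_dual E) y + 1) / \<bar>?I\<bar>"
      have "\<bar>c\<bar> = c" using kothe_norm_nonneg[OF E y] by (simp add: c_def)
      moreover have "c * \<bar>?I\<bar> = fnorm (kothe_dual E) y + 1"
        using \<open>\<bar>?I\<bar> \<noteq> 0\<close> by (simp add: c_def)
      moreover have "\<bar>c\<bar> * \<bar>?I\<bar> \<le> fnorm (kothe_dual E) y" by (rule main) (simp add: True)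
      ultimately show False by simp
    qed
    then show ?thesis using True by simp
  next
    case False
    then have p: "0 < fnorm E x" using norm_nonneg[OF x] by simp
    then show ?thesis using main[of "1 / fnorm E x"] by (simp add: field_simps)
  qed
qed

text \<open>Replacing x by |x| sgn y makes the integrand nonnegative without increasing the
  norm.\<close>

lemma kothe_Holder_nn:
  assumes E: "absorbs_sequences E" and y: "y \<in> funs (kothe_dual E)" and x: "x \<in> funs E"
  shows "(\<integral>\<^sup>+t. ennreal \<bar>x t * y t\<bar> \<partial>leb01) \<le> ennreal (fnorm E x * fnorm (kothe_dual E) y)"
proof -
  define z where "z t = \<bar>x t\<bar> * sgn (y t)" for t
  have ym: "y \<in> borel_measurable leb01" using y by (simp add: kothe_dual_mem)
  have zm: "z \<in> borel_measurable leb01" using meas[OF x] ym unfolding z_def[abs_def] by measurable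
  have z: "z \<in> funs E" "fnorm E z \<le> fnorm E x"
    using ideal[OF x zm] by (auto simp: z_def abs_mult abs_sgn_eq)
  have eq: "z t * y t = \<bar>x t * y t\<bar>" for t
    by (simp add: z_def abs_mult abs_sgn[of "y t"])
  have int: "integrable leb01 (\<lambda>t. \<bar>x t * y t\<bar>)" using y x by (auto simp: kothe_dual_mem)
  have "(\<integral>\<^sup>+t. ennreal \<bar>x t * y t\<bar> \<partial>leb01) = ennreal (LINT t|leb01. z t * y t)"
    unfolding eq by (rule nn_integral_eq_integral[OF int]) simp
  also have "\<dots> \<le> ennreal (fnorm E x * fnorm (kothe_dual E) y)"
    using kothe_Holder[OF E y z(1)] mult_right_mono[OF z(2) kothe_norm_nonneg[OF E y]]
    by (intro ennreal_leI) linarith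
  finally show ?thesis .
qed

text \<open>The attained form of Hardy-Littlewood replaces the integral of the rearrangements by an
  actual pairing of y with an element whose norm is at most that of x. Combined with the usual
  inequality it makes the dual norm monotone under rearrangement.\<close>

lemma kothe_rearr:
  assumes E: "absorbs_sequences E" and y: "y \<in> funs (kothe_dual E)" and x: "x \<in> funs E"
  shows "(\<integral>\<^sup>+t. ennreal (rearr x t * rearr y t) \<partial>leb01) \<le> ennreal (fnorm E x * fnorm (kothe_dual E) y)"
proof -
  have ym: "y \<in> borel_measurable leb01" using y by (simp add: kothe_dual_mem)
  obtain z where z: "z \<in> borel_measurable leb01" "\<And>\<tau>. 0 \<le> \<tau> \<Longrightarrow> distr_fun z \<tau> \<le> distr_fun x \<tau>"
    "(\<integral>\<^sup>+t. ennreal (rearr x t * rearr y t) \<partial>leb01) \<le> (\<integral>\<^sup>+t. ennreal \<bar>z t * y t\<bar> \<partial>leb01)"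
    using Hardy_Littlewood_attained[OF meas[OF x] ym] by blast
  have zE: "z \<in> funs E" "fnorm E z \<le> fnorm E x" using distr_mono[OF x z(1,2)] by auto
  note z(3)
  also have "(\<integral>\<^sup>+t. ennreal \<bar>z t * y t\<bar> \<partial>leb01) \<le> ennreal (fnorm E z * fnorm (kothe_dual E) y)"
    by (rule kothe_Holder_nn[OF E y zE(1)])
  also have "\<dots> \<le> ennreal (fnorm E x * fnorm (kothe_dual E) y)"
    by (intro ennreal_leI mult_right_mono zE kothe_norm_nonneg[OF E y])
  finally show ?thesis .
qed

lemma kothe_dual_sym:
  assumes E: "absorbs_sequences E" and nt: "\<exists>y\<in>funs (kothe_dual E). \<not> (AE t in leb01. y t = 0)"
  shows "sym_space (kothe_dual E)"
proof
  let ?E = "kothe_dual E"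
  show "f \<in> borel_measurable leb01" if "f \<in> funs ?E" for f using that by (simp add: kothe_dual_mem)
  show a: "(\<lambda>t. f t + g t) \<in> funs ?E" if "f \<in> funs ?E" "g \<in> funs ?E" for f g
    using that by (auto simp: kothe_dual_mem distrib_left)
  show "fnorm ?E (\<lambda>t. f t + g t) \<le> fnorm ?E f + fnorm ?E g" if "f \<in> funs ?E" "g \<in> funs ?E" for f g
  proof (rule kothe_least)
    fix x assume x: "x \<in> funs E" "fnorm E x \<le> 1"
    have "(LINT t|leb01. x t * (f t + g t)) = (LINT t|leb01. x t * f t) + (LINT t|leb01. x t * g t)"
      using that x by (simp add: distrib_left kothe_dual_mem)
    then show "(LINT t|leb01. x t * (f t + g t)) \<le> fnorm ?E f + fnorm ?E g"
      using kothe_upper[OF E that(1) x] kothe_upper[OF E that(2) x] by simp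
  qed
  show s: "(\<lambda>t. c * f t) \<in> funs ?E" if "f \<in> funs ?E" for f c
  proof -
    have "integrable leb01 (\<lambda>t. x t * (c * f t))" if "x \<in> funs E" for x
      using integrable_mult_right[of c leb01 "\<lambda>t. x t * f t"] that \<open>f \<in> funs ?E\<close>
      by (simp add: kothe_dual_mem mult.left_commute)
    then show ?thesis using that by (auto simp: kothe_dual_mem)
  qed
  have le: "fnorm ?E (\<lambda>t. c * f t) \<le> \<bar>c\<bar> * fnorm ?E f" if "f \<in> funs ?E" for f c
  proof (rule kothe_least)
    fix x assume x: "x \<in> funs E" "fnorm E x \<le> 1"
    have "(LINT t|leb01. x t * (c * f t)) = c * (LINT t|leb01. x t * f t)"
      by (simp add: mult.left_commute)
    also have "\<dots> \<le> \<bar>c\<bar> * \<bar>LINT t|leb01. x t * f t\<bar>" by (simp flip: abs_mult)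
    also have "\<dots> \<le> \<bar>c\<bar> * (fnorm E x * fnorm ?E f)"
      by (intro mult_left_mono kothe_Holder E that x) simp
    also have "\<dots> \<le> \<bar>c\<bar> * (1 * fnorm ?E f)"
      by (intro mult_left_mono mult_right_mono x kothe_norm_nonneg E that) simp
    finally show "(LINT t|leb01. x t * (c * f t)) \<le> \<bar>c\<bar> * fnorm ?E f" by simp
  qed
  show "fnorm ?E (\<lambda>t. c * f t) = \<bar>c\<bar> * fnorm ?E f" if "f \<in> funs ?E" for f c
  proof (cases "c = 0")
    case True
    then show ?thesis using le[OF that, of 0] kothe_norm_nonneg[OF E s[OF that, of 0]] by simp
  next
    case False
    have "fnorm ?E f \<le> \<bar>1 / c\<bar> * fnorm ?E (\<lambda>t. c * f t)" using le[OF s[OF that, of c], of "1 / c"] False by simp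
    then have "\<bar>c\<bar> * fnorm ?E f \<le> fnorm ?E (\<lambda>t. c * f t)" using False by (simp add: field_simps)
    then show ?thesis using le[OF that, of c] by simp
  qed
  show "0 \<le> fnorm ?E f" if "f \<in> funs ?E" for f by (rule kothe_norm_nonneg[OF E that])
  show "g \<in> funs ?E \<and> fnorm ?E g \<le> fnorm ?E f"
    if f: "f \<in> funs ?E" and g: "g \<in> borel_measurable leb01" and le: "\<And>t. 0 < t \<Longrightarrow> rearr g t \<le> rearr f t" for f g
  proof -
    have fm: "f \<in> borel_measurable leb01" using f by (simp add: kothe_dual_mem)
    have main: "(\<integral>\<^sup>+t. ennreal \<bar>x t * g t\<bar> \<partial>leb01) \<le> ennreal (fnorm E x * fnorm ?E f)" if x: "x \<in> funs E" for x
    proof -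
      have "(\<integral>\<^sup>+t. ennreal \<bar>x t * g t\<bar> \<partial>leb01) \<le> (\<integral>\<^sup>+t. ennreal (rearr x t * rearr g t) \<partial>leb01)"
        by (rule Hardy_Littlewood[OF meas[OF x] g])
      also have "\<dots> \<le> (\<integral>\<^sup>+t. ennreal (rearr x t * rearr f t) \<partial>leb01)"
        using AE_leb01_pos
        by (intro nn_integral_mono_AE)
           (auto elim!: eventually_mono intro!: ennreal_leI mult_left_mono le rearr_nonneg meas[OF x])
      also have "\<dots> \<le> ennreal (fnorm E x * fnorm ?E f)" by (rule kothe_rearr[OF E f x])
      finally show ?thesis .
    qed
    have int: "integrable leb01 (\<lambda>t. x t * g t)" if x: "x \<in> funs E" for x
      using le_less_trans[OF main[OF x] ennreal_less_top] meas[OF x] g by (intro integrable_of_nn_integral_abs) auto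
    have "fnorm ?E g \<le> fnorm ?E f"
    proof (rule kothe_least)
      fix x assume x: "x \<in> funs E" "fnorm E x \<le> 1"
      have "ennreal (LINT t|leb01. \<bar>x t * g t\<bar>) = (\<integral>\<^sup>+t. ennreal \<bar>x t * g t\<bar> \<partial>leb01)"
        using int[OF x(1)] by (intro nn_integral_eq_integral[symmetric]) auto
      also note main[OF x(1)]
      also have "ennreal (fnorm E x * fnorm ?E f) \<le> ennreal (1 * fnorm ?E f)"
        by (intro ennreal_leI mult_right_mono x kothe_norm_nonneg[OF E f])
      finally have "(LINT t|leb01. \<bar>x t * g t\<bar>) \<le> fnorm ?E f"
        using kothe_norm_nonneg[OF E f] by simp
      moreover have "(LINT t|leb01. x t * g t) \<le> \<bar>LINT t|leb01. x t * g t\<bar>" by simp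
      moreover have "\<bar>LINT t|leb01. x t * g t\<bar> \<le> (LINT t|leb01. \<bar>x t * g t\<bar>)" by (rule integral_abs_bound)
      ultimately show "(LINT t|leb01. x t * g t) \<le> fnorm ?E f" by linarith
    qed
    then show ?thesis using int g by (simp add: kothe_dual_mem)
  qed
  show "\<exists>f\<in>funs ?E. \<not> (AE t in leb01. f t = 0)" by (rule nt)
qed

text \<open>The sum g of 2^(-n) |y_n| is tested against each x by monotone convergence, which keeps
  norm limits in the dual out of the argument. Testing against 1 shows that the sum is finite
  a.e.\<close>

lemma kothe_dual_absorbs:
  assumes E: "absorbs_sequences E"
  shows "absorbs_sequences (kothe_dual E)"
  unfolding absorbs_sequences_def
proof (intro allI impI)
  fix y :: "nat \<Rightarrow> real \<Rightarrow> real" assume y: "\<forall>n. y n \<in> funs (kothe_dual E) \<and> fnorm (kothe_dual E) (y n) \<le> 1"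
  have ym [measurable]: "y n \<in> borel_measurable leb01" for n using y by (simp add: kothe_dual_mem)
  define g where "g t = (\<Sum>n. \<bar>y n t\<bar> / 2 ^ n)" for t
  have gm [measurable]: "g \<in> borel_measurable leb01" unfolding g_def[abs_def] by measurable
  have bound: "(\<integral>\<^sup>+t. (\<Sum>n. ennreal (\<bar>x t\<bar> * (\<bar>y n t\<bar> / 2 ^ n))) \<partial>leb01) \<le> ennreal (2 * fnorm E x)"
    if x: "x \<in> funs E" for x
  proof -
    have [measurable]: "x \<in> borel_measurable leb01" by (rule meas[OF x])
    have "(\<integral>\<^sup>+t. (\<Sum>n. ennreal (\<bar>x t\<bar> * (\<bar>y n t\<bar> / 2 ^ n))) \<partial>leb01)
      = (\<Sum>n. \<integral>\<^sup>+t. ennreal (\<bar>x t\<bar> * (\<bar>y n t\<bar> / 2 ^ n)) \<partial>leb01)"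
      by (rule nn_integral_suminf) measurable
    also have "\<dots> \<le> (\<Sum>n. ennreal ((1 / 2) ^ n * fnorm E x))"
    proof (rule suminf_le)
      fix n
      have "(\<integral>\<^sup>+t. ennreal (\<bar>x t\<bar> * (\<bar>y n t\<bar> / 2 ^ n)) \<partial>leb01)
        = (\<integral>\<^sup>+t. ennreal ((1 / 2) ^ n) * ennreal \<bar>x t * y n t\<bar> \<partial>leb01)"
        by (intro nn_integral_cong) (simp add: abs_mult power_divide flip: ennreal_mult)
      also have "\<dots> = ennreal ((1 / 2) ^ n) * (\<integral>\<^sup>+t. ennreal \<bar>x t * y n t\<bar> \<partial>leb01)"
        by (rule nn_integral_cmult) measurable
      also have "\<dots> \<le> ennreal ((1 / 2) ^ n) * ennreal (fnorm E x * fnorm (kothe_dual E) (y n))"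
        using y by (intro mult_left_mono kothe_Holder_nn E x) auto
      also have "\<dots> \<le> ennreal ((1 / 2) ^ n) * ennreal (fnorm E x * 1)"
        using y by (intro mult_left_mono ennreal_leI norm_nonneg[OF x]) auto
      finally show "(\<integral>\<^sup>+t. ennreal (\<bar>x t\<bar> * (\<bar>y n t\<bar> / 2 ^ n)) \<partial>leb01) \<le> ennreal ((1 / 2) ^ n * fnorm E x)"
        by (simp add: norm_nonneg[OF x] flip: ennreal_mult)
    qed auto
    also have "\<dots> = ennreal (2 * fnorm E x)"
    proof (rule suminf_ennreal_eq)
      have "(\<lambda>n. (1 / 2 :: real) ^ n) sums 2" using geometric_sums[of "1/2 :: real"] by simp
      then show "(\<lambda>n. (1 / 2) ^ n * fnorm E x) sums (2 * fnorm E x)" by (rule sums_mult2)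
    qed (simp add: norm_nonneg[OF x])
    finally show ?thesis .
  qed
  have "(\<integral>\<^sup>+t. (\<Sum>n. ennreal (\<bar>y n t\<bar> / 2 ^ n)) \<partial>leb01) \<noteq> \<infinity>"
    using le_less_trans[OF bound[OF one] ennreal_less_top] by simp
  then have "AE t in leb01. (\<Sum>n. ennreal (\<bar>y n t\<bar> / 2 ^ n)) \<noteq> \<infinity>"
    by (intro nn_integral_PInf_AE) measurable
  then have summ: "AE t in leb01. summable (\<lambda>n. \<bar>y n t\<bar> / 2 ^ n)"
    by eventually_elim (intro summable_suminf_not_top, auto)
  have "g \<in> funs (kothe_dual E)"
    unfolding kothe_dual_mem
  proof (intro conjI ballI gm)
    fix x assume x: "x \<in> funs E"
    have [measurable]: "x \<in> borel_measurable leb01" by (rule meas[OF x])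
    have "(\<integral>\<^sup>+t. ennreal \<bar>x t * g t\<bar> \<partial>leb01) = (\<integral>\<^sup>+t. (\<Sum>n. ennreal (\<bar>x t\<bar> * (\<bar>y n t\<bar> / 2 ^ n))) \<partial>leb01)"
    proof (rule nn_integral_cong_AE)
      show "AE t in leb01. ennreal \<bar>x t * g t\<bar> = (\<Sum>n. ennreal (\<bar>x t\<bar> * (\<bar>y n t\<bar> / 2 ^ n)))"
        using summ
      proof eventually_elim
        case (elim t)
        have "(\<Sum>n. ennreal (\<bar>x t\<bar> * (\<bar>y n t\<bar> / 2 ^ n))) = ennreal (\<bar>x t\<bar> * g t)"
          unfolding g_def by (intro suminf_ennreal_eq sums_mult summable_sums elim) simp
        moreover have "0 \<le> g t" unfolding g_def by (intro suminf_nonneg elim) simp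
        ultimately show ?case by (simp add: abs_mult)
      qed
    qed
    then show "integrable leb01 (\<lambda>t. x t * g t)"
      using le_less_trans[OF bound[OF x] ennreal_less_top] by (intro integrable_of_nn_integral_abs) auto
  qed
  moreover have "AE t in leb01. \<bar>y n t\<bar> \<le> 2 ^ n * \<bar>g t\<bar>" for n
    using summ
  proof eventually_elim
    case (elim t)
    have "(\<Sum>i\<in>{n}. \<bar>y i t\<bar> / 2 ^ i) \<le> g t" unfolding g_def by (intro sum_le_suminf elim) auto
    then have "\<bar>y n t\<bar> / 2 ^ n \<le> \<bar>g t\<bar>" by simp
    then show ?case by (simp add: field_simps)
  qed
  ultimately show "\<exists>g\<in>funs (kothe_dual E). \<forall>n. AE t in leb01. \<bar>y n t\<bar> \<le> 2 ^ n * \<bar>g t\<bar>" by blast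
qed

end

text \<open>A space and its dual in a form that is symmetric in the two partners. For Z = X the
  assumption \<open>norming\<close> expresses the isometric embedding into the bidual, and
  \<open>norming_dual\<close> the definition of the dual norm.\<close>

locale dual_pair = Z: sym_space Z + Y: sym_space Y for Z Y :: fspace +
  assumes Holder_nn: "z \<in> funs Z \<Longrightarrow> y \<in> funs Y \<Longrightarrow>
      (\<integral>\<^sup>+t. ennreal \<bar>z t * y t\<bar> \<partial>leb01) \<le> ennreal (fnorm Z z * fnorm Y y)"
    and norming: "z \<in> funs Z \<Longrightarrow>
      (\<And>y. y \<in> funs Y \<Longrightarrow> fnorm Y y \<le> 1 \<Longrightarrow> \<bar>LINT t|leb01. z t * y t\<bar> \<le> C) \<Longrightarrow> fnorm Z z \<le> C"
    and norming_dual: "y \<in> funs Y \<Longrightarrow>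
      (\<And>z. z \<in> funs Z \<Longrightarrow> fnorm Z z \<le> 1 \<Longrightarrow> \<bar>LINT t|leb01. z t * y t\<bar> \<le> C) \<Longrightarrow> fnorm Y y \<le> C"
begin

lemma flip: "dual_pair Y Z"
proof
  show "(\<integral>\<^sup>+t. ennreal \<bar>y t * z t\<bar> \<partial>leb01) \<le> ennreal (fnorm Y y * fnorm Z z)"
    if "y \<in> funs Y" "z \<in> funs Z" for y z
    using Holder_nn[OF that(2,1)] by (simp add: mult.commute)
qed (use norming norming_dual in \<open>simp_all add: mult.commute\<close>)

lemma integrable_mult:
  assumes "z \<in> funs Z" "y \<in> funs Y"
  shows "integrable leb01 (\<lambda>t. z t * y t)"
  using le_less_trans[OF Holder_nn[OF assms] ennreal_less_top] Z.meas[OF assms(1)] Y.meas[OF assms(2)]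
  by (intro integrable_of_nn_integral_abs) auto

lemma Holder:
  assumes "z \<in> funs Z" "y \<in> funs Y"
  shows "(LINT t|leb01. \<bar>z t * y t\<bar>) \<le> fnorm Z z * fnorm Y y"
proof -
  have "ennreal (LINT t|leb01. \<bar>z t * y t\<bar>) \<le> ennreal (fnorm Z z * fnorm Y y)"
    using Holder_nn[OF assms] nn_integral_eq_integral[of leb01 "\<lambda>t. \<bar>z t * y t\<bar>"] integrable_mult[OF assms]
    by simp
  then show ?thesis
    using Z.norm_nonneg[OF assms(1)] Y.norm_nonneg[OF assms(2)] by (simp add: ennreal_le_iff)
qed

lemma Holder_abs:
  assumes "z \<in> funs Z" "y \<in> funs Y"
  shows "\<bar>LINT t|leb01. z t * y t\<bar> \<le> fnorm Z z * fnorm Y y"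
  using order_trans[OF integral_abs_bound Holder[OF assms]] .

lemma Holder_rearr:
  assumes "z \<in> funs Z" "y \<in> funs Y"
  shows "(\<integral>\<^sup>+t. ennreal (rearr z t * rearr y t) \<partial>leb01) \<le> ennreal (fnorm Z z * fnorm Y y)"
proof -
  have "(\<integral>\<^sup>+t. ennreal (rearr z t * rearr y t) \<partial>leb01) = (\<integral>\<^sup>+t. ennreal \<bar>rearr z t * rearr y t\<bar> \<partial>leb01)"
    using AE_leb01_pos Z.meas[OF assms(1)] Y.meas[OF assms(2)]
    by (intro nn_integral_cong_AE) (auto elim!: eventually_mono simp: rearr_nonneg)
  also have "\<dots> \<le> ennreal (fnorm Z (rearr z) * fnorm Y (rearr y))"
    by (intro Holder_nn Z.rearr_mem Y.rearr_mem assms)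
  also have "\<dots> \<le> ennreal (fnorm Z z * fnorm Y y)"
    by (intro ennreal_leI mult_mono Z.rearr_mem Y.rearr_mem assms Z.norm_nonneg Y.norm_nonneg)
  finally show ?thesis .
qed

end

lemma dual_pair_kothe:
  assumes X: "symmetric_space X" and iso: "isometric_in_bidual X"
    and nt: "\<exists>y\<in>funs (kothe_dual X). \<not> (AE t in leb01. y t = 0)"
  shows "dual_pair X (kothe_dual X)"
proof -
  note E = symmetric_space_absorbs[OF X]
  interpret X: sym_space X by (rule symmetric_space_sym[OF X])
  interpret Y: sym_space "kothe_dual X" by (rule X.kothe_dual_sym[OF E nt])
  show ?thesis
  proof
    show "(\<integral>\<^sup>+t. ennreal \<bar>z t * y t\<bar> \<partial>leb01) \<le> ennreal (fnorm X z * fnorm (kothe_dual X) y)"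
      if "z \<in> funs X" "y \<in> funs (kothe_dual X)" for z y by (rule X.kothe_Holder_nn[OF E that(2,1)])
    fix z C assume z: "z \<in> funs X" and
      C: "\<And>y. y \<in> funs (kothe_dual X) \<Longrightarrow> fnorm (kothe_dual X) y \<le> 1 \<Longrightarrow> \<bar>LINT t|leb01. z t * y t\<bar> \<le> C"
    have "fnorm (kothe_dual (kothe_dual X)) z \<le> C"
    proof (rule Y.kothe_least)
      fix y assume "y \<in> funs (kothe_dual X)" "fnorm (kothe_dual X) y \<le> 1"
      from C[OF this] show "(LINT t|leb01. y t * z t) \<le> C" by (simp add: mult.commute abs_le_iff)
    qed
    then show "fnorm X z \<le> C" using iso z by (simp add: isometric_in_bidual_def)
  next
    fix y C assume y: "y \<in> funs (kothe_dual X)" and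
      C: "\<And>z. z \<in> funs X \<Longrightarrow> fnorm X z \<le> 1 \<Longrightarrow> \<bar>LINT t|leb01. z t * y t\<bar> \<le> C"
    show "fnorm (kothe_dual X) y \<le> C"
    proof (rule X.kothe_least)
      fix x assume "x \<in> funs X" "fnorm X x \<le> 1"
      from C[OF this] show "(LINT t|leb01. x t * y t) \<le> C" by (simp add: abs_le_iff)
    qed
  qed
qed

section \<open>Uniform boundedness\<close>

text \<open>Sokal's gliding hump proof. Functions stand for vectors; \<open>N\<close> is only a seminorm.\<close>

lemma uniform_boundedness:
  fixes S :: "('i \<Rightarrow> real) set" and N :: "('i \<Rightarrow> real) \<Rightarrow> real" and p :: "'j \<Rightarrow> ('i \<Rightarrow> real) \<Rightarrow> real"
  assumes S0: "S \<noteq> {}"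
    and S: "\<And>x y c. x \<in> S \<Longrightarrow> y \<in> S \<Longrightarrow> (\<lambda>i. x i + c * y i) \<in> S"
    and S_scale: "\<And>x c. x \<in> S \<Longrightarrow> (\<lambda>i. c * x i) \<in> S"
    and N: "\<And>x y c. x \<in> S \<Longrightarrow> y \<in> S \<Longrightarrow> N (\<lambda>i. x i + c * y i) \<le> N x + \<bar>c\<bar> * N y"
    and N_scale: "\<And>x c. x \<in> S \<Longrightarrow> N (\<lambda>i. c * x i) \<le> \<bar>c\<bar> * N x"
    and N_nonneg: "\<And>x. x \<in> S \<Longrightarrow> 0 \<le> N x"
    and p: "\<And>j x y c. j \<in> J \<Longrightarrow> x \<in> S \<Longrightarrow> y \<in> S \<Longrightarrow> p j (\<lambda>i. x i + c * y i) \<le> p j x + \<bar>c\<bar> * p j y"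
    and p_scale: "\<And>j x c. j \<in> J \<Longrightarrow> x \<in> S \<Longrightarrow> p j (\<lambda>i. c * x i) \<le> \<bar>c\<bar> * p j x"
    and p_bdd: "\<And>j. j \<in> J \<Longrightarrow> \<exists>K. \<forall>x\<in>S. p j x \<le> K * N x"
    and pointwise: "\<And>x. x \<in> S \<Longrightarrow> \<exists>B. \<forall>j\<in>J. p j x \<le> B"
    and complete: "\<And>s. (\<And>n. s n \<in> S) \<Longrightarrow> (\<And>n. N (\<lambda>i. s (Suc n) i - s n i) \<le> (1 / 3) ^ n) \<Longrightarrow>
      \<exists>l\<in>S. (\<lambda>n. N (\<lambda>i. s n i - l i)) \<longlonglongrightarrow> 0"
  shows "\<exists>C\<ge>0. \<forall>j\<in>J. \<forall>x\<in>S. p j x \<le> C * N x"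
proof (rule ccontr)
  assume neg: "\<not> ?thesis"
  have S_diff: "(\<lambda>i. x i - y i) \<in> S" if "x \<in> S" "y \<in> S" for x y
    using S[OF that, of "-1"] by simp
  define Ks where "Ks j = {K. 0 \<le> K \<and> (\<forall>x\<in>S. p j x \<le> K * N x)}" for j
  \<comment> \<open>The operator seminorm of \<open>p j\<close>, as the least admissible constant. A
    common bound for all \<open>M j\<close> would serve as C, so there are indices with
    \<open>M j\<close> above any 4^n.\<close>
  define M where "M j = Inf (Ks j)" for j
  have Ks: "Ks j \<noteq> {}" if "j \<in> J" for j
  proof -
    obtain K where "\<forall>x\<in>S. p j x \<le> K * N x" using p_bdd[OF \<open>j \<in> J\<close>] by blast
    then have "max 0 K \<in> Ks j"
      by (auto simp: Ks_def intro: order_trans[OF _ mult_right_mono] N_nonneg)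
    then show ?thesis by blast
  qed
  have M0: "0 \<le> M j" if "j \<in> J" for j
    unfolding M_def using Ks[OF that] by (intro cInf_greatest) (auto simp: Ks_def)
  have M1: "p j x \<le> M j * N x" if j: "j \<in> J" and x: "x \<in> S" for j x
  proof (cases "N x = 0")
    case True
    then show ?thesis using Ks[OF j] x by (auto simp: Ks_def)
  next
    case False
    then have Nx: "0 < N x" using N_nonneg[OF x] by simp
    have "p j x / N x \<le> M j"
      unfolding M_def using Ks[OF j] Nx x by (intro cInf_greatest) (auto simp: Ks_def field_simps)
    then show ?thesis using Nx by (simp add: field_simps)
  qed
  have "\<exists>j\<in>J. 4 ^ n < M j" for n :: nat
  proof (rule ccontr)
    assume "\<not> ?thesis"
    then have "M j \<le> 4 ^ n" if "j \<in> J" for j using that by (auto simp: not_less)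
    then have "p j x \<le> 4 ^ n * N x" if "j \<in> J" "x \<in> S" for j x
      using order_trans[OF M1[OF that] mult_right_mono[OF _ N_nonneg[OF that(2)]]] that by blast
    then have "0 \<le> (4::real) ^ n \<and> (\<forall>j\<in>J. \<forall>x\<in>S. p j x \<le> 4 ^ n * N x)" by simp
    then show False using neg by blast
  qed
  then obtain jj :: "nat \<Rightarrow> 'j" where jj: "\<And>n. jj n \<in> J" "\<And>n. 4 ^ n < M (jj n)" by metis
  have Mp: "0 < M (jj n)" for n using less_trans[OF zero_less_power jj(2)[of n]] by simp
  have "\<exists>z\<in>S. 3 / 4 * M (jj n) * N z < p (jj n) z" for n
  proof (rule ccontr)
    assume "\<not> ?thesis"
    then have "3 / 4 * M (jj n) \<in> Ks (jj n)" using Mp[of n] by (auto simp: Ks_def not_less)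
    then have "M (jj n) \<le> 3 / 4 * M (jj n)"
      unfolding M_def by (rule cInf_lower) (auto simp: Ks_def bdd_below_def)
    then show False using Mp[of n] by simp
  qed
  then obtain z :: "nat \<Rightarrow> 'i \<Rightarrow> real" where z: "\<And>n. z n \<in> S" "\<And>n. 3 / 4 * M (jj n) * N (z n) < p (jj n) (z n)"
    by metis
  have Nz: "0 < N (z n)" for n
  proof (rule ccontr)
    assume "\<not> 0 < N (z n)"
    then have "N (z n) = 0" using N_nonneg[OF z(1)[of n]] by simp
    then show False using z(2)[of n] M1[OF jj(1) z(1), of n n] by simp
  qed
  define c where "c n = (1 / 3) ^ n / N (z n)" for n
  have c: "c n > 0" "c n * N (z n) = (1 / 3) ^ n" for n using Nz[of n] by (auto simp: c_def)
  obtain z0 where z0: "z0 \<in> S" using S0 by blast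
  \<comment> \<open>Of x + c z and x - c z the one with the larger value of \<open>p\<close> is
    kept. Their difference is 2 c z, so by subadditivity the larger value is at least c times the
    value at z.\<close>
  define s where "s = rec_nat z0 (\<lambda>n x. if p (jj n) (\<lambda>i. x i - c n * z n i) \<le> p (jj n) (\<lambda>i. x i + c n * z n i)
      then (\<lambda>i. x i + c n * z n i) else (\<lambda>i. x i - c n * z n i))"
  have s_0: "s 0 = z0" by (simp add: s_def)
  have s_Suc: "s (Suc n) = (if p (jj n) (\<lambda>i. s n i - c n * z n i) \<le> p (jj n) (\<lambda>i. s n i + c n * z n i)
      then (\<lambda>i. s n i + c n * z n i) else (\<lambda>i. s n i - c n * z n i))" for n
    by (simp add: s_def)
  have minus: "(\<lambda>i. x i - d * y i) = (\<lambda>i. x i + (- d) * y i)" for d and x y :: "'i \<Rightarrow> real" by simp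
  have s: "s n \<in> S" for n
  proof (induction n)
    case (Suc n)
    have "(\<lambda>i. s n i + c n * z n i) \<in> S" "(\<lambda>i. s n i - c n * z n i) \<in> S"
      unfolding minus by (rule S[OF Suc z(1)])+
    then show ?case by (simp add: s_Suc)
  qed (simp add: s_0 z0)
  have step: "N (\<lambda>i. s (Suc n) i - s n i) \<le> (1 / 3) ^ n" for n
  proof -
    have "(\<lambda>i. s (Suc n) i - s n i) = (\<lambda>i. c n * z n i) \<or> (\<lambda>i. s (Suc n) i - s n i) = (\<lambda>i. (- c n) * z n i)"
      by (auto simp: s_Suc)
    moreover have "N (\<lambda>i. d * z n i) \<le> (1 / 3) ^ n" if "\<bar>d\<bar> = c n" for d
      using N_scale[OF z(1), of d n] c(2)[of n] that by simp
    from this[of "c n"] this[of "- c n"] have "N (\<lambda>i. c n * z n i) \<le> (1 / 3) ^ n"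
      "N (\<lambda>i. (- c n) * z n i) \<le> (1 / 3) ^ n" using c(1)[of n] by simp_all
    ultimately show ?thesis by (elim disjE) (simp_all only:)
  qed
  obtain l where l: "l \<in> S" "(\<lambda>n. N (\<lambda>i. s n i - l i)) \<longlonglongrightarrow> 0" using complete[OF s step] by blast
  have tail: "N (\<lambda>i. s (Suc n + k) i - s (Suc n) i) \<le> 1 / 2 * (1 / 3) ^ n - 1 / 2 * (1 / 3) ^ (n + k)" for n k
  proof (induction k)
    case 0
    show ?case using N_scale[OF s, of 0 0] by simp
  next
    case (Suc k)
    have "(\<lambda>i. s (Suc n + Suc k) i - s (Suc n) i)
        = (\<lambda>i. (s (Suc (Suc n + k)) i - s (Suc n + k) i) + 1 * (s (Suc n + k) i - s (Suc n) i))"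
      by simp
    then have "N (\<lambda>i. s (Suc n + Suc k) i - s (Suc n) i)
        \<le> N (\<lambda>i. s (Suc (Suc n + k)) i - s (Suc n + k) i) + \<bar>1\<bar> * N (\<lambda>i. s (Suc n + k) i - s (Suc n) i)"
      using N[OF S_diff[OF s s] S_diff[OF s s]] by metis
    then show ?case using step[of "Suc n + k"] Suc.IH by simp
  qed
  have close: "N (\<lambda>i. s (Suc n) i - l i) \<le> 1 / 2 * (1 / 3) ^ n" for n
  proof -
    have "N (\<lambda>i. s (Suc n) i - l i) \<le> N (\<lambda>i. s (k + Suc n) i - l i) + 1 / 2 * (1 / 3) ^ n" for k
    proof -
      have "(\<lambda>i. s (Suc n) i - l i) = (\<lambda>i. (s (k + Suc n) i - l i) + (-1) * (s (Suc n + k) i - s (Suc n) i))"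
        by (simp add: add.commute)
      then have "N (\<lambda>i. s (Suc n) i - l i) \<le> N (\<lambda>i. s (k + Suc n) i - l i) + \<bar>-1\<bar> * N (\<lambda>i. s (Suc n + k) i - s (Suc n) i)"
        using N[OF S_diff[OF s l(1)] S_diff[OF s s]] by metis
      moreover have "0 \<le> (1 / 3 :: real) ^ (n + k)" by simp
      ultimately show ?thesis using tail[of n k] by linarith
    qed
    note bound = this
    have "(\<lambda>k. N (\<lambda>i. s (k + Suc n) i - l i) + 1 / 2 * (1 / 3) ^ n) \<longlonglongrightarrow> 0 + 1 / 2 * (1 / 3) ^ n"
      by (intro tendsto_add tendsto_const LIMSEQ_ignore_initial_segment[OF l(2)])
    from LIMSEQ_le_const[OF this] have "N (\<lambda>i. s (Suc n) i - l i) \<le> 0 + 1 / 2 * (1 / 3) ^ n"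
      using bound by blast
    then show ?thesis by simp
  qed
  have big: "3 / 4 * M (jj n) * (1 / 3) ^ n \<le> p (jj n) (s (Suc n))" for n
  proof -
    let ?u = "\<lambda>i. s n i + c n * z n i" and ?v = "\<lambda>i. s n i - c n * z n i"
    have uv: "?u \<in> S" "?v \<in> S" unfolding minus by (rule S[OF s z(1)])+
    have "(\<lambda>i. ?u i + (-1) * ?v i) = (\<lambda>i. (2 * c n) * z n i)" by auto
    then have "p (jj n) (\<lambda>i. (2 * c n) * z n i) \<le> p (jj n) ?u + p (jj n) ?v"
      using p[OF jj(1) uv, of n "-1"] by simp
    also have "\<dots> \<le> 2 * p (jj n) (s (Suc n))" by (simp add: s_Suc)
    finally have a: "p (jj n) (\<lambda>i. (2 * c n) * z n i) \<le> 2 * p (jj n) (s (Suc n))" .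
    have "(\<lambda>i. 1 / (2 * c n) * ((2 * c n) * z n i)) = z n" using c(1)[of n] by auto
    with p_scale[OF jj(1) S_scale[OF z(1)[of n]], of n "1 / (2 * c n)" "2 * c n"]
    have "p (jj n) (z n) \<le> \<bar>1 / (2 * c n)\<bar> * p (jj n) (\<lambda>i. (2 * c n) * z n i)" by (simp only:)
    also have "\<dots> \<le> 1 / (2 * c n) * (2 * p (jj n) (s (Suc n)))"
      unfolding abs_of_pos[OF divide_pos_pos[OF zero_less_one mult_pos_pos[OF zero_less_numeral c(1)]]]
      using a c(1)[of n] by (intro mult_left_mono) simp_all
    finally have "c n * p (jj n) (z n) \<le> c n * (1 / (2 * c n) * (2 * p (jj n) (s (Suc n))))"
      using c(1)[of n] by (intro mult_left_mono) simp_all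
    also have "\<dots> = p (jj n) (s (Suc n))" using c(1)[of n] by simp
    finally have "c n * p (jj n) (z n) \<le> p (jj n) (s (Suc n))" .
    moreover have "c n * (3 / 4 * M (jj n) * N (z n)) \<le> c n * p (jj n) (z n)"
      using z(2)[of n] c(1)[of n] by simp
    moreover have "c n * (3 / 4 * M (jj n) * N (z n)) = 3 / 4 * M (jj n) * (c n * N (z n))" by simp
    ultimately show ?thesis unfolding c(2) by linarith
  qed
  \<comment> \<open>The main term 3/4 M 3^(-n) outweighs the later steps, which contribute at most
    1/2 M 3^(-n). With M above 4^n the remaining quarter is at least (4/3)^n / 4, and this is
    unbounded.\<close>
  have "1 / 4 * (4 / 3) ^ n \<le> p (jj n) l" for n
  proof -
    have "(\<lambda>i. l i + 1 * (s (Suc n) i - l i)) = s (Suc n)" by simp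
    then have "p (jj n) (s (Suc n)) \<le> p (jj n) l + p (jj n) (\<lambda>i. s (Suc n) i - l i)"
      using p[OF jj(1) l(1) S_diff[OF s l(1)], of n 1 "Suc n"] by simp
    also have "p (jj n) (\<lambda>i. s (Suc n) i - l i) \<le> M (jj n) * (1 / 2 * (1 / 3) ^ n)"
      by (rule order_trans[OF M1[OF jj(1) S_diff[OF s l(1)]] mult_left_mono[OF close M0[OF jj(1)]]])
    finally have "1 / 4 * M (jj n) * (1 / 3) ^ n \<le> p (jj n) l" using big[of n] by simp
    moreover have "1 / 4 * 4 ^ n * (1 / 3) ^ n \<le> 1 / 4 * M (jj n) * (1 / 3) ^ n"
      using jj(2)[of n] by simp
    moreover have "1 / 4 * 4 ^ n * (1 / 3) ^ n = 1 / 4 * (4 / 3 :: real) ^ n" by (simp add: power_divide)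
    ultimately show ?thesis by linarith
  qed
  note large = this
  obtain B where B: "\<And>j. j \<in> J \<Longrightarrow> p j l \<le> B" using pointwise[OF l(1)] by blast
  obtain n :: nat where "4 * B < (4 / 3) ^ n" using real_arch_pow[of "4 / 3" "4 * B"] by auto
  then show False using B[OF jj(1)[of n]] large[of n] by linarith
qed

section \<open>The Orlicz space of \<open>exp (t\<^sup>2) - 1\<close>\<close>

abbreviation (input) L_half :: "real \<Rightarrow> real" where
  "L_half t \<equiv> sqrt (ln (exp 1 / t))"

lemma L_half_sq: "0 < t \<Longrightarrow> t \<le> 1 \<Longrightarrow> (L_half t)\<^sup>2 = 1 - ln t"
  by (simp add: ln_div) (smt (verit) ln_le_zero_iff real_sqrt_pow2)

lemma L_half_ge_1: "0 < t \<Longrightarrow> t \<le> 1 \<Longrightarrow> 1 \<le> L_half t"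
  using ln_le_zero_iff[of t] by (simp add: ln_div)

context
  fixes N2 :: "real \<Rightarrow> real"
  assumes orl: "orlicz_function N2" and eqv: "orlicz_equivalent N2 (\<lambda>t. exp (t\<^sup>2) - 1)"
begin

lemma orlicz_mono: "0 \<le> x \<Longrightarrow> x \<le> y \<Longrightarrow> N2 x \<le> N2 y"
  using orl by (auto simp: orlicz_function_def mono_on_def)

lemma orlicz_nonneg: "0 \<le> x \<Longrightarrow> 0 \<le> N2 x"
  using orlicz_mono[of 0 x] orl by (simp add: orlicz_function_def)

lemma orlicz_convex:
  assumes "0 \<le> x" "0 \<le> y" "0 \<le> u" "0 \<le> v" "u + v = 1"
  shows "N2 (u * x + v * y) \<le> u * N2 x + v * N2 y"
  using orl assms unfolding orlicz_function_def convex_on_def by auto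

text \<open>The equivalence controls \<open>N2\<close> only beyond t0, and adding N2(t0) covers
  smaller arguments. Convexity with N2(0) = 0 divides the value by m = N2(t0) + 2 when the argument
  is divided by m, which brings the integral down to 1.\<close>

lemma orlicz_exp_sq:
  "\<exists>K>0. \<forall>f s. s > 0 \<longrightarrow> f \<in> borel_measurable leb01 \<longrightarrow> (\<integral>\<^sup>+t. ennreal (exp ((f t)\<^sup>2 / s\<^sup>2)) \<partial>leb01) \<le> 2 \<longrightarrow>
    (\<integral>\<^sup>+t. ennreal (N2 (\<bar>f t\<bar> / (K * s))) \<partial>leb01) \<le> 1"
proof -
  obtain C t0 where C: "C > 0" "t0 \<ge> 0" and up: "\<And>t. t \<ge> t0 \<Longrightarrow> N2 t \<le> exp ((C * t)\<^sup>2) - 1"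
    using eqv by (auto simp: orlicz_equivalent_def)
  define m where "m = N2 t0 + 2"
  have m: "m > 0" "1 \<le> m" using orlicz_nonneg[OF C(2)] by (auto simp: m_def)
  have "(\<integral>\<^sup>+t. ennreal (N2 (\<bar>f t\<bar> / (m * C * s))) \<partial>leb01) \<le> 1"
    if s: "s > 0" and f [measurable]: "f \<in> borel_measurable leb01"
      and ex: "(\<integral>\<^sup>+t. ennreal (exp ((f t)\<^sup>2 / s\<^sup>2)) \<partial>leb01) \<le> 2" for f s
  proof -
    have pt: "N2 (\<bar>f t\<bar> / (m * C * s)) \<le> (N2 t0 + exp ((f t)\<^sup>2 / s\<^sup>2)) / m" for t
    proof -
      define u where "u = \<bar>f t\<bar> / (C * s)"
      have u: "0 \<le> u" using C s by (simp add: u_def)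
      have "N2 (\<bar>f t\<bar> / (m * C * s)) = N2 (1 / m * u + (1 - 1 / m) * 0)"
        by (simp add: u_def mult.assoc)
      also have "\<dots> \<le> 1 / m * N2 u + (1 - 1 / m) * N2 0"
        using u m by (intro orlicz_convex) auto
      also have "N2 0 = 0" using orl by (simp add: orlicz_function_def)
      also have "N2 u \<le> N2 t0 + exp ((f t)\<^sup>2 / s\<^sup>2)"
      proof (cases "u \<le> t0")
        case True
        then show ?thesis using orlicz_mono[OF u True] by (simp add: add_increasing2)
      next
        case False
        have "(C * u)\<^sup>2 = (f t)\<^sup>2 / s\<^sup>2" using C by (simp add: u_def power_divide power_mult_distrib)
        then show ?thesis using up[of u] False orlicz_nonneg[OF C(2)] by simp
      qed
      finally show ?thesis using m by (simp add: divide_right_mono)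
    qed
    have "(\<integral>\<^sup>+t. ennreal (N2 (\<bar>f t\<bar> / (m * C * s))) \<partial>leb01)
      \<le> (\<integral>\<^sup>+t. ennreal (1 / m) * (ennreal (N2 t0) + ennreal (exp ((f t)\<^sup>2 / s\<^sup>2))) \<partial>leb01)"
      using pt m orlicz_nonneg[OF C(2)]
      by (intro nn_integral_mono) (simp add: ennreal_leI flip: ennreal_plus ennreal_mult)
    also have "\<dots> = ennreal (1 / m) * (ennreal (N2 t0) + (\<integral>\<^sup>+t. ennreal (exp ((f t)\<^sup>2 / s\<^sup>2)) \<partial>leb01))"
      by (simp add: nn_integral_cmult nn_integral_add)
    also have "\<dots> \<le> ennreal (1 / m) * (ennreal (N2 t0) + ennreal 2)"
      using ex by (intro mult_left_mono add_left_mono) auto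
    also have "\<dots> = ennreal (1 / m * (N2 t0 + 2))"
      using m orlicz_nonneg[OF C(2)] by (subst ennreal_mult, simp_all add: ennreal_plus)
    also have "1 / m * (N2 t0 + 2) = 1" using m by (simp add: m_def)
    finally show ?thesis by simp
  qed
  then show ?thesis using m C by (intro exI[of _ "m * C"]) auto
qed

text \<open>Where |g| exceeds K l log^(1/2)(e/t), the function N2(|g| / l) is at least 1/t. Its
  integral is at most 1, so this set has measure at most t.\<close>

lemma orlicz_rearr:
  "\<exists>K>0. \<forall>g l. l > 0 \<longrightarrow> g \<in> borel_measurable leb01 \<longrightarrow> (\<integral>\<^sup>+t. ennreal (N2 (\<bar>g t\<bar> / l)) \<partial>leb01) \<le> 1 \<longrightarrow>
    (\<forall>t. 0 < t \<longrightarrow> t \<le> 1 \<longrightarrow> rearr g t \<le> K * l * L_half t)"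
proof -
  obtain C t0 where C: "C > 0" "t0 \<ge> 0" and lo: "\<And>t. t \<ge> t0 \<Longrightarrow> exp ((t / C)\<^sup>2) - 1 \<le> N2 t"
    using eqv by (auto simp: orlicz_equivalent_def)
  \<comment> \<open>The bound t0 puts the argument into the range of the equivalence. The bound 2 C
    gives (K/C)^2 \<ge> 4, so the exponential is at least (e/t)^2 \<ge> 4/t, and subtracting 1 still
    leaves 1/t.\<close>
  define K where "K = max t0 (2 * C)"
  have K: "K > 0" "t0 \<le> K" "2 * C \<le> K" using C by (auto simp: K_def)
  have "rearr g t \<le> K * l * L_half t"
    if l: "l > 0" and g: "g \<in> borel_measurable leb01"
      and le: "(\<integral>\<^sup>+t. ennreal (N2 (\<bar>g t\<bar> / l)) \<partial>leb01) \<le> 1" and t: "0 < t" "t \<le> 1" for g l t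
  proof (rule rearr_le)
    note L1 = L_half_ge_1[OF t]
    show "0 \<le> K * l * L_half t" using K l L1 by simp
    let ?B = "{u \<in> {0..1}. \<bar>g u\<bar> > K * l * L_half t}"
    have "1 / t \<le> N2 (K * L_half t)"
    proof -
      have "t0 \<le> K * L_half t" using K L1 mult_left_mono[OF L1, of K] by linarith
      from lo[OF this] have a: "exp ((K * L_half t / C)\<^sup>2) - 1 \<le> N2 (K * L_half t)" .
      have "2 \<le> K / C" using K C by (simp add: field_simps)
      then have "2\<^sup>2 \<le> (K / C)\<^sup>2" by (rule power_mono) simp
      then have "2 * (1 - ln t) \<le> (K / C)\<^sup>2 * (L_half t)\<^sup>2"
        unfolding L_half_sq[OF t] using ln_bound[of t] t by (intro mult_right_mono) auto
      also have "\<dots> = (K * L_half t / C)\<^sup>2" by (simp add: power_mult_distrib power_divide)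
      finally have "exp (2 * (1 - ln t)) \<le> exp ((K * L_half t / C)\<^sup>2)" by simp
      moreover have "exp (2 * (1 - ln t)) = (exp 1 / t)\<^sup>2"
        using t by (simp only: exp_double) (simp add: exp_diff)
      moreover have "4 / t \<le> (exp 1 / t)\<^sup>2"
      proof -
        have "2 \<le> exp (1::real)" using exp_ge_add_one_self[of 1] by simp
        then have "2\<^sup>2 \<le> (exp (1::real))\<^sup>2" by (rule power_mono) simp
        then have "4 \<le> (exp (1::real))\<^sup>2" by simp
        then have "4 * t \<le> (exp 1)\<^sup>2" using t by simp
        then show ?thesis using t by (simp add: power_divide field_simps power2_eq_square)
      qed
      moreover have "1 \<le> 1 / t" "4 / t = 4 * (1 / t)" using t by auto
      ultimately show ?thesis using a by linarith
    qed
    then have pt: "ennreal (1 / t) * indicator ?B u \<le> ennreal (N2 (\<bar>g u\<bar> / l))" for u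
    proof (cases "u \<in> ?B")
      case True
      then have "K * L_half t \<le> \<bar>g u\<bar> / l" using l by (simp add: field_simps)
      then have "N2 (K * L_half t) \<le> N2 (\<bar>g u\<bar> / l)" using K L1 by (intro orlicz_mono) auto
      then show ?thesis using True \<open>1 / t \<le> N2 (K * L_half t)\<close> by (simp add: ennreal_leI)
    qed simp
    have "ennreal (1 / t) * emeasure leb01 ?B = (\<integral>\<^sup>+u. ennreal (1 / t) * indicator ?B u \<partial>leb01)"
      using distr_set_sets[OF g] by (simp add: nn_integral_cmult_indicator)
    also have "\<dots> \<le> (\<integral>\<^sup>+u. ennreal (N2 (\<bar>g u\<bar> / l)) \<partial>leb01)" by (intro nn_integral_mono pt)
    also have "\<dots> \<le> ennreal 1" using le by simp
    finally have "1 / t * distr_fun g (K * l * L_half t) \<le> 1"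
      unfolding distr_fun_def leb01.emeasure_eq_measure using t by (simp flip: ennreal_mult ennreal_1)
    then show "distr_fun g (K * l * L_half t) \<le> t" using t by (simp add: field_simps)
  qed
  then show ?thesis using K by blast
qed

text \<open>\<open>N2\<close> is monotone on the half-line; extending it by its value at 0 makes it
  monotone on the whole line, hence Borel.\<close>

lemma orlicz_measurable:
  assumes [measurable]: "f \<in> borel_measurable leb01" and "l > 0"
  shows "(\<lambda>t. N2 (\<bar>f t\<bar> / l)) \<in> borel_measurable leb01"
proof -
  have "mono (\<lambda>x. N2 (max 0 x))" by (auto intro!: monoI orlicz_mono)
  then have [measurable]: "(\<lambda>x. N2 (max 0 x)) \<in> borel_measurable borel" by (rule borel_measurable_mono)
  have "(\<lambda>t. N2 (max 0 (\<bar>f t\<bar> / l))) \<in> borel_measurable leb01" by measurable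
  then show ?thesis using assms(2) by (simp add: max_absorb2)
qed

text \<open>The Luxemburg norm is an \<open>Inf\<close> of reals, and a small value is informative
  only if the set is nonempty. Convexity shows that the sum of admissible scales for f and for h is
  admissible for f - h, so a genuine scale below e exists.\<close>

lemma G_space_approx:
  assumes f: "f \<in> funs (G_space N2)" and e: "e > 0"
  shows "\<exists>h\<in>Linfty. \<exists>l. 0 < l \<and> l < e \<and> (\<integral>\<^sup>+t. ennreal (N2 (\<bar>f t - h t\<bar> / l)) \<partial>leb01) \<le> 1"
proof -
  obtain h where h: "h \<in> Linfty" "h \<in> funs (orlicz_space N2)" "fnorm (orlicz_space N2) (\<lambda>t. f t - h t) < e"
    using f e by (auto simp: G_space_def closure_in_def)
  have f': "f \<in> funs (orlicz_space N2)" using f by (simp add: G_space_def closure_in_def)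
  obtain l1 where l1: "l1 > 0" "(\<integral>\<^sup>+t. ennreal (N2 (\<bar>f t\<bar> / l1)) \<partial>leb01) \<le> 1" and fm: "f \<in> borel_measurable leb01"
    using f' by (auto simp: orlicz_space_def)
  obtain l2 where l2: "l2 > 0" "(\<integral>\<^sup>+t. ennreal (N2 (\<bar>h t\<bar> / l2)) \<partial>leb01) \<le> 1" and hm: "h \<in> borel_measurable leb01"
    using h(2) by (auto simp: orlicz_space_def)
  let ?L = "{l. l > 0 \<and> (\<integral>\<^sup>+t. ennreal (N2 (\<bar>f t - h t\<bar> / l)) \<partial>leb01) \<le> 1}"
  have "l1 + l2 \<in> ?L"
  proof -
    define u v where "u = l1 / (l1 + l2)" and "v = l2 / (l1 + l2)"
    have uv: "0 \<le> u" "0 \<le> v" "u + v = 1" using l1 l2 by (auto simp: u_def v_def simp flip: add_divide_distrib)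
    have pt: "N2 (\<bar>f t - h t\<bar> / (l1 + l2)) \<le> u * N2 (\<bar>f t\<bar> / l1) + v * N2 (\<bar>h t\<bar> / l2)" for t
    proof -
      have "\<bar>f t - h t\<bar> / (l1 + l2) \<le> (\<bar>f t\<bar> + \<bar>h t\<bar>) / (l1 + l2)" using l1 l2 by (intro divide_right_mono) auto
      also have "\<dots> = u * (\<bar>f t\<bar> / l1) + v * (\<bar>h t\<bar> / l2)"
        using l1 l2 by (simp add: u_def v_def add_divide_distrib)
      finally have "N2 (\<bar>f t - h t\<bar> / (l1 + l2)) \<le> N2 (u * (\<bar>f t\<bar> / l1) + v * (\<bar>h t\<bar> / l2))"
        using l1 l2 by (intro orlicz_mono) auto
      also have "\<dots> \<le> u * N2 (\<bar>f t\<bar> / l1) + v * N2 (\<bar>h t\<bar> / l2)"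
        using l1 l2 uv by (intro orlicz_convex) auto
      finally show ?thesis .
    qed
    have "(\<integral>\<^sup>+t. ennreal (N2 (\<bar>f t - h t\<bar> / (l1 + l2))) \<partial>leb01)
      \<le> (\<integral>\<^sup>+t. ennreal u * ennreal (N2 (\<bar>f t\<bar> / l1)) + ennreal v * ennreal (N2 (\<bar>h t\<bar> / l2)) \<partial>leb01)"
      using pt uv l1 l2 orlicz_nonneg
      by (intro nn_integral_mono) (simp add: ennreal_leI flip: ennreal_plus ennreal_mult)
    also have "\<dots> = ennreal u * (\<integral>\<^sup>+t. ennreal (N2 (\<bar>f t\<bar> / l1)) \<partial>leb01) + ennreal v * (\<integral>\<^sup>+t. ennreal (N2 (\<bar>h t\<bar> / l2)) \<partial>leb01)"
      using orlicz_measurable[OF fm l1(1)] orlicz_measurable[OF hm l2(1)]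
      by (simp add: nn_integral_add nn_integral_cmult)
    also have "\<dots> \<le> ennreal u * 1 + ennreal v * 1"
      using l1 l2 by (intro add_mono mult_left_mono) auto
    also have "\<dots> = 1" using uv by (simp flip: ennreal_plus)
    finally show ?thesis using l1 l2 by simp
  qed
  then have "?L \<noteq> {}" by blast
  moreover have "Inf ?L < e" using h(3) by (simp add: orlicz_space_def)
  ultimately have "\<exists>l\<in>?L. l < e" by (rule cInf_lessD)
  then show ?thesis using h(1) by blast
qed

text \<open>The tails of the square sum tend to 0, so by the subgaussian estimate the bounded
  partial sums approximate the series in the Luxemburg norm. This gives membership in the closure
  \<open>G_space\<close>, beyond membership in the Orlicz space.\<close>

lemma rad_series_G:
  assumes a: "a \<in> l2_seqs"
  shows "rad_series a \<in> funs (G_space N2)"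
proof -
  obtain K where K: "K > 0" and N2_le: "\<And>f s. s > 0 \<Longrightarrow> f \<in> borel_measurable leb01 \<Longrightarrow>
      (\<integral>\<^sup>+t. ennreal (exp ((f t)\<^sup>2 / s\<^sup>2)) \<partial>leb01) \<le> 2 \<Longrightarrow> (\<integral>\<^sup>+t. ennreal (N2 (\<bar>f t\<bar> / (K * s))) \<partial>leb01) \<le> 1"
    using orlicz_exp_sq by blast
  define s where "s = sqrt (2 * exp 1 * (l2_norm a)\<^sup>2 + 1)"
  have s: "s > 0" "s\<^sup>2 = 2 * exp 1 * (l2_norm a)\<^sup>2 + 1"
    unfolding s_def by (auto intro!: add_nonneg_pos)
  have V: "2 * exp 1 * (\<Sum>k=1..n. (a k)\<^sup>2) \<le> s\<^sup>2" for n
  proof -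
    have "(\<Sum>k=1..n. (a k)\<^sup>2) \<le> (l2_norm a)\<^sup>2"
      unfolding L2_set_sq[symmetric] by (intro power_mono L2_set_le_l2_norm[OF a]) simp
    then have "2 * exp 1 * (\<Sum>k=1..n. (a k)\<^sup>2) \<le> 2 * exp 1 * (l2_norm a)\<^sup>2"
      by (intro mult_left_mono) simp_all
    then show ?thesis unfolding s(2) by linarith
  qed
  have fin: "rad_sum a {1..n} \<in> funs (orlicz_space N2)" for n
    using N2_le[OF s(1) rad_sum_leb01 rad_sum_exp_sq[OF _ _ s(1) V]] K s(1)
    by (auto simp: orlicz_space_def intro!: exI[of _ "K * s"])
  have inf: "rad_series a \<in> funs (orlicz_space N2)"
  proof -
    have "{0<..n} = {1..n}" for n :: nat by auto
    then have "(\<integral>\<^sup>+t. ennreal (exp ((rad_series a t - rad_sum a {1..0} t)\<^sup>2 / s\<^sup>2)) \<partial>leb01) \<le> 2"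
      using V by (intro rad_series_exp_sq[OF a s(1)]) simp
    then have "(\<integral>\<^sup>+t. ennreal (exp ((rad_series a t)\<^sup>2 / s\<^sup>2)) \<partial>leb01) \<le> 2" by (simp add: rad_sum_def)
    from N2_le[OF s(1) rad_series_measurable this] show ?thesis
      using K s(1) by (auto simp: orlicz_space_def intro!: exI[of _ "K * s"])
  qed
  have "\<exists>g\<in>Linfty \<inter> funs (orlicz_space N2). fnorm (orlicz_space N2) (\<lambda>t. rad_series a t - g t) < e" if e: "e > 0" for e
  proof -
    define s where "s = e / (2 * K)"
    have s: "s > 0" using e K by (simp add: s_def)
    have "0 < s\<^sup>2 / (2 * exp 1)" using s by simp
    then obtain m where m: "\<And>n. (\<Sum>k\<in>{m<..n}. (a k)\<^sup>2) < s\<^sup>2 / (2 * exp 1)" using l2_tail[OF a] by blast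
    have "2 * exp 1 * (\<Sum>k\<in>{m<..n}. (a k)\<^sup>2) \<le> s\<^sup>2" for n using m[of n] by (simp add: field_simps)
    from rad_series_exp_sq[OF a s this]
    have "(\<integral>\<^sup>+t. ennreal (N2 (\<bar>rad_series a t - rad_sum a {1..m} t\<bar> / (K * s))) \<partial>leb01) \<le> 1"
      by (intro N2_le[OF s]) auto
    then have "fnorm (orlicz_space N2) (\<lambda>t. rad_series a t - rad_sum a {1..m} t) \<le> K * s"
      using K s unfolding orlicz_space_def fspace.simps by (intro cInf_lower) (auto simp: bdd_below_def intro: less_imp_le)
    also have "K * s < e" using K e by (simp add: s_def)
    finally have "fnorm (orlicz_space N2) (\<lambda>t. rad_series a t - rad_sum a {1..m} t) < e" .
    moreover have "rad_sum a {1..m} \<in> Linfty"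
      unfolding Linfty_def using abs_rad_sum_le[of a "{1..m}"] by (auto intro!: exI[of _ "\<Sum>k\<in>{1..m}. \<bar>a k\<bar>"])
    ultimately show ?thesis using fin[of m] by blast
  qed
  then show ?thesis using inf by (simp add: G_space_def closure_in_def)
qed

end

section \<open>Rademacher sums in weighted spaces\<close>

text \<open>With x = f v the n-th partial sum operator P_n on the weighted space becomes x -> v
  P_n(x / v) on the unweighted one, where duality is directly available.\<close>

definition projections_bdd :: "fspace \<Rightarrow> (real \<Rightarrow> real) \<Rightarrow> bool" where
  "projections_bdd Z v \<longleftrightarrow> (\<exists>C\<ge>0. \<forall>n. \<forall>x\<in>funs Z.
     fnorm Z (\<lambda>t. rad_sum (rad_coeff (\<lambda>t. x t / v t)) {1..n} t * v t) \<le> C * fnorm Z x)"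

definition rad_sums_bdd :: "fspace \<Rightarrow> (real \<Rightarrow> real) \<Rightarrow> bool" where
  "rad_sums_bdd Z v \<longleftrightarrow> (\<exists>C\<ge>0. \<forall>a n. fnorm Z (\<lambda>t. rad_sum a {1..n} t * v t) \<le> C * L2_set a {1..n})"

lemma rad_sum_diff: "rad_sum a F t - rad_sum b F t = rad_sum (\<lambda>k. a k - b k) F t"
  by (simp add: rad_sum_def left_diff_distrib sum_subtractf)

text \<open>Pairing with the constant 1 of \<open>Y\<close> maps \<open>Z\<close> continuously into
  L1, and Fatou's lemma then makes the L1 distance of the two limits vanish.\<close>

lemma (in dual_pair) limit_unique:
  assumes x: "\<And>n. x n \<in> funs Z" and h: "h \<in> funs Z" and lim: "(\<lambda>n. fnorm Z (\<lambda>t. x n t - h t)) \<longlonglongrightarrow> 0"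
    and g [measurable]: "g \<in> borel_measurable leb01" and ae: "AE t in leb01. (\<lambda>n. x n t) \<longlonglongrightarrow> g t"
  shows "AE t in leb01. g t = h t"
proof -
  note [measurable] = Z.meas[OF h] Z.meas[OF x]
  have "(\<integral>\<^sup>+t. ennreal \<bar>g t - h t\<bar> \<partial>leb01) \<le> ennreal e" if e: "e > 0" for e
  proof -
    have "(\<lambda>n. fnorm Z (\<lambda>t. x n t - h t) * fnorm Y (\<lambda>t. 1)) \<longlonglongrightarrow> 0"
      using tendsto_mult_right[OF lim, of "fnorm Y (\<lambda>t. 1)"] by (simp add: mult.commute)
    then have "eventually (\<lambda>n. fnorm Z (\<lambda>t. x n t - h t) * fnorm Y (\<lambda>t. 1) < e) sequentially"
      using e by (rule order_tendstoD)
    then obtain m where m: "\<And>n. n \<ge> m \<Longrightarrow> fnorm Z (\<lambda>t. x n t - h t) * fnorm Y (\<lambda>t. 1) < e"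
      by (auto simp: eventually_sequentially)
    show ?thesis
    proof (rule nn_integral_limit_le[where f = "\<lambda>n t. ennreal \<bar>x (n + m) t - h t\<bar>"])
      show "AE t in leb01. (\<lambda>n. ennreal \<bar>x (n + m) t - h t\<bar>) \<longlonglongrightarrow> ennreal \<bar>g t - h t\<bar>"
        using ae
      proof eventually_elim
        case (elim t)
        then show ?case
          by (intro tendsto_ennrealI tendsto_intros LIMSEQ_ignore_initial_segment)
      qed
      fix n
      have "(\<integral>\<^sup>+t. ennreal \<bar>(x (n + m) t - h t) * 1\<bar> \<partial>leb01) \<le> ennreal (fnorm Z (\<lambda>t. x (n + m) t - h t) * fnorm Y (\<lambda>t. 1))"
        by (intro Holder_nn Z.diff x h Y.one)
      also have "\<dots> \<le> ennreal e" using m[of "n + m"] by (intro ennreal_leI) simp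
      finally show "(\<integral>\<^sup>+t. ennreal \<bar>x (n + m) t - h t\<bar> \<partial>leb01) \<le> ennreal e" by simp
    qed measurable
  qed
  note small = this
  have "(\<integral>\<^sup>+t. ennreal \<bar>g t - h t\<bar> \<partial>leb01) \<le> 0"
    by (rule ennreal_le_epsilon) (use small in \<open>simp only: add_0\<close>)
  then have "(\<integral>\<^sup>+t. ennreal \<bar>g t - h t\<bar> \<partial>leb01) = 0" by simp
  then have "AE t in leb01. ennreal \<bar>g t - h t\<bar> = 0"
    by (subst (asm) nn_integral_0_iff_AE) measurable
  then show ?thesis by (auto elim!: eventually_mono)
qed

text \<open>The two memberships stand for the inclusions of the weighted space between
  \<open>Linfty\<close> and \<open>L1\<close>, in a form that is preserved when (Z, v) is exchanged
  with (Y, 1/v).\<close>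

locale weighted_pair = dual_pair +
  fixes v :: "real \<Rightarrow> real"
  assumes v_mem: "v \<in> funs Z" and inv_v_mem: "(\<lambda>t. 1 / v t) \<in> funs Y" and v_pos: "AE t in leb01. v t > 0"
begin

lemma flip_weighted: "weighted_pair Y Z (\<lambda>t. 1 / v t)"
proof -
  interpret F: dual_pair Y Z by (rule flip)
  show ?thesis
    by unfold_locales (use v_mem inv_v_mem v_pos in \<open>auto elim: eventually_mono\<close>)
qed

lemma v_meas [measurable]: "v \<in> borel_measurable leb01" by (rule Z.meas[OF v_mem])

lemma bounded_mult_mem:
  assumes [measurable]: "f \<in> borel_measurable leb01" and "\<And>t. \<bar>f t\<bar> \<le> B"
  shows "(\<lambda>t. f t * v t) \<in> funs Z"
proof (rule Z.ideal(1)[OF Z.scale[OF v_mem, of B]])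
  have "\<bar>f t * v t\<bar> \<le> \<bar>B * v t\<bar>" for t
    using assms(2)[of t] by (auto simp: abs_mult intro!: mult_right_mono)
  then show "AE t in leb01. \<bar>f t * v t\<bar> \<le> \<bar>B * v t\<bar>" by simp
qed measurable

lemma rad_sum_mem: "(\<lambda>t. rad_sum a F t * v t) \<in> funs Z"
  by (rule bounded_mult_mem[OF rad_sum_leb01 abs_rad_sum_le])

lemma rademacher_inv_mem: "(\<lambda>t. rademacher k t * (1 / v t)) \<in> funs Y"
  by (rule weighted_pair.bounded_mult_mem[OF flip_weighted rademacher_leb01 abs_rademacher_le_1])

lemma rad_coeff_eq: "rad_coeff (\<lambda>t. x t / v t) k = (LINT t|leb01. x t * (rademacher k t * (1 / v t)))"
  by (simp add: rad_coeff_def mult.commute)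

lemma abs_rad_coeff_le:
  assumes "x \<in> funs Z"
  shows "\<bar>rad_coeff (\<lambda>t. x t / v t) k\<bar> \<le> fnorm Z x * fnorm Y (\<lambda>t. rademacher k t * (1 / v t))"
  unfolding rad_coeff_eq by (rule Holder_abs[OF assms rademacher_inv_mem])

lemma LINT_rad_sum_coeff:
  assumes x: "x \<in> funs Z"
  shows "(LINT t|leb01. x t * (rad_sum b F t * (1 / v t))) = (\<Sum>k\<in>F. b k * rad_coeff (\<lambda>t. x t / v t) k)"
proof -
  have int: "integrable leb01 (\<lambda>t. b k * (x t * (rademacher k t * (1 / v t))))" for k
    by (intro integrable_mult_right integrable_mult[OF x rademacher_inv_mem])
  have "(LINT t|leb01. x t * (rad_sum b F t * (1 / v t)))
    = (LINT t|leb01. (\<Sum>k\<in>F. b k * (x t * (rademacher k t * (1 / v t)))))"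
    by (intro Bochner_Integration.integral_cong refl)
       (simp only: rad_sum_def sum_distrib_left sum_distrib_right mult_ac)
  also have "\<dots> = (\<Sum>k\<in>F. b k * rad_coeff (\<lambda>t. x t / v t) k)"
    unfolding rad_coeff_eq 
    by (subst Bochner_Integration.integral_sum[OF int]) (simp only: integral_mult_right_zero)
  finally show ?thesis .
qed

text \<open>Both pairings equal the sum of c_k(z / v) c_k(y v) over k \<le> n. So the projection for
  (Y, 1/v) is the adjoint of the one for (Z, v).\<close>

lemma projections_bdd_dual:
  assumes "projections_bdd Z v"
  shows "projections_bdd Y (\<lambda>t. 1 / v t)"
proof -
  interpret F: weighted_pair Y Z "\<lambda>t. 1 / v t" by (rule flip_weighted)
  obtain C where C: "C \<ge> 0" and P: "\<And>n x. x \<in> funs Z \<Longrightarrow>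
     fnorm Z (\<lambda>t. rad_sum (rad_coeff (\<lambda>t. x t / v t)) {1..n} t * v t) \<le> C * fnorm Z x"
    using assms by (auto simp: projections_bdd_def)
  have "fnorm Y (\<lambda>t. rad_sum (rad_coeff (\<lambda>t. y t / (1 / v t))) {1..n} t * (1 / v t)) \<le> C * fnorm Y y"
    if y: "y \<in> funs Y" for n y
  proof (rule norming_dual)
    show "(\<lambda>t. rad_sum (rad_coeff (\<lambda>t. y t / (1 / v t))) {1..n} t * (1 / v t)) \<in> funs Y" by (rule F.rad_sum_mem)
    fix z assume z: "z \<in> funs Z" "fnorm Z z \<le> 1"
    let ?c = "rad_coeff (\<lambda>t. z t / v t)" and ?d = "rad_coeff (\<lambda>t. y t / (1 / v t))"
    have "(LINT t|leb01. z t * (rad_sum ?d {1..n} t * (1 / v t))) = (\<Sum>k\<in>{1..n}. ?d k * ?c k)"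
      by (rule LINT_rad_sum_coeff[OF z(1)])
    also have "\<dots> = (\<Sum>k\<in>{1..n}. ?c k * ?d k)" by (simp add: mult.commute)
    also have "\<dots> = (LINT t|leb01. y t * (rad_sum ?c {1..n} t * (1 / (1 / v t))))"
      by (rule F.LINT_rad_sum_coeff[OF y, symmetric])
    finally have "\<bar>LINT t|leb01. z t * (rad_sum ?d {1..n} t * (1 / v t))\<bar>
        = \<bar>LINT t|leb01. (rad_sum ?c {1..n} t * v t) * y t\<bar>" by (simp add: mult.commute)
    also have "\<dots> \<le> fnorm Z (\<lambda>t. rad_sum ?c {1..n} t * v t) * fnorm Y y"
      by (rule Holder_abs[OF rad_sum_mem y])
    also have "\<dots> \<le> (C * fnorm Z z) * fnorm Y y" by (intro mult_right_mono P z Y.norm_nonneg y)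
    also have "\<dots> \<le> (C * 1) * fnorm Y y" using C z by (intro mult_right_mono mult_left_mono Y.norm_nonneg y)
    finally show "\<bar>LINT t|leb01. z t * (rad_sum ?d {1..n} t * (1 / v t))\<bar> \<le> C * fnorm Y y" by simp
  qed
  then show ?thesis using C unfolding projections_bdd_def by blast
qed

text \<open>Truncating a Rademacher sum \<open>R\<close> to \<open>f = R \<cdot> 1{\<bar>R\<bar> \<le> 12 \<parallel>a\<parallel>, v \<le> M}\<close> moves its coefficients by at most half
  of their norm, while \<open>f v\<close> is bounded; so \<open>R v = (P f) v + (error)\<close>, and the error is absorbed.\<close>

lemma rad_sums_bdd_of_projections:
  assumes "projections_bdd Z v"
  shows "rad_sums_bdd Z v"
proof -
  obtain C where C: "C \<ge> 0" and P: "\<And>n x. x \<in> funs Z \<Longrightarrow>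
     fnorm Z (\<lambda>t. rad_sum (rad_coeff (\<lambda>t. x t / v t)) {1..n} t * v t) \<le> C * fnorm Z x"
    using assms by (auto simp: projections_bdd_def)
  \<comment> \<open>M depends on v alone, so C0 is independent of n and of the coefficients. Points
    with v > M and |R| \<le> 12 A contribute at most 144 A^2 / 1152 = A^2 / 8 to the squared error,
    points with |R| > 12 A at most 18 A^4 / (144 A^2) = A^2 / 8; together (A / 2)^2.\<close>
  obtain M where M: "M \<ge> 0" "distr_fun v M \<le> 1 / 1152" using distr_fun_tendsto_0[OF v_meas, of "1 / 1152"] by auto
  define C0 where "C0 = C * (12 * M * fnorm Z (\<lambda>t. 1))"
  have C0: "C0 \<ge> 0" using C M Z.norm_nonneg[OF Z.one] by (simp add: C0_def)
  have improve: "fnorm Z (\<lambda>t. rad_sum a {1..n} t * v t) \<le> (C0 + K / 2) * L2_set a {1..n}"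
    if K: "K \<ge> 0" and le: "\<And>a. fnorm Z (\<lambda>t. rad_sum a {1..n} t * v t) \<le> K * L2_set a {1..n}" for K a n
  proof -
    define A where "A = L2_set a {1..n}"
    have A: "A \<ge> 0" by (simp add: A_def)
    define R where "R = rad_sum a {1..n}"
    define f where "f t = (if \<bar>v t\<bar> \<le> M \<and> \<bar>R t\<bar> \<le> 12 * A then R t else 0)" for t
    have [measurable]: "R \<in> borel_measurable leb01" by (simp add: R_def)
    have fm [measurable]: "f \<in> borel_measurable leb01" unfolding f_def[abs_def] by measurable
    have f_le: "\<bar>f t\<bar> \<le> 12 * A" for t using A by (simp add: f_def)
    have fv_le: "\<bar>f t * v t\<bar> \<le> 12 * A * M" for t
      using A M mult_mono[of "\<bar>R t\<bar>" "12 * A" "\<bar>v t\<bar>" M] by (auto simp: f_def abs_mult)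
    have x: "(\<lambda>t. f t * v t) \<in> funs Z" "fnorm Z (\<lambda>t. f t * v t) \<le> 12 * A * M * fnorm Z (\<lambda>t. 1)"
      using Z.bounded_mem[of "\<lambda>t. f t * v t" "12 * A * M"] fv_le A M by auto
    define e where "e k = (LINT t|leb01. (R t - f t) * rademacher k t)" for k
    have R_int: "integrable leb01 (\<lambda>t. R t * rademacher k t)" for k
      using integrable_rad_sum_power[of a "{1..n}" 1]
      by (intro integrable_mult_bounded[where B = 1]) (auto simp: abs_rademacher_le_1 R_def)
    have f_int: "integrable leb01 (\<lambda>t. f t * rademacher k t)" for k
      by (intro integrable_mult_bounded[where B = 1] integrable_leb01_bounded[OF fm f_le])
         (auto simp: abs_rademacher_le_1)
    have coeff: "rad_coeff (\<lambda>t. f t * v t / v t) k = a k - e k" if "k \<in> {1..n}" for k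
    proof -
      have "rad_coeff (\<lambda>t. f t * v t / v t) k = (LINT t|leb01. f t * rademacher k t)"
        unfolding rad_coeff_def using v_pos
        by (intro integral_cong_AE) (measurable, auto elim!: eventually_mono)
      also have "\<dots> = (LINT t|leb01. R t * rademacher k t) - e k"
        unfolding e_def left_diff_distrib using R_int f_int by simp
      also have "(LINT t|leb01. R t * rademacher k t) = a k"
        unfolding R_def using that by (subst LINT_rad_sum_rademacher) auto
      finally show ?thesis .
    qed
    have err: "L2_set e {1..n} \<le> A / 2"
    proof (cases "A = 0")
      case True
      then have "a k = 0" if "k \<in> {1..n}" for k using that by (simp add: A_def L2_set_eq_0_iff)
      then have R0: "R t = 0" for t by (simp add: R_def rad_sum_def)
      then have "f t = 0" for t by (simp add: f_def)
      with R0 have "e k = 0" for k by (simp add: e_def)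
      then show ?thesis using True by (simp add: L2_set_def)
    next
      case False
      then have Ap: "A > 0" using A by simp
      have VA: "(\<Sum>k\<in>{1..n}. (a k)\<^sup>2) = A\<^sup>2" by (simp only: A_def L2_set_sq)
      let ?B = "{t \<in> {0..1}. \<bar>v t\<bar> > M}"
      have B: "?B \<in> sets leb01" by (rule distr_set_sets[OF v_meas])
      have intB: "integrable leb01 (\<lambda>t. 144 * A\<^sup>2 * indicator ?B t)"
        by (intro integrable_leb01_bounded[where B = "144 * A\<^sup>2"]) (use B in \<open>auto split: split_indicator\<close>)
      have int4: "integrable leb01 (\<lambda>t. R t ^ 4 / (144 * A\<^sup>2))"
        unfolding R_def by (intro integrable_divide integrable_rad_sum_power)
      have int2: "integrable leb01 (\<lambda>t. (R t - f t)\<^sup>2)"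
      proof (rule integrable_leb01_bounded)
        show "\<bar>(R t - f t)\<^sup>2\<bar> \<le> (\<Sum>k\<in>{1..n}. \<bar>a k\<bar>)\<^sup>2" for t
          using power_mono[OF abs_rad_sum_le[of a "{1..n}" t], of 2] by (auto simp: R_def f_def sum_nonneg)
      qed measurable
      have "(L2_set e {1..n})\<^sup>2 = (\<Sum>k\<in>{1..n}. (LINT t|leb01. (R t - f t) * rademacher k t)\<^sup>2)"
        unfolding L2_set_sq e_def ..
      also have "\<dots> \<le> (LINT t|leb01. (R t - f t)\<^sup>2)"
        by (rule Bessel_leb01[OF _ _ _ _ _ int2])
           (auto simp: abs_rademacher_le_1 LINT_rademacher_mult)
      also have "\<dots> \<le> (LINT t|leb01. 144 * A\<^sup>2 * indicator ?B t + R t ^ 4 / (144 * A\<^sup>2))"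
      proof (rule integral_mono[OF int2 Bochner_Integration.integrable_add[OF intB int4]])
        fix t assume t: "t \<in> space leb01"
        define y where "y = (R t)\<^sup>2"
        have y4: "R t ^ 4 = y\<^sup>2" by (simp add: y_def)
        have y0: "0 \<le> y\<^sup>2 / (144 * A\<^sup>2)" by simp
        show "(R t - f t)\<^sup>2 \<le> 144 * A\<^sup>2 * indicator ?B t + R t ^ 4 / (144 * A\<^sup>2)"
        proof (cases "\<bar>R t\<bar> \<le> 12 * A")
          case True
          then have "y \<le> 144 * A\<^sup>2"
            using power_mono[OF True, of 2] by (simp add: y_def power_mult_distrib)
          then have "(R t - f t)\<^sup>2 \<le> 144 * A\<^sup>2 * indicator ?B t"
            using True t by (auto simp: f_def y_def not_le)
          then show ?thesis using y0 unfolding y4 by linarith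
        next
          case False
          then have "(12 * A)\<^sup>2 \<le> \<bar>R t\<bar>\<^sup>2" using A by (intro power_mono) auto
          then have "144 * A\<^sup>2 \<le> y" by (simp add: y_def power_mult_distrib)
          then have "144 * A\<^sup>2 * y \<le> y * y" by (intro mult_right_mono) (simp_all add: y_def)
          then have "y \<le> y\<^sup>2 / (144 * A\<^sup>2)" using Ap by (simp add: field_simps power2_eq_square)
          then show ?thesis using False unfolding y4 by (simp add: f_def y_def add_increasing)
        qed
      qed
      also have "\<dots> = 144 * A\<^sup>2 * distr_fun v M + (LINT t|leb01. R t ^ 4) / (144 * A\<^sup>2)"
        using B by (subst Bochner_Integration.integral_add[OF intB int4])
          (simp add: distr_fun_def sets_leb01_iff Int_absorb2)
      also have "\<dots> \<le> 144 * A\<^sup>2 * (1 / 1152) + 18 * (A\<^sup>2)\<^sup>2 / (144 * A\<^sup>2)"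
        using rad_sum_fourth_moment[of "{1..n}" a, unfolded VA] M(2)
        by (intro add_mono mult_left_mono divide_right_mono) (auto simp: R_def)
      also have "\<dots> = (A / 2)\<^sup>2" using Ap by (simp add: power2_eq_square field_simps)
      finally show ?thesis by (rule power2_le_imp_le) (use A in simp)
    qed
    have "(\<lambda>t. R t * v t) = (\<lambda>t. rad_sum (rad_coeff (\<lambda>t. f t * v t / v t)) {1..n} t * v t + rad_sum e {1..n} t * v t)"
    proof
      fix t
      have "rad_sum (rad_coeff (\<lambda>t. f t * v t / v t)) {1..n} t = rad_sum (\<lambda>k. a k - e k) {1..n} t"
        unfolding rad_sum_def by (rule sum.cong[OF refl]) (simp only: coeff)
      then show "R t * v t = rad_sum (rad_coeff (\<lambda>t. f t * v t / v t)) {1..n} t * v t + rad_sum e {1..n} t * v t"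
        by (simp add: R_def flip: rad_sum_diff) (simp add: algebra_simps)
    qed
    then have "fnorm Z (\<lambda>t. R t * v t)
        \<le> fnorm Z (\<lambda>t. rad_sum (rad_coeff (\<lambda>t. f t * v t / v t)) {1..n} t * v t) + fnorm Z (\<lambda>t. rad_sum e {1..n} t * v t)"
      using Z.triangle[OF rad_sum_mem rad_sum_mem] by simp
    also have "\<dots> \<le> C * (12 * A * M * fnorm Z (\<lambda>t. 1)) + K * (A / 2)"
      by (intro add_mono order_trans[OF P[OF x(1)]] order_trans[OF le] mult_left_mono x(2) err C K)
    also have "\<dots> = (C0 + K / 2) * A" by (simp add: C0_def algebra_simps)
    finally show ?thesis by (simp add: R_def A_def)
  qed
  have "fnorm Z (\<lambda>t. rad_sum a {1..n} t * v t) \<le> 2 * C0 * L2_set a {1..n}" for a n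
  proof -
    \<comment> \<open>A crude starting constant that depends on n. Each application of
      \<open>improve\<close> halves the excess over 2 C0, so K0 disappears in the limit of the
      iteration.\<close>
    define K0 where "K0 = (\<Sum>k\<in>{1..n}. fnorm Z (\<lambda>t. rademacher k t * v t))"
    have rv: "(\<lambda>t. rademacher k t * v t) \<in> funs Z" for k
      by (rule bounded_mult_mem[OF rademacher_leb01 abs_rademacher_le_1])
    have K0: "K0 \<ge> 0" unfolding K0_def by (intro sum_nonneg Z.norm_nonneg rv)
    have start: "fnorm Z (\<lambda>t. rad_sum a {1..n} t * v t) \<le> K0 * L2_set a {1..n}" for a
    proof -
      have "(\<lambda>t. rad_sum a {1..n} t * v t) = (\<lambda>t. \<Sum>k\<in>{1..n}. a k * (rademacher k t * v t))"
        by (simp add: rad_sum_def sum_distrib_right mult.assoc fun_eq_iff)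
      then have "fnorm Z (\<lambda>t. rad_sum a {1..n} t * v t) \<le> (\<Sum>k\<in>{1..n}. fnorm Z (\<lambda>t. a k * (rademacher k t * v t)))"
        using Z.sum[of "{1..n}" "\<lambda>k t. a k * (rademacher k t * v t)"] Z.scale[OF rv] by simp
      also have "\<dots> \<le> (\<Sum>k\<in>{1..n}. fnorm Z (\<lambda>t. rademacher k t * v t) * L2_set a {1..n})"
      proof (rule sum_mono)
        fix k assume k: "k \<in> {1..n}"
        have "\<bar>a k\<bar> \<le> L2_set (\<lambda>k. \<bar>a k\<bar>) {1..n}" using k by (intro member_le_L2_set) auto
        then have "\<bar>a k\<bar> \<le> L2_set a {1..n}" by (simp add: L2_set_def)
        then show "fnorm Z (\<lambda>t. a k * (rademacher k t * v t)) \<le> fnorm Z (\<lambda>t. rademacher k t * v t) * L2_set a {1..n}"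
          unfolding Z.norm_scale[OF rv] by (subst mult.commute) (intro mult_left_mono Z.norm_nonneg rv)
      qed
      finally show ?thesis by (simp add: K0_def sum_distrib_right)
    qed
    have iter: "\<forall>a. fnorm Z (\<lambda>t. rad_sum a {1..n} t * v t) \<le> (2 * C0 + K0 / 2 ^ i) * L2_set a {1..n}" for i
    proof (induction i)
      case 0
      have "K0 * L2_set a {1..n} \<le> (2 * C0 + K0) * L2_set a {1..n}" for a
        using C0 by (intro mult_right_mono) auto
      then show ?case using order_trans[OF start] by simp
    next
      case (Suc i)
      have eq: "2 * C0 + K0 / 2 ^ Suc i = C0 + (2 * C0 + K0 / 2 ^ i) / 2" by (simp add: field_simps)
      have "0 \<le> 2 * C0 + K0 / 2 ^ i" using C0 K0 by simp
      from improve[OF this] Suc show ?case unfolding eq by blast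
    qed
    have "(\<lambda>i. (2 * C0 + K0 / 2 ^ i) * L2_set a {1..n}) \<longlonglongrightarrow> (2 * C0 + 0) * L2_set a {1..n}"
      by (intro tendsto_intros LIMSEQ_divide_realpow_zero) simp
    from LIMSEQ_le_const[OF this] iter show ?thesis by auto
  qed
  then show ?thesis unfolding rad_sums_bdd_def using C0 by (intro exI[of _ "2 * C0"]) auto
qed

end

lemma L_half_measurable [measurable]: "L_half \<in> borel_measurable leb01"
  by (rule borel_measurable_leb01) measurable

context weighted_pair
begin

text \<open>One block, shifted far enough, has the required tails on D at all levels sqrt q with q
  in {16..Q} simultaneously. It yields a test function in \<open>Z\<close>, with a norm bound free
  of Q, whose rearrangement dominates log^(1/2)(e/t) up to a constant between t1 and a cutoff that
  decreases to 0 with Q. Pairing with \<open>rearr y\<close> and letting Q grow gives the estimate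
  near 0.\<close>

lemma L_half_rearr_le:
  assumes "rad_sums_bdd Z v"
  shows "\<exists>C\<ge>0. \<forall>y\<in>funs Y. (\<integral>\<^sup>+t. ennreal (L_half t * rearr y t) \<partial>leb01) \<le> ennreal (C * fnorm Y y)"
proof -
  obtain C where C: "C \<ge> 0" and R: "\<And>a n. fnorm Z (\<lambda>t. rad_sum a {1..n} t * v t) \<le> C * L2_set a {1..n}"
    using assms by (auto simp: rad_sums_bdd_def)
  have "\<not> (AE t in leb01. v t = 0)"
  proof
    assume "AE t in leb01. v t = 0"
    with v_pos have "AE t in leb01. False" by eventually_elim simp
    then show False using not_AE_leb01_False by blast
  qed
  then obtain \<delta> where \<delta>: "\<delta> > 0" "0 < distr_fun v \<delta>" using distr_fun_pos[OF v_meas] by blast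
  define D where "D = {t \<in> {0..1}. \<bar>v t\<bar> > \<delta>}"
  have D [measurable]: "D \<in> sets leb01" unfolding D_def by (rule distr_set_sets[OF v_meas])
  define \<mu> where "\<mu> = measure leb01 D"
  have \<mu>: "\<mu> > 0" "\<mu> \<le> 1" using \<delta>(2) measure_leb01_le_1[of D] by (auto simp: \<mu>_def D_def distr_fun_def)
  define c where "c = \<mu>\<^sup>2 / 64"
  have c: "c > 0" "c \<le> 1" using \<mu> power_le_one[of \<mu> 2] by (auto simp: c_def)
  \<comment> \<open>Made for the comparison at t = c exp(-3 y / 2): there the square of
    log^(1/2)(e/t) is 1 - ln c + 3 y / 2, at most (5/2 - ln c) y, and y \<le> 2 q for the integer q
    just below y.\<close>
  define \<kappa> where "\<kappa> = sqrt (2 * (5 / 2 - ln c))"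
  have lnc: "ln c \<le> 0" using c by simp
  have \<kappa>: "\<kappa> > 0" "\<kappa>\<^sup>2 = 2 * (5 / 2 - ln c)" using lnc by (auto simp: \<kappa>_def)
  \<comment> \<open>At t1 the parameter y is 17. For t \<le> t1 the integer just below y is
    therefore at least 16, and its root is at least 4, as the tail estimate demands.\<close>
  define t1 where "t1 = c * exp (- (3 / 2) * 17)"
  have t1: "0 < t1" "t1 \<le> 1" using c mult_le_one[of c "exp (- (3 / 2) * 17)"] by (auto simp: t1_def)
  have test: "\<exists>z\<in>funs Z. fnorm Z z \<le> C / \<delta> \<and>
      (\<forall>t. c * exp (- (3 / 2) * real Q) \<le> t \<and> t \<le> t1 \<longrightarrow> L_half t \<le> 8 * \<kappa> * rearr z t)" for Q :: nat
  proof -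
    define S where "S j = rad_sum (\<lambda>_. 1 / sqrt (real Q)) {1 + j..Q + j}" for j
    have "eventually (\<lambda>j. \<forall>q\<in>{16..Q}. measure leb01 {t \<in> D. sqrt (real q) / 8 \<le> S j t} \<ge> c * exp (- (3 / 2) * real q)) sequentially"
    proof (rule eventually_ball_finite[OF finite_atLeastAtMost], rule ballI)
      fix q assume q: "q \<in> {16..Q}"
      have "sqrt 16 \<le> sqrt (real q)" using q by (intro real_sqrt_le_mono) auto
      then have "4 \<le> sqrt (real q)" by simp
      from rad_sum_tail_on_set[OF D _ this, of Q] q \<mu>(1)
      show "eventually (\<lambda>j. measure leb01 {t \<in> D. sqrt (real q) / 8 \<le> S j t} \<ge> c * exp (- (3 / 2) * real q)) sequentially"
        by (simp add: c_def \<mu>_def S_def)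
    qed
    then obtain j where j: "\<And>q. q \<in> {16..Q} \<Longrightarrow> c * exp (- (3 / 2) * real q) \<le> measure leb01 {t \<in> D. sqrt (real q) / 8 \<le> S j t}"
      using eventually_happens'[OF sequentially_bot] by blast
    define a where "a k = (if j < k then 1 / sqrt (real Q) else 0)" for k
    have S_eq: "rad_sum a {1..Q + j} t = S j t" for t
      unfolding S_def rad_sum_def a_def by (rule sum.mono_neutral_cong_right) auto
    have a1: "L2_set a {1..Q + j} \<le> 1"
    proof -
      have "(\<Sum>k\<in>{1..Q + j}. (a k)\<^sup>2) = (\<Sum>k\<in>{1 + j..Q + j}. 1 / real Q)"
        unfolding a_def by (rule sum.mono_neutral_cong_right) (auto simp: power_divide)
      also have "\<dots> \<le> 1" by simp
      finally show ?thesis by (simp add: L2_set_def)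
    qed
    have Sm [measurable]: "S j \<in> borel_measurable leb01" by (simp add: S_def)
    \<comment> \<open>The weight is dropped here: v exceeds \<delta> on D, so |z| is at most |R v| /
      \<delta> for the full sum R, and the ideal property transfers the norm bound.\<close>
    define z where "z t = indicator D t * S j t" for t
    have zm [measurable]: "z \<in> borel_measurable leb01" unfolding z_def[abs_def] by measurable
    have "\<bar>z t\<bar> \<le> \<bar>1 / \<delta> * (rad_sum a {1..Q + j} t * v t)\<bar>" for t
    proof (cases "t \<in> D")
      case True
      then have "\<delta> \<le> \<bar>v t\<bar>" by (simp add: D_def)
      then have "\<bar>S j t\<bar> * \<delta> \<le> \<bar>S j t\<bar> * \<bar>v t\<bar>" by (intro mult_left_mono) auto
      then show ?thesis using True \<delta>(1) unfolding S_eq by (simp add: z_def abs_mult field_simps)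
    qed (simp add: z_def)
    then have ae: "AE t in leb01. \<bar>z t\<bar> \<le> \<bar>1 / \<delta> * (rad_sum a {1..Q + j} t * v t)\<bar>" by (intro AE_I2)
    have z: "z \<in> funs Z" "fnorm Z z \<le> fnorm Z (\<lambda>t. 1 / \<delta> * (rad_sum a {1..Q + j} t * v t))"
      by (rule Z.ideal[OF Z.scale[OF rad_sum_mem] zm ae])+
    note z(2)
    also have "fnorm Z (\<lambda>t. 1 / \<delta> * (rad_sum a {1..Q + j} t * v t)) \<le> 1 / \<delta> * (C * L2_set a {1..Q + j})"
      unfolding Z.norm_scale[OF rad_sum_mem] using \<delta>(1) by (intro mult_mono R) (auto intro: Z.norm_nonneg rad_sum_mem)
    also have "\<dots> \<le> C / \<delta>" using mult_left_mono[OF a1 C] \<delta>(1) by (simp add: divide_right_mono)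
    finally have zn: "fnorm Z z \<le> C / \<delta>" .
    have "L_half t \<le> 8 * \<kappa> * rearr z t" if t: "c * exp (- (3 / 2) * real Q) \<le> t" "t \<le> t1" for t
    proof -
      have tpos: "t > 0" using t(1) c by (smt (verit) exp_gt_zero mult_pos_pos)
      have tle1: "t \<le> 1" using t t1 by simp
      define y where "y = (ln c - ln t) / (3 / 2)"
      have "- (3 / 2) * y = ln t - ln c" by (simp add: y_def field_simps)
      then have ty: "t = c * exp (- (3 / 2) * y)" using c tpos by (simp only: exp_diff) simp
      have y17: "17 \<le> y"
        using t(2) c unfolding ty t1_def by (simp only: mult_le_cancel_left_pos exp_le_cancel_iff)
      have yQ: "y \<le> real Q"
        using t(1) c unfolding ty by (simp only: mult_le_cancel_left_pos exp_le_cancel_iff)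
      \<comment> \<open>The largest integer strictly below y. Strictness makes the tail set larger
        than t, which is what a lower bound for \<open>rearr z t\<close> requires.\<close>
      define q where "q = nat (\<lceil>y\<rceil> - 1)"
      have qr: "real q = of_int \<lceil>y\<rceil> - 1" using y17 by (simp add: q_def)
      have q: "real q < y" "y - 1 \<le> real q" unfolding qr by linarith+
      have qQ: "q \<in> {16..Q}" using q y17 yQ by auto
      have "t < c * exp (- (3 / 2) * real q)" using q c unfolding ty by simp
      also have "\<dots> \<le> measure leb01 {s \<in> D. sqrt (real q) / 8 \<le> S j s}" by (rule j[OF qQ])
      finally have lt: "t < measure leb01 {s \<in> D. sqrt (real q) / 8 \<le> S j s}" .
      have "sqrt (real q) / 8 \<le> rearr z t"
      proof (rule rearr_ge[OF zm tpos], rule ccontr)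
        fix \<tau> assume \<tau>: "0 \<le> \<tau>" "distr_fun z \<tau> \<le> t" "\<not> sqrt (real q) / 8 \<le> \<tau>"
        have "measure leb01 {s \<in> D. sqrt (real q) / 8 \<le> S j s} \<le> distr_fun z \<tau>"
          unfolding distr_fun_def
        proof (intro leb01.finite_measure_mono distr_set_sets zm subsetI)
          fix s assume "s \<in> {s \<in> D. sqrt (real q) / 8 \<le> S j s}"
          then show "s \<in> {t \<in> {0..1}. \<tau> < \<bar>z t\<bar>}" using \<tau> by (auto simp: z_def D_def)
        qed
        then show False using lt \<tau> by simp
      qed
      then have "8 * \<kappa> * (sqrt (real q) / 8) \<le> 8 * \<kappa> * rearr z t" using \<kappa> by (intro mult_left_mono) auto
      moreover have "L_half t \<le> \<kappa> * sqrt (real q)"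
      proof (rule power2_le_imp_le)
        have "(L_half t)\<^sup>2 = 1 - ln c + 3 / 2 * y" unfolding L_half_sq[OF tpos tle1] by (simp add: y_def field_simps)
        also have "\<dots> \<le> (1 - ln c) * y + 3 / 2 * y" using mult_left_mono[of 1 y "1 - ln c"] lnc y17 by simp
        also have "\<dots> = (5 / 2 - ln c) * y" by (simp add: algebra_simps)
        also have "\<dots> \<le> (5 / 2 - ln c) * (2 * real q)" using lnc q y17 by (intro mult_left_mono) auto
        also have "\<dots> = (\<kappa> * sqrt (real q))\<^sup>2" by (simp add: power_mult_distrib \<kappa>)
        finally show "(L_half t)\<^sup>2 \<le> (\<kappa> * sqrt (real q))\<^sup>2" .
      qed (use \<kappa> in simp)
      ultimately show ?thesis by simp
    qed
    then show ?thesis using z(1) zn by blast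
  qed
  have "(\<integral>\<^sup>+t. ennreal (L_half t * rearr y t) \<partial>leb01)
      \<le> ennreal ((8 * \<kappa> * (C / \<delta>) + L_half t1 * fnorm Z (\<lambda>t. 1)) * fnorm Y y)" if y: "y \<in> funs Y" for y
  proof -
    note ym [measurable] = rearr_measurable[OF Y.meas[OF y]]
    have y0: "0 \<le> rearr y t" if "t > 0" for t by (rule rearr_nonneg[OF Y.meas[OF y] that])
    have L0: "0 \<le> L_half t" if "0 < t" "t \<le> 1" for t using L_half_ge_1[OF that] by linarith
    have small: "(\<integral>\<^sup>+t. ennreal (L_half t * rearr y t) * indicator {0<..t1} t \<partial>leb01) \<le> ennreal (8 * \<kappa> * (C / \<delta>) * fnorm Y y)"
    proof (rule nn_integral_limit_le)
      let ?f = "\<lambda>Q t. ennreal (L_half t * rearr y t) * indicator {c * exp (- (3 / 2) * real Q)..t1} t"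
      have lim0: "(\<lambda>Q. c * exp (- (3 / 2) * real Q)) \<longlonglongrightarrow> 0" by real_asymp
      show "AE t in leb01. (\<lambda>Q. ?f Q t) \<longlonglongrightarrow> ennreal (L_half t * rearr y t) * indicator {0<..t1} t"
        using AE_leb01_pos
      proof eventually_elim
        case (elim t)
        have "eventually (\<lambda>Q. c * exp (- (3 / 2) * real Q) < t) sequentially"
          using lim0 elim by (intro order_tendstoD) auto
        then have "eventually (\<lambda>Q. ?f Q t = ennreal (L_half t * rearr y t) * indicator {0<..t1} t) sequentially"
          by eventually_elim (use elim in \<open>auto split: split_indicator\<close>)
        then show ?case by (rule tendsto_eventually)
      qed
      fix Q :: nat
      obtain z where z: "z \<in> funs Z" "fnorm Z z \<le> C / \<delta>"
        "\<And>t. c * exp (- (3 / 2) * real Q) \<le> t \<Longrightarrow> t \<le> t1 \<Longrightarrow> L_half t \<le> 8 * \<kappa> * rearr z t"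
        using test[of Q] by blast
      note [measurable] = rearr_measurable[OF Z.meas[OF z(1)]]
      have "(\<integral>\<^sup>+t. ?f Q t \<partial>leb01) \<le> (\<integral>\<^sup>+t. ennreal (8 * \<kappa>) * ennreal (rearr z t * rearr y t) \<partial>leb01)"
      proof (rule nn_integral_mono_AE)
        show "AE t in leb01. ?f Q t \<le> ennreal (8 * \<kappa>) * ennreal (rearr z t * rearr y t)"
          using AE_leb01_pos
        proof eventually_elim
          case (elim t)
          have "L_half t * rearr y t \<le> 8 * \<kappa> * (rearr z t * rearr y t)" if "c * exp (- (3 / 2) * real Q) \<le> t" "t \<le> t1"
            using mult_right_mono[OF z(3)[OF that] y0[of t]] elim by (simp only: mult.assoc)
          then show ?case using \<kappa>(1) by (auto simp: ennreal_leI ennreal_mult'[symmetric] split: split_indicator)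
        qed
      qed
      also have "\<dots> = ennreal (8 * \<kappa>) * (\<integral>\<^sup>+t. ennreal (rearr z t * rearr y t) \<partial>leb01)"
        by (rule nn_integral_cmult) measurable
      also have "\<dots> \<le> ennreal (8 * \<kappa>) * ennreal (fnorm Z z * fnorm Y y)"
        by (intro mult_left_mono Holder_rearr z y) simp
      also have "\<dots> \<le> ennreal (8 * \<kappa>) * ennreal (C / \<delta> * fnorm Y y)"
        by (intro mult_left_mono ennreal_leI mult_right_mono z Y.norm_nonneg y) simp
      also have "\<dots> = ennreal (8 * \<kappa> * (C / \<delta>) * fnorm Y y)"
        using \<kappa>(1) C \<delta>(1) Y.norm_nonneg[OF y] by (simp add: ennreal_mult'[symmetric] mult.assoc)
      finally show "(\<integral>\<^sup>+t. ?f Q t \<partial>leb01) \<le> ennreal (8 * \<kappa> * (C / \<delta>) * fnorm Y y)" .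
    next
      have [measurable]: "{0<..t1} \<in> sets leb01" using t1 by (intro sets_leb01_borel) auto
      have [measurable]: "{c * exp (- (3 / 2) * real Q)..t1} \<in> sets leb01" for Q :: nat
      proof (rule sets_leb01_borel)
        have "0 \<le> c * exp (- (3 / 2) * real Q)" using c by simp
        then show "{c * exp (- (3 / 2) * real Q)..t1} \<subseteq> {0..1}"
          unfolding atLeastatMost_subset_iff using t1 by blast
      qed simp
      show "(\<lambda>t. ennreal (L_half t * rearr y t) * indicator {c * exp (- (3 / 2) * real Q)..t1} t) \<in> borel_measurable leb01" for Q :: nat
        by measurable
      show "(\<lambda>t. ennreal (L_half t * rearr y t) * indicator {0<..t1} t) \<in> borel_measurable leb01" by measurable
    qed
    \<comment> \<open>Beyond t1 the logarithmic factor is at most its value at t1, so the remaining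
      part is a multiple of the pairing of \<open>rearr y\<close> with the constant 1.\<close>
    have "(\<integral>\<^sup>+t. ennreal (L_half t * rearr y t) \<partial>leb01)
      \<le> (\<integral>\<^sup>+t. ennreal (L_half t * rearr y t) * indicator {0<..t1} t + ennreal (L_half t1) * ennreal \<bar>1 * rearr y t\<bar> \<partial>leb01)"
    proof (rule nn_integral_mono_AE)
      show "AE t in leb01. ennreal (L_half t * rearr y t)
         \<le> ennreal (L_half t * rearr y t) * indicator {0<..t1} t + ennreal (L_half t1) * ennreal \<bar>1 * rearr y t\<bar>"
        using AE_leb01_pos
      proof eventually_elim
        case (elim t)
        show ?case
        proof (cases "t \<le> t1")
          case False
          then have "L_half t \<le> L_half t1" using elim t1 by (simp add: ln_div)
          then have "L_half t * rearr y t \<le> L_half t1 * \<bar>1 * rearr y t\<bar>"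
            using y0[of t] elim by (simp add: mult_right_mono)
          then show ?thesis using False L0[OF t1] by (simp add: ennreal_leI flip: ennreal_mult)
        qed (use elim in simp)
      qed
    qed
    also have "\<dots> = (\<integral>\<^sup>+t. ennreal (L_half t * rearr y t) * indicator {0<..t1} t \<partial>leb01)
        + ennreal (L_half t1) * (\<integral>\<^sup>+t. ennreal \<bar>1 * rearr y t\<bar> \<partial>leb01)"
    proof -
      have [measurable]: "{0<..t1} \<in> sets leb01" using t1 by (intro sets_leb01_borel) auto
      show ?thesis by (subst nn_integral_add) (measurable, simp add: nn_integral_cmult)
    qed
    also have "\<dots> \<le> ennreal (8 * \<kappa> * (C / \<delta>) * fnorm Y y) + ennreal (L_half t1) * ennreal (fnorm Z (\<lambda>t. 1) * fnorm Y (rearr y))"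
      by (intro add_mono small mult_left_mono Holder_nn Z.one Y.rearr_mem y) simp
    also have "\<dots> \<le> ennreal (8 * \<kappa> * (C / \<delta>) * fnorm Y y) + ennreal (L_half t1) * ennreal (fnorm Z (\<lambda>t. 1) * fnorm Y y)"
      by (intro add_left_mono mult_left_mono ennreal_leI Y.rearr_mem y Z.norm_nonneg Z.one) simp
    also have "\<dots> = ennreal ((8 * \<kappa> * (C / \<delta>) + L_half t1 * fnorm Z (\<lambda>t. 1)) * fnorm Y y)"
      using \<kappa>(1) C \<delta>(1) Y.norm_nonneg[OF y] Z.norm_nonneg[OF Z.one] L0[OF t1]
      by (simp add: distrib_right mult.assoc flip: ennreal_mult ennreal_plus)
    finally show ?thesis .
  qed
  moreover have "0 \<le> 8 * \<kappa> * (C / \<delta>) + L_half t1 * fnorm Z (\<lambda>t. 1)"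
  proof (rule add_nonneg_nonneg)
    show "0 \<le> 8 * \<kappa> * (C / \<delta>)"
      by (intro mult_nonneg_nonneg divide_nonneg_nonneg less_imp_le[OF \<kappa>(1)] less_imp_le[OF \<delta>(1)] C) simp
    have "0 \<le> L_half t1" using L_half_ge_1[OF t1] by linarith
    then show "0 \<le> L_half t1 * fnorm Z (\<lambda>t. 1)" by (intro mult_nonneg_nonneg Z.norm_nonneg Z.one)
  qed
  ultimately show ?thesis by blast
qed

text \<open>The hypothesis is the three-function Hardy--Littlewood majorant, since \<open>(\<Sum>a\<^sub>kr\<^sub>k)\<^sup>* \<le> C \<parallel>a\<parallel> L\<close>.\<close>

lemma rad_sums_bdd_of_L_half:
  assumes B: "B \<ge> 0" and le: "\<And>y. y \<in> funs Y \<Longrightarrow> fnorm Y y \<le> 1 \<Longrightarrow>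
    (\<integral>\<^sup>+t. ennreal (L_half t * rearr v t * rearr y t) \<partial>leb01) \<le> ennreal B"
  shows "rad_sums_bdd Z v"
proof -
  \<comment> \<open>With s = K A, where A is the l2 norm of the coefficients, the condition 2 e A^2
    \<le> s^2 of the subgaussian estimate holds with equality.\<close>
  define K where "K = sqrt (2 * exp 1)"
  have K: "K > 0" "K\<^sup>2 = 2 * exp 1" by (auto simp: K_def)
  have "fnorm Z (\<lambda>t. rad_sum a {1..n} t * v t) \<le> (K * B) * L2_set a {1..n}" for a n
  proof (rule norming[OF rad_sum_mem])
    fix y assume y: "y \<in> funs Y" "fnorm Y y \<le> 1"
    note ym [measurable] = Y.meas[OF y(1)]
    note [measurable] = rearr_measurable[OF ym] rearr_measurable[OF v_meas]
    let ?R = "rad_sum a {1..n}" and ?A = "L2_set a {1..n}"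
    show "\<bar>LINT t|leb01. ?R t * v t * y t\<bar> \<le> K * B * ?A"
    proof (cases "?A = 0")
      case True
      then have "a k = 0" if "k \<in> {1..n}" for k using that by (simp add: L2_set_eq_0_iff)
      then have "?R t = 0" for t by (simp add: rad_sum_def)
      then show ?thesis using True by simp
    next
      case False
      then have A: "?A > 0" by (metis L2_set_nonneg order_le_less)
      have s: "0 < K * ?A" "2 * exp 1 * (\<Sum>k\<in>{1..n}. (a k)\<^sup>2) \<le> (K * ?A)\<^sup>2"
        using A K(1) unfolding power_mult_distrib K(2) L2_set_sq by auto
      have rR: "rearr ?R t \<le> K * ?A * L_half t" if "0 < t" "t \<le> 1" for t
        by (rule rearr_le_of_exp_sq[OF rad_sum_leb01 s(1) rad_sum_exp_sq[OF _ _ s] that]) auto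
      have "(\<integral>\<^sup>+t. ennreal \<bar>?R t * v t * y t\<bar> \<partial>leb01) \<le> (\<integral>\<^sup>+t. ennreal (rearr ?R t * rearr v t * rearr y t) \<partial>leb01)"
        by (rule Hardy_Littlewood_3[OF rad_sum_leb01 v_meas ym])
      also have "\<dots> \<le> (\<integral>\<^sup>+t. ennreal (K * ?A) * ennreal (L_half t * rearr v t * rearr y t) \<partial>leb01)"
      proof (rule nn_integral_mono_AE)
        show "AE t in leb01. ennreal (rearr ?R t * rearr v t * rearr y t)
            \<le> ennreal (K * ?A) * ennreal (L_half t * rearr v t * rearr y t)"
          using AE_leb01_pos
        proof eventually_elim
          case (elim t)
          have "0 \<le> L_half t" using elim L_half_ge_1[of t] by linarith
          with elim have nn: "0 \<le> rearr v t" "0 \<le> rearr y t" "0 \<le> L_half t"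
            by (auto intro: rearr_nonneg v_meas ym)
          have "rearr ?R t * rearr v t * rearr y t \<le> (K * ?A * L_half t) * rearr v t * rearr y t"
            using elim nn by (intro mult_right_mono rR) auto
          then have "ennreal (rearr ?R t * rearr v t * rearr y t) \<le> ennreal (K * ?A * (L_half t * rearr v t * rearr y t))"
            by (intro ennreal_leI) (simp add: mult.assoc)
          also have "\<dots> = ennreal (K * ?A) * ennreal (L_half t * rearr v t * rearr y t)"
            using s(1) by (intro ennreal_mult') simp
          finally show ?case .
        qed
      qed
      also have "\<dots> = ennreal (K * ?A) * (\<integral>\<^sup>+t. ennreal (L_half t * rearr v t * rearr y t) \<partial>leb01)"
        by (rule nn_integral_cmult) measurable
      also have "\<dots> \<le> ennreal (K * ?A) * ennreal B" by (intro mult_left_mono le y) simp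
      also have "\<dots> = ennreal (K * B * ?A)" using s(1) B by (simp add: mult_ac flip: ennreal_mult)
      finally have "ennreal (LINT t|leb01. \<bar>?R t * v t * y t\<bar>) \<le> ennreal (K * B * ?A)"
        using nn_integral_eq_integral[of leb01 "\<lambda>t. \<bar>?R t * v t * y t\<bar>"] integrable_mult[OF rad_sum_mem y(1), of a "{1..n}"]
        by simp
      then have "(LINT t|leb01. \<bar>?R t * v t * y t\<bar>) \<le> K * B * ?A" using K B A by (simp add: ennreal_le_iff)
      then show ?thesis using integral_abs_bound[of leb01 "\<lambda>t. ?R t * v t * y t"] by linarith
    qed
  qed
  then show ?thesis unfolding rad_sums_bdd_def using K B by (intro exI[of _ "K * B"]) auto
qed

end

section \<open>The space of square-summable coefficients\<close>

lemma l2_lin: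
  assumes a: "a \<in> l2_seqs" and b: "b \<in> l2_seqs"
  shows "(\<lambda>k. a k + c * b k) \<in> l2_seqs" "l2_norm (\<lambda>k. a k + c * b k) \<le> l2_norm a + \<bar>c\<bar> * l2_norm b"
proof -
  have "L2_set (\<lambda>k. a k + c * b k) {1..n} \<le> l2_norm a + \<bar>c\<bar> * l2_norm b" for n
  proof -
    have "L2_set (\<lambda>k. c * b k) {1..n} = \<bar>c\<bar> * L2_set b {1..n}"
      by (simp add: L2_set_def power_mult_distrib real_sqrt_mult flip: sum_distrib_left)
    also have "\<dots> \<le> \<bar>c\<bar> * l2_norm b" by (intro mult_left_mono L2_set_le_l2_norm b) simp
    finally show ?thesis
      using L2_set_triangle_ineq[of a "\<lambda>k. c * b k" "{1..n}"] L2_set_le_l2_norm[OF a, of n] by linarith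
  qed
  then show "(\<lambda>k. a k + c * b k) \<in> l2_seqs" "l2_norm (\<lambda>k. a k + c * b k) \<le> l2_norm a + \<bar>c\<bar> * l2_norm b"
    by (rule l2_seqsI, rule l2_norm_le)
qed

lemma l2_zero: "(\<lambda>k. 0) \<in> l2_seqs" "l2_norm (\<lambda>k. 0) = 0"
proof -
  have le: "L2_set (\<lambda>k. 0) {1..n} \<le> 0" for n by (simp add: L2_set_def)
  show z: "(\<lambda>k. 0) \<in> l2_seqs" using le by (rule l2_seqsI)
  show "l2_norm (\<lambda>k. 0) = 0" using l2_norm_le[OF le] l2_norm_nonneg[OF z] by simp
qed

lemma abs_le_l2_norm:
  assumes "a \<in> l2_seqs" "1 \<le> k"
  shows "\<bar>a k\<bar> \<le> l2_norm a"
proof -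
  have "\<bar>a k\<bar> \<le> L2_set (\<lambda>k. \<bar>a k\<bar>) {1..k}" using assms by (intro member_le_L2_set) auto
  also have "\<dots> = L2_set a {1..k}" by (simp add: L2_set_def)
  finally show ?thesis using L2_set_le_l2_norm[OF assms(1), of k] by simp
qed

text \<open>The rate (1/3)^n is the one at which the gliding hump argument produces its sequences.
  The limit is taken coordinatewise, and the uniform bound on finite sections survives the passage
  to it.\<close>

lemma l2_complete:
  assumes s: "\<And>n. s n \<in> l2_seqs" and fast: "\<And>n. l2_norm (\<lambda>i. s (Suc n) i - s n i) \<le> (1 / 3) ^ n"
  shows "\<exists>l\<in>l2_seqs. (\<lambda>n. l2_norm (\<lambda>i. s n i - l i)) \<longlonglongrightarrow> 0"
proof -
  have diff: "(\<lambda>i. s m i - s n i) \<in> l2_seqs" for m n using l2_lin(1)[OF s s, of m "-1" n] by simp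
  have close: "l2_norm (\<lambda>i. s (n + k) i - s n i) \<le> 3 / 2 * (1 / 3) ^ n - 3 / 2 * (1 / 3) ^ (n + k)" for n k
  proof (induction k)
    case 0
    show ?case by (simp add: l2_zero)
  next
    case (Suc k)
    have "(\<lambda>i. s (n + Suc k) i - s n i) = (\<lambda>i. (s (Suc (n + k)) i - s (n + k) i) + 1 * (s (n + k) i - s n i))"
      by simp
    then have "l2_norm (\<lambda>i. s (n + Suc k) i - s n i)
        \<le> l2_norm (\<lambda>i. s (Suc (n + k)) i - s (n + k) i) + \<bar>1\<bar> * l2_norm (\<lambda>i. s (n + k) i - s n i)"
      using l2_lin(2)[OF diff diff, of "Suc (n + k)" "n + k" 1 "n + k" n] by (simp only:)
    then show ?case using fast[of "n + k"] Suc by simp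
  qed
  have close': "l2_norm (\<lambda>i. s m i - s n i) \<le> 3 / 2 * (1 / 3) ^ n" if "n \<le> m" for m n
  proof -
    have "0 \<le> (1 / 3 :: real) ^ m" by simp
    moreover have "l2_norm (\<lambda>i. s m i - s n i) \<le> 3 / 2 * (1 / 3) ^ n - 3 / 2 * (1 / 3) ^ m"
      using close[of n "m - n"] that by simp
    ultimately show ?thesis by linarith
  qed
  have small: "(\<lambda>n. 3 / 2 * (1 / 3 :: real) ^ n) \<longlonglongrightarrow> 0" by real_asymp
  have conv: "convergent (\<lambda>n. s n i)" if "1 \<le> i" for i
  proof (rule Cauchy_convergent, rule metric_CauchyI)
    fix e :: real assume "e > 0"
    then have "eventually (\<lambda>n. 3 / 2 * (1 / 3 :: real) ^ n < e / 2) sequentially"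
      using order_tendstoD(2)[OF small, of "e / 2"] by simp
    then obtain N where N: "3 / 2 * (1 / 3 :: real) ^ N < e / 2" by (auto simp: eventually_sequentially)
    have "\<bar>s m i - s N i\<bar> < e / 2" if "N \<le> m" for m
      using abs_le_l2_norm[OF diff \<open>1 \<le> i\<close>, of m N] close'[OF that] N by simp
    then show "\<exists>M. \<forall>m\<ge>M. \<forall>n\<ge>M. dist (s m i) (s n i) < e"
      by (intro exI[of _ N]) (smt (verit) dist_real_def field_sum_of_halves)
  qed
  \<comment> \<open>The coordinate at 0 is invisible to \<open>l2_norm\<close>, so convergence there
    is not controlled and the limit is simply set to 0.\<close>
  define l where "l i = (if 1 \<le> i then lim (\<lambda>n. s n i) else 0)" for i
  have lim: "(\<lambda>m. s m i) \<longlonglongrightarrow> l i" if "1 \<le> i" for i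
    using conv[OF that] that by (simp add: l_def convergent_LIMSEQ_iff)
  have bound: "L2_set (\<lambda>i. s n i - l i) {1..k} \<le> 3 / 2 * (1 / 3) ^ n" for n k
  proof (rule LIMSEQ_le_const2)
    show "(\<lambda>m. L2_set (\<lambda>i. s m i - s n i) {1..k}) \<longlonglongrightarrow> L2_set (\<lambda>i. s n i - l i) {1..k}"
    proof -
      have "(\<lambda>m. sqrt (\<Sum>i\<in>{1..k}. (s m i - s n i)\<^sup>2)) \<longlonglongrightarrow> sqrt (\<Sum>i\<in>{1..k}. (l i - s n i)\<^sup>2)"
        by (intro tendsto_intros lim) auto
      then show ?thesis by (simp add: L2_set_def power2_commute[of "l _"])
    qed
    show "\<exists>N. \<forall>m\<ge>N. L2_set (\<lambda>i. s m i - s n i) {1..k} \<le> 3 / 2 * (1 / 3) ^ n"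
      using order_trans[OF L2_set_le_l2_norm[OF diff] close'] by blast
  qed
  have d: "(\<lambda>i. s n i - l i) \<in> l2_seqs" for n using bound by (rule l2_seqsI)
  have "l = (\<lambda>i. s 0 i + (-1) * (s 0 i - l i))" by simp
  then have l: "l \<in> l2_seqs" using l2_lin(1)[OF s d, of 0 "-1" 0] by simp
  have "(\<lambda>n. l2_norm (\<lambda>i. s n i - l i)) \<longlonglongrightarrow> 0"
  proof (rule tendsto_sandwich[OF _ _ tendsto_const small])
    show "eventually (\<lambda>n. 0 \<le> l2_norm (\<lambda>i. s n i - l i)) sequentially"
      by (intro always_eventually allI l2_norm_nonneg d)
    show "eventually (\<lambda>n. l2_norm (\<lambda>i. s n i - l i) \<le> 3 / 2 * (1 / 3) ^ n) sequentially"
      by (intro always_eventually allI l2_norm_le bound)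
  qed
  then show ?thesis using l by blast
qed

text \<open>Integrating |x| \<le> B + x^2 / B takes the place of the Cauchy-Schwarz inequality. B
  stays strictly above the l2 norm to be positive and tends to it at the end.\<close>

lemma rad_series_L1:
  assumes a: "a \<in> l2_seqs"
  shows "integrable leb01 (rad_series a)" "(LINT t|leb01. \<bar>rad_series a t\<bar>) \<le> 2 * l2_norm a"
proof -
  have nn: "(\<integral>\<^sup>+t. ennreal \<bar>rad_series a t\<bar> \<partial>leb01) \<le> ennreal (2 * B)" if B: "B > l2_norm a" for B
  proof (rule nn_integral_limit_le)
    have Bp: "B > 0" using B l2_norm_nonneg[OF a] by simp
    show "AE t in leb01. (\<lambda>n. ennreal \<bar>rad_sum a {1..n} t\<bar>) \<longlonglongrightarrow> ennreal \<bar>rad_series a t\<bar>"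
      using AE_rad_series[OF a] by eventually_elim (intro tendsto_ennrealI tendsto_intros)
    fix n
    let ?S = "rad_sum a {1..n}"
    have int: "integrable leb01 (\<lambda>t. (?S t)\<^sup>2 / B)" by (intro integrable_divide integrable_rad_sum_power)
    have "\<bar>x\<bar> \<le> B + x\<^sup>2 / B" for x
    proof (cases "\<bar>x\<bar> \<le> B")
      case False
      then have "B * \<bar>x\<bar> \<le> \<bar>x\<bar> * \<bar>x\<bar>" by (intro mult_right_mono) auto
      then have "\<bar>x\<bar> \<le> x\<^sup>2 / B" using Bp by (simp add: field_simps power2_eq_square)
      then show ?thesis using Bp by simp
    qed (use Bp in \<open>simp add: add_increasing2\<close>)
    then have "(\<integral>\<^sup>+t. ennreal \<bar>?S t\<bar> \<partial>leb01) \<le> (\<integral>\<^sup>+t. ennreal (B + (?S t)\<^sup>2 / B) \<partial>leb01)"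
      by (intro nn_integral_mono ennreal_leI)
    also have "\<dots> = ennreal (LINT t|leb01. B + (?S t)\<^sup>2 / B)"
      using Bp int by (intro nn_integral_eq_integral) (auto intro!: AE_I2 add_nonneg_nonneg)
    also have "(LINT t|leb01. B + (?S t)\<^sup>2 / B) = B + (\<Sum>k\<in>{1..n}. (a k)\<^sup>2) / B"
    proof -
      have "integrable leb01 (\<lambda>t. B)" by simp
      from Bochner_Integration.integral_add[OF this int] show ?thesis
        by (simp add: LINT_rad_sum_sq)
    qed
    also have "\<dots> \<le> B + B\<^sup>2 / B"
    proof -
      have "(L2_set a {1..n})\<^sup>2 \<le> B\<^sup>2" using L2_set_le_l2_norm[OF a, of n] B by (intro power_mono) auto
      then show ?thesis using Bp unfolding L2_set_sq by (intro add_left_mono divide_right_mono) auto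
    qed
    also have "\<dots> = 2 * B" using Bp by (simp add: power2_eq_square)
    finally show "(\<integral>\<^sup>+t. ennreal \<bar>?S t\<bar> \<partial>leb01) \<le> ennreal (2 * B)" by (simp add: ennreal_leI)
  qed measurable
  show int: "integrable leb01 (rad_series a)"
    using le_less_trans[OF nn[of "l2_norm a + 1"] ennreal_less_top] by (intro integrable_of_nn_integral_abs) auto
  show "(LINT t|leb01. \<bar>rad_series a t\<bar>) \<le> 2 * l2_norm a"
  proof (rule field_le_epsilon)
    fix e :: real assume e: "e > 0"
    have "ennreal (LINT t|leb01. \<bar>rad_series a t\<bar>) \<le> ennreal (2 * (l2_norm a + e / 2))"
      using nn[of "l2_norm a + e / 2"] e int nn_integral_eq_integral[of leb01 "\<lambda>t. \<bar>rad_series a t\<bar>"] by simp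
    then have "(LINT t|leb01. \<bar>rad_series a t\<bar>) \<le> 2 * (l2_norm a + e / 2)"
      using e l2_norm_nonneg[OF a] by (subst (asm) ennreal_le_iff) auto
    then show "(LINT t|leb01. \<bar>rad_series a t\<bar>) \<le> 2 * l2_norm a + e" by simp
  qed
qed

lemma AE_rad_series_lin:
  assumes a: "a \<in> l2_seqs" and b: "b \<in> l2_seqs"
  shows "AE t in leb01. rad_series (\<lambda>k. a k + c * b k) t = rad_series a t + c * rad_series b t"
  using AE_rad_series[OF a] AE_rad_series[OF b] AE_rad_series[OF l2_lin(1)[OF a b, of c]]
proof eventually_elim
  case (elim t)
  have "rad_sum (\<lambda>k. a k + c * b k) {1..n} t = rad_sum a {1..n} t + c * rad_sum b {1..n} t" for n
    by (simp add: rad_sum_def distrib_right sum.distrib sum_distrib_left mult.assoc)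
  then have "(\<lambda>n. rad_sum (\<lambda>k. a k + c * b k) {1..n} t) \<longlonglongrightarrow> rad_series a t + c * rad_series b t"
    using tendsto_add[OF elim(1) tendsto_mult_left[OF elim(2), of c]] by simp
  with elim(3) show ?case by (rule LIMSEQ_unique)
qed

context weighted_pair
begin

text \<open>Uniform boundedness on \<open>\<ell>\<^sub>2\<close>, for the functionals \<open>a \<mapsto> \<integral> (\<Sum>a\<^sub>kr\<^sub>k) v y 1{\<bar>v y\<bar> \<le> K}\<close>.\<close>

lemma rad_sums_bdd_of_series_mem:
  assumes mem: "\<And>a. a \<in> l2_seqs \<Longrightarrow> (\<lambda>t. rad_series a t * v t) \<in> funs Z"
  shows "rad_sums_bdd Z v"
proof -
  \<comment> \<open>Truncation at level K makes each functional continuous in a by the L1 bound,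
    with a constant depending on K. Membership of the weighted series in \<open>Z\<close> gives, for
    each a, a bound uniform over y and K.\<close>
  define J where "J = {y \<in> funs Y. fnorm Y y \<le> 1} \<times> (UNIV :: nat set)"
  define h where "h j t = (if \<bar>v t * fst j t\<bar> \<le> real (snd j) then v t * fst j t else 0)"
    for j :: "(real \<Rightarrow> real) \<times> nat" and t
  define p where "p j a = \<bar>LINT t|leb01. rad_series a t * h j t\<bar>" for j a
  have h_meas [measurable]: "h j \<in> borel_measurable leb01" if "j \<in> J" for j
  proof -
    have [measurable]: "fst j \<in> borel_measurable leb01" using that Y.meas by (auto simp: J_def)
    show ?thesis unfolding h_def[abs_def] by measurable
  qed
  have h_le: "\<bar>h j t\<bar> \<le> real (snd j)" for j t by (simp add: h_def)
  have h_int: "integrable leb01 (\<lambda>t. rad_series a t * h j t)" if "j \<in> J" "a \<in> l2_seqs" for j a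
    by (rule integrable_mult_bounded[OF rad_series_L1(1)[OF that(2)] h_meas[OF that(1)] h_le])
  have lin: "(LINT t|leb01. rad_series (\<lambda>k. a k + c * b k) t * h j t)
      = (LINT t|leb01. rad_series a t * h j t) + c * (LINT t|leb01. rad_series b t * h j t)"
    if j: "j \<in> J" and a: "a \<in> l2_seqs" and b: "b \<in> l2_seqs" for j a b c
  proof -
    note [measurable] = h_meas[OF j]
    have "(LINT t|leb01. rad_series (\<lambda>k. a k + c * b k) t * h j t)
      = (LINT t|leb01. rad_series a t * h j t + c * (rad_series b t * h j t))"
      using AE_rad_series_lin[OF a b, of c]
      by (intro integral_cong_AE) (measurable, auto elim!: eventually_mono simp: algebra_simps)
    also have "\<dots> = (LINT t|leb01. rad_series a t * h j t) + c * (LINT t|leb01. rad_series b t * h j t)"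
      using Bochner_Integration.integral_add[OF h_int[OF j a] integrable_mult_right[OF h_int[OF j b]], of c] by simp
    finally show ?thesis .
  qed
  have "\<exists>C\<ge>0. \<forall>j\<in>J. \<forall>a\<in>l2_seqs. p j a \<le> C * l2_norm a"
  proof (rule uniform_boundedness)
    show "l2_seqs \<noteq> {}" using l2_zero(1) by blast
    show "(\<lambda>i. c * a i) \<in> l2_seqs" if "a \<in> l2_seqs" for a c
      using l2_lin(1)[OF l2_zero(1) that, of c] by simp
    show "l2_norm (\<lambda>i. c * a i) \<le> \<bar>c\<bar> * l2_norm a" if "a \<in> l2_seqs" for a c
      using l2_lin(2)[OF l2_zero(1) that, of c] by (simp add: l2_zero)
    show "p j (\<lambda>i. a i + c * b i) \<le> p j a + \<bar>c\<bar> * p j b" if "j \<in> J" "a \<in> l2_seqs" "b \<in> l2_seqs" for j a b c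
      unfolding p_def lin[OF that] abs_mult[symmetric] by (rule abs_triangle_ineq)
    show "p j (\<lambda>i. c * a i) \<le> \<bar>c\<bar> * p j a" if "j \<in> J" "a \<in> l2_seqs" for j a c
    proof -
      have "rad_series (\<lambda>k. 0) = (\<lambda>t. 0)" by (simp add: rad_series_def rad_sum_def fun_eq_iff)
      then show ?thesis using lin[OF that(1) l2_zero(1) that(2), of c] by (simp add: p_def abs_mult)
    qed
    show "\<exists>K. \<forall>a\<in>l2_seqs. p j a \<le> K * l2_norm a" if j: "j \<in> J" for j
    proof (intro exI ballI)
      fix a assume a: "a \<in> l2_seqs"
      have "p j a \<le> (LINT t|leb01. \<bar>rad_series a t * h j t\<bar>)" unfolding p_def by (rule integral_abs_bound)
      also have "\<dots> \<le> (LINT t|leb01. \<bar>rad_series a t\<bar> * real (snd j))"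
        by (intro integral_mono integrable_abs h_int[OF j a] integrable_mult_left rad_series_L1(1)[OF a])
          (auto simp: abs_mult intro!: mult_left_mono h_le)
      also have "\<dots> \<le> (2 * l2_norm a) * real (snd j)"
        using rad_series_L1(2)[OF a] by (simp add: mult_right_mono)
      finally show "p j a \<le> (2 * real (snd j)) * l2_norm a" by (simp add: mult_ac)
    qed
    show "\<exists>B. \<forall>j\<in>J. p j a \<le> B" if a: "a \<in> l2_seqs" for a
    proof (intro exI ballI)
      fix j assume j: "j \<in> J"
      then have y: "fst j \<in> funs Y" "fnorm Y (fst j) \<le> 1" by (auto simp: J_def)
      have "p j a \<le> (LINT t|leb01. \<bar>rad_series a t * h j t\<bar>)" unfolding p_def by (rule integral_abs_bound)
      also have "\<dots> \<le> (LINT t|leb01. \<bar>(rad_series a t * v t) * fst j t\<bar>)"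
        by (intro integral_mono integrable_abs h_int[OF j a] integrable_mult[OF mem[OF a] y(1)])
          (auto simp: abs_mult h_def)
      also have "\<dots> \<le> fnorm Z (\<lambda>t. rad_series a t * v t) * fnorm Y (fst j)"
        by (rule Holder[OF mem[OF a] y(1)])
      also have "\<dots> \<le> fnorm Z (\<lambda>t. rad_series a t * v t) * 1"
        by (intro mult_left_mono y Z.norm_nonneg mem a)
      finally show "p j a \<le> fnorm Z (\<lambda>t. rad_series a t * v t)" by simp
    qed
  qed (auto intro: l2_lin l2_norm_nonneg l2_complete)
  then obtain C where C: "C \<ge> 0" and bd: "\<And>j a. j \<in> J \<Longrightarrow> a \<in> l2_seqs \<Longrightarrow> p j a \<le> C * l2_norm a" by blast
  have "fnorm Z (\<lambda>t. rad_sum a {1..n} t * v t) \<le> C * L2_set a {1..n}" for a n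
  proof (rule norming[OF rad_sum_mem])
    fix y assume y: "y \<in> funs Y" "fnorm Y y \<le> 1"
    note ym [measurable] = Y.meas[OF y(1)]
    \<comment> \<open>Extension by zeros beyond n turns the finite sum into a series whose l2 norm
      is at most that of the section of a. The truncation at K is then removed by dominated
      convergence.\<close>
    define b where "b k = (if k \<le> n then a k else 0)" for k
    have bs: "rad_sum b {1..m} t = rad_sum a {1..n} t" if "n \<le> m" for m t
      unfolding rad_sum_def b_def using that by (intro sum.mono_neutral_cong_right) auto
    have bn: "L2_set b {1..m} \<le> L2_set a {1..n}" for m
    proof -
      have "(\<Sum>k\<in>{1..m}. (b k)\<^sup>2) = (\<Sum>k\<in>{1..m} \<inter> {1..n}. (a k)\<^sup>2)"
        unfolding b_def by (rule sum.mono_neutral_cong_right) auto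
      also have "\<dots> \<le> (\<Sum>k\<in>{1..n}. (a k)\<^sup>2)" by (intro sum_mono2) auto
      finally show ?thesis by (simp add: L2_set_def)
    qed
    have b: "b \<in> l2_seqs" "l2_norm b \<le> L2_set a {1..n}" using l2_seqsI[OF bn] l2_norm_le[OF bn] by auto
    have br: "rad_series b t = rad_sum a {1..n} t" for t
      unfolding rad_series_def
      by (rule limI, rule tendsto_eventually, unfold eventually_sequentially, intro exI[of _ n] allI impI bs)
    have lim: "(\<lambda>K. LINT t|leb01. rad_sum a {1..n} t * h (y, K) t) \<longlonglongrightarrow> (LINT t|leb01. rad_sum a {1..n} t * v t * y t)"
    proof (rule integral_dominated_convergence)
      show "integrable leb01 (\<lambda>t. \<bar>rad_sum a {1..n} t * v t * y t\<bar>)"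
        using integrable_mult[OF rad_sum_mem y(1), of a "{1..n}"] by simp
      show "AE t in leb01. norm (rad_sum a {1..n} t * h (y, K) t) \<le> \<bar>rad_sum a {1..n} t * v t * y t\<bar>" for K
        by (auto simp: h_def abs_mult)
      show "AE t in leb01. (\<lambda>K. rad_sum a {1..n} t * h (y, K) t) \<longlonglongrightarrow> rad_sum a {1..n} t * v t * y t"
      proof (rule AE_I2, rule tendsto_eventually)
        fix t
        obtain K0 :: nat where K0: "\<bar>v t * y t\<bar> \<le> real K0" using real_arch_simple by blast
        have "h (y, K) t = v t * y t" if "K0 \<le> K" for K
        proof -
          have "\<bar>v t * y t\<bar> \<le> real K" using K0 that by simp
          then show ?thesis by (simp add: h_def)
        qed
        then show "eventually (\<lambda>K. rad_sum a {1..n} t * h (y, K) t = rad_sum a {1..n} t * v t * y t) sequentially"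
          unfolding eventually_sequentially by (intro exI[of _ K0]) simp
      qed
      show "(\<lambda>t. rad_sum a {1..n} t * h (y, K) t) \<in> borel_measurable leb01" for K
        using h_meas[of "(y, K)"] y by (intro borel_measurable_times) (auto simp: J_def)
    qed measurable
    have "\<bar>LINT t|leb01. rad_sum a {1..n} t * h (y, K) t\<bar> \<le> C * L2_set a {1..n}" for K
    proof -
      have "\<bar>LINT t|leb01. rad_sum a {1..n} t * h (y, K) t\<bar> = p (y, K) b" by (simp add: p_def br)
      also have "\<dots> \<le> C * l2_norm b" using y b by (intro bd) (auto simp: J_def)
      also have "\<dots> \<le> C * L2_set a {1..n}" by (intro mult_left_mono b C)
      finally show ?thesis .
    qed
    with tendsto_rabs[OF lim] show "\<bar>LINT t|leb01. rad_sum a {1..n} t * v t * y t\<bar> \<le> C * L2_set a {1..n}"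
      by (intro LIMSEQ_le_const2) auto
  qed
  then show ?thesis unfolding rad_sums_bdd_def using C by blast
qed

lemma rad_sums_bdd_tail:
  assumes C: "C \<ge> 0" and R: "\<And>a n. fnorm Z (\<lambda>t. rad_sum a {1..n} t * v t) \<le> C * L2_set a {1..n}"
    and mn: "m \<le> n"
  shows "fnorm Z (\<lambda>t. rad_sum a {1..n} t * v t - rad_sum a {1..m} t * v t) \<le> C * sqrt (\<Sum>k\<in>{m<..n}. (a k)\<^sup>2)"
proof -
  define b where "b k = (if m < k then a k else 0)" for k
  have "rad_sum b {1..n} t = rad_sum a {1..n} t - rad_sum a {1..m} t" for t
  proof -
    have *: "{1..n} = {1..m} \<union> {m<..n}" using mn by auto
    show ?thesis unfolding rad_sum_def b_def * by (subst (1 2) sum.union_disjoint) auto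
  qed
  then have "(\<lambda>t. rad_sum a {1..n} t * v t - rad_sum a {1..m} t * v t) = (\<lambda>t. rad_sum b {1..n} t * v t)"
    by (simp add: left_diff_distrib)
  moreover have "L2_set b {1..n} = sqrt (\<Sum>k\<in>{m<..n}. (a k)\<^sup>2)"
    unfolding L2_set_def b_def by (rule arg_cong[where f = sqrt], rule sum.mono_neutral_cong_right) auto
  ultimately show ?thesis using R[of b n] by simp
qed

lemma rad_sums_cauchy:
  assumes "rad_sums_bdd Z v" and a: "a \<in> l2_seqs"
  shows "cauchy_in Z (\<lambda>n t. rad_sum a {1..n} t * v t)"
proof -
  obtain C where C: "C \<ge> 0" and R: "\<And>a n. fnorm Z (\<lambda>t. rad_sum a {1..n} t * v t) \<le> C * L2_set a {1..n}"
    using assms by (auto simp: rad_sums_bdd_def)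
  show ?thesis
    unfolding cauchy_in_def
  proof (intro conjI allI impI rad_sum_mem)
    fix e :: real assume e: "e > 0"
    then have "0 < (e / (C + 1))\<^sup>2" using C by simp
    then obtain N where N: "\<And>m n. N \<le> m \<Longrightarrow> (\<Sum>k\<in>{m<..n}. (a k)\<^sup>2) < (e / (C + 1))\<^sup>2"
      using l2_tail[OF a] by metis
    have le: "fnorm Z (\<lambda>t. rad_sum a {1..n} t * v t - rad_sum a {1..m} t * v t) < e" if "N \<le> m" "m \<le> n" for m n
    proof -
      have "sqrt (\<Sum>k\<in>{m<..n}. (a k)\<^sup>2) \<le> e / (C + 1)"
        using N[OF that(1), of n] e C by (intro real_le_lsqrt) (auto intro: less_imp_le)
      then have "C * sqrt (\<Sum>k\<in>{m<..n}. (a k)\<^sup>2) \<le> C * (e / (C + 1))" using C by (rule mult_left_mono)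
      also have "\<dots> < e" using e C by (simp add: field_simps)
      finally show ?thesis using rad_sums_bdd_tail[OF C R that(2), of a] by simp
    qed
    have "fnorm Z (\<lambda>t. rad_sum a {1..m} t * v t - rad_sum a {1..n} t * v t) < e" if "N \<le> m" "N \<le> n" for m n
    proof (cases "n \<le> m")
      case True
      then show ?thesis using le that by blast
    next
      case False
      have "fnorm Z (\<lambda>t. rad_sum a {1..m} t * v t - rad_sum a {1..n} t * v t)
        = fnorm Z (\<lambda>t. rad_sum a {1..n} t * v t - rad_sum a {1..m} t * v t)"
        using Z.norm_scale[OF Z.diff(1)[OF rad_sum_mem rad_sum_mem], of "-1" a "{1..n}" a "{1..m}"] by simp
      then show ?thesis using le[of m n] that False by simp
    qed
    then show "\<exists>N. \<forall>m\<ge>N. \<forall>n\<ge>N. fnorm Z (\<lambda>t. rad_sum a {1..m} t * v t - rad_sum a {1..n} t * v t) < e" by blast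
  qed
qed

end

section \<open>The projection\<close>

lemma sum_rademacher_eq: "(\<Sum>k=1..n. a k * rademacher k t) = rad_sum a {1..n} t"
  by (simp add: rad_sum_def)

text \<open>Membership in \<open>rademacher_sums\<close> is convergence a.e. with no condition on
  the coefficients; the small-ball estimate forces them to be square-summable.\<close>

lemma rademacher_sums_l2:
  assumes "g \<in> rademacher_sums"
  obtains a where "a \<in> l2_seqs" "AE t in leb01. (\<lambda>n. rad_sum a {1..n} t) \<longlonglongrightarrow> g t"
proof -
  obtain a where a: "AE t in leb01. (\<lambda>n. rad_sum a {1..n} t) \<longlonglongrightarrow> g t"
    using assms unfolding rademacher_sums_def sum_rademacher_eq by blast
  then have "AE t in leb01. convergent (\<lambda>n. rad_sum a {1..n} t)"
    by (rule eventually_mono) (auto simp: convergent_def)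
  from that[OF l2_of_AE_convergent[OF this] a] show ?thesis .
qed

lemma rad_series_rademacher_sums:
  assumes "a \<in> l2_seqs"
  shows "rad_series a \<in> rademacher_sums"
  unfolding rademacher_sums_def sum_rademacher_eq using AE_rad_series[OF assms] by auto

text \<open>As 1 is in \<open>Linfty\<close>, the first inclusion puts w into X. The second one says
  that x / w is integrable for every x in X, that is, 1/w belongs to the dual; since 1/w is nonzero,
  the dual is nontrivial.\<close>

lemma weighted_pair_kothe:
  assumes X: "symmetric_space X" and iso: "isometric_in_bidual X" and w: "w \<in> borel_measurable leb01"
    and pos: "AE t in leb01. w t > 0" and Li: "Linfty \<subseteq> funs (weighted X w)" and L1: "funs (weighted X w) \<subseteq> L1"
  shows "weighted_pair X (kothe_dual X) w"
proof -
  interpret X: sym_space X by (rule symmetric_space_sym[OF X])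
  have "(\<lambda>t. 1) \<in> Linfty" by (auto simp: Linfty_def intro!: exI[of _ 1])
  then have wX: "w \<in> funs X" using Li by (auto simp: weighted_def)
  have inv: "(\<lambda>t. 1 / w t) \<in> funs (kothe_dual X)"
    unfolding kothe_dual_mem
  proof (intro conjI ballI)
    show "(\<lambda>t. 1 / w t) \<in> borel_measurable leb01" using w by measurable
    fix x assume x: "x \<in> funs X"
    have xm: "x \<in> borel_measurable leb01" by (rule X.meas[OF x])
    have "(\<lambda>t. x t * (1 / w t) * w t) \<in> funs X"
      using xm w pos by (intro X.norm_cong_AE[OF x]) (measurable, auto elim!: eventually_mono)
    then have "(\<lambda>t. x t * (1 / w t)) \<in> funs (weighted X w)"
      using xm w by (auto simp: weighted_def)
    then show "integrable leb01 (\<lambda>t. x t * (1 / w t))" using L1 by (auto simp: L1_def)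
  qed
  have "\<not> (AE t in leb01. 1 / w t = 0)"
  proof
    assume "AE t in leb01. 1 / w t = 0"
    with pos have "AE t in leb01. False" by eventually_elim simp
    then show False using not_AE_leb01_False by blast
  qed
  then have "\<exists>y\<in>funs (kothe_dual X). \<not> (AE t in leb01. y t = 0)" using inv by (rule bexI)
  from dual_pair_kothe[OF X iso this] interpret dual_pair X "kothe_dual X" .
  show ?thesis by unfold_locales (fact wX inv pos)+
qed

context
  fixes X :: fspace and w :: "real \<Rightarrow> real"
  assumes X: "symmetric_space X" and wp: "weighted_pair X (kothe_dual X) w"
begin

interpretation weighted_pair X "kothe_dual X" w by (rule wp)
interpretation flipped: weighted_pair "kothe_dual X" X "\<lambda>t. 1 / w t" by (rule flip_weighted)

lemma weighted_mem: "f \<in> funs (weighted X w) \<longleftrightarrow> f \<in> borel_measurable leb01 \<and> (\<lambda>t. f t * w t) \<in> funs X"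
  by (simp add: weighted_def)

lemma weighted_norm: "fnorm (weighted X w) f = fnorm X (\<lambda>t. f t * w t)"
  by (simp add: weighted_def)

lemma AE_mult_div: "AE t in leb01. x t / w t * w t = x t"
  using v_pos by (auto elim: eventually_mono)

lemma div_mem:
  assumes "x \<in> funs X"
  shows "(\<lambda>t. x t / w t) \<in> funs (weighted X w)" "fnorm X (\<lambda>t. x t / w t * w t) = fnorm X x"
proof -
  have [measurable]: "x \<in> borel_measurable leb01" by (rule Z.meas[OF assms])
  have "(\<lambda>t. x t / w t * w t) \<in> borel_measurable leb01" "(\<lambda>t. x t / w t) \<in> borel_measurable leb01" by measurable
  with Z.norm_cong_AE[OF assms this(1) AE_mult_div] show "(\<lambda>t. x t / w t) \<in> funs (weighted X w)"
    "fnorm X (\<lambda>t. x t / w t * w t) = fnorm X x"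
    by (auto simp: weighted_mem)
qed

lemma rad_sum_weighted_mem: "rad_sum a F \<in> funs (weighted X w)"
  using rad_sum_mem by (simp add: weighted_mem)

lemma rad_coeff_div:
  assumes f: "f \<in> borel_measurable leb01"
  shows "rad_coeff (\<lambda>t. f t * w t / w t) = rad_coeff f"
proof
  fix k
  have [measurable]: "f \<in> borel_measurable leb01" by (rule f)
  show "rad_coeff (\<lambda>t. f t * w t / w t) k = rad_coeff f k"
    unfolding rad_coeff_def using v_pos
    by (intro integral_cong_AE) (measurable, auto elim!: eventually_mono)
qed

lemma is_rad_projection_iff:
  "is_rad_projection (weighted X w) f g \<longleftrightarrow> g \<in> funs (weighted X w) \<and>
     (\<lambda>n. fnorm X (\<lambda>t. rad_sum (rad_coeff f) {1..n} t * w t - g t * w t)) \<longlonglongrightarrow> 0"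
  unfolding is_rad_projection_def converges_in_def sum_rademacher_eq weighted_norm
  using rad_sum_weighted_mem[of "rad_coeff f"] by (simp add: left_diff_distrib)

text \<open>The dual estimate bounds the coefficients of f in the l2 norm, and the direct estimate
  turns square-summable coefficients into a norm-convergent series.\<close>

lemma rad_projection_bounded_of_sums:
  assumes A: "rad_sums_bdd X w" and B: "rad_sums_bdd (kothe_dual X) (\<lambda>t. 1 / w t)"
  shows "rad_projection_bounded (weighted X w)"
proof -
  obtain C where C: "C \<ge> 0" and R: "\<And>a n. fnorm X (\<lambda>t. rad_sum a {1..n} t * w t) \<le> C * L2_set a {1..n}"
    using A by (auto simp: rad_sums_bdd_def)
  obtain C' where C': "C' \<ge> 0"
    and R': "\<And>a n. fnorm (kothe_dual X) (\<lambda>t. rad_sum a {1..n} t * (1 / w t)) \<le> C' * L2_set a {1..n}"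
    using B by (auto simp: rad_sums_bdd_def)
  have coeff: "L2_set (rad_coeff f) {1..n} \<le> C' * fnorm X (\<lambda>t. f t * w t)" if f: "f \<in> funs (weighted X w)" for f n
  proof (cases "L2_set (rad_coeff f) {1..n} = 0")
    case False
    let ?c = "rad_coeff f" and ?N = "L2_set (rad_coeff f) {1..n}"
    have N: "?N > 0" using False by (metis L2_set_nonneg order_le_less)
    have fm: "f \<in> borel_measurable leb01" and fw: "(\<lambda>t. f t * w t) \<in> funs X" using f by (auto simp: weighted_mem)
    \<comment> \<open>f w is paired with the Rademacher sum of its own coefficients, divided by w.
      The pairing is the square of the coefficient norm, and one factor cancels.\<close>
    have "?N * ?N = (\<Sum>k\<in>{1..n}. ?c k * rad_coeff (\<lambda>t. f t * w t / w t) k)"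
      using L2_set_sq[of ?c "{1..n}"] unfolding rad_coeff_div[OF fm] by (simp only: power2_eq_square)
    also have "\<dots> = (LINT t|leb01. (f t * w t) * (rad_sum ?c {1..n} t * (1 / w t)))"
      by (rule LINT_rad_sum_coeff[OF fw, symmetric])
    also have "\<dots> \<le> fnorm X (\<lambda>t. f t * w t) * fnorm (kothe_dual X) (\<lambda>t. rad_sum ?c {1..n} t * (1 / w t))"
      using Holder_abs[OF fw flipped.rad_sum_mem, of ?c "{1..n}"] by (rule order_trans[OF abs_ge_self])
    also have "\<dots> \<le> fnorm X (\<lambda>t. f t * w t) * (C' * ?N)" by (intro mult_left_mono R' Z.norm_nonneg fw)
    finally have "?N * ?N \<le> (C' * fnorm X (\<lambda>t. f t * w t)) * ?N" by (simp only: mult_ac)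
    then show ?thesis using N by (simp only: mult_le_cancel_right_pos)
  next
    case True
    then show ?thesis using C' f Z.norm_nonneg by (simp add: weighted_mem)
  qed
  have ex: "\<exists>g. is_rad_projection (weighted X w) f g" if f: "f \<in> funs (weighted X w)" for f
  proof -
    have l2: "rad_coeff f \<in> l2_seqs" using coeff[OF f] by (rule l2_seqsI)
    obtain h where h: "h \<in> funs X" "(\<lambda>n. fnorm X (\<lambda>t. rad_sum (rad_coeff f) {1..n} t * w t - h t)) \<longlonglongrightarrow> 0"
      using symmetric_space_complete[OF X rad_sums_cauchy[OF A l2]] by blast
    have "fnorm X (\<lambda>t. rad_sum (rad_coeff f) {1..n} t * w t - h t / w t * w t)
        = fnorm X (\<lambda>t. rad_sum (rad_coeff f) {1..n} t * w t - h t)" for n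
    proof (rule Z.norm_cong_AE(2)[OF Z.diff(1)[OF rad_sum_mem h(1)]])
      have [measurable]: "h \<in> borel_measurable leb01" by (rule Z.meas[OF h(1)])
      show "(\<lambda>t. rad_sum (rad_coeff f) {1..n} t * w t - h t / w t * w t) \<in> borel_measurable leb01" by measurable
      show "AE t in leb01. rad_sum (rad_coeff f) {1..n} t * w t - h t / w t * w t = rad_sum (rad_coeff f) {1..n} t * w t - h t"
        using AE_mult_div[of h] by eventually_elim simp
    qed
    then have "is_rad_projection (weighted X w) f (\<lambda>t. h t / w t)"
      unfolding is_rad_projection_iff using h div_mem(1)[OF h(1)] by simp
    then show ?thesis by blast
  qed
  moreover have "fnorm (weighted X w) g \<le> (C * C') * fnorm (weighted X w) f"
    if f: "f \<in> funs (weighted X w)" and g: "is_rad_projection (weighted X w) f g" for f g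
  proof -
    let ?s = "\<lambda>n t. rad_sum (rad_coeff f) {1..n} t * w t"
    have gw: "(\<lambda>t. g t * w t) \<in> funs X" and lim: "(\<lambda>n. fnorm X (\<lambda>t. ?s n t - g t * w t)) \<longlonglongrightarrow> 0"
      using g by (auto simp: is_rad_projection_iff weighted_mem)
    have "fnorm X (\<lambda>t. g t * w t) \<le> C * (C' * fnorm X (\<lambda>t. f t * w t)) + fnorm X (\<lambda>t. ?s n t - g t * w t)" for n
    proof -
      have "fnorm X (\<lambda>t. g t * w t) = fnorm X (\<lambda>t. ?s n t - (?s n t - g t * w t))" by simp
      also have "\<dots> \<le> fnorm X (?s n) + fnorm X (\<lambda>t. ?s n t - g t * w t)"
        by (rule Z.diff(2)[OF rad_sum_mem Z.diff(1)[OF rad_sum_mem gw]])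
      also have "fnorm X (?s n) \<le> C * (C' * fnorm X (\<lambda>t. f t * w t))"
        by (rule order_trans[OF R mult_left_mono[OF coeff[OF f] C]])
      finally show ?thesis by simp
    qed
    moreover have "(\<lambda>n. C * (C' * fnorm X (\<lambda>t. f t * w t)) + fnorm X (\<lambda>t. ?s n t - g t * w t))
        \<longlonglongrightarrow> C * (C' * fnorm X (\<lambda>t. f t * w t)) + 0"
      by (intro tendsto_add tendsto_const lim)
    ultimately have "fnorm X (\<lambda>t. g t * w t) \<le> C * (C' * fnorm X (\<lambda>t. f t * w t)) + 0"
      by (intro LIMSEQ_le_const) auto
    then show ?thesis by (simp add: weighted_norm mult.assoc)
  qed
  ultimately show ?thesis unfolding rad_projection_bounded_def by blast
qed

text \<open>Each partial sum operator is bounded, as a finite combination of coefficient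
  functionals. Convergence of the series makes these operators pointwise bounded, and completeness
  of X turns this into a bound uniform in n.\<close>

lemma projections_bdd_of_bounded:
  assumes P: "rad_projection_bounded (weighted X w)"
  shows "projections_bdd X w"
proof -
  define p where "p n x = fnorm X (\<lambda>t. rad_sum (rad_coeff (\<lambda>t. x t / w t)) {1..n} t * w t)" for n :: nat and x
  have lin: "rad_coeff (\<lambda>t. (x t + c * y t) / w t) k = rad_coeff (\<lambda>t. x t / w t) k + c * rad_coeff (\<lambda>t. y t / w t) k"
    if x: "x \<in> funs X" and y: "y \<in> funs X" for x y c k
  proof -
    let ?r = "\<lambda>t. rademacher k t * (1 / w t)"
    have "(LINT t|leb01. (x t + c * y t) * ?r t) = (LINT t|leb01. x t * ?r t + c * (y t * ?r t))"
      by (simp only: distrib_right mult.assoc)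
    also have "\<dots> = (LINT t|leb01. x t * ?r t) + c * (LINT t|leb01. y t * ?r t)"
      using Bochner_Integration.integral_add[OF integrable_mult[OF x rademacher_inv_mem]
          integrable_mult_right[OF integrable_mult[OF y rademacher_inv_mem]], of k c k]
      by (simp only: integral_mult_right_zero)
    finally show ?thesis by (simp only: rad_coeff_eq)
  qed
  have rad_lin: "rad_sum (\<lambda>k. a k + c * b k) {1..n} t * w t = rad_sum a {1..n} t * w t + c * (rad_sum b {1..n} t * w t)"
    for a b c n t
    by (simp add: rad_sum_def distrib_right sum.distrib sum_distrib_left sum_distrib_right mult.assoc)
  have "\<exists>C\<ge>0. \<forall>n\<in>UNIV. \<forall>x\<in>funs X. p n x \<le> C * fnorm X x"
  proof (rule uniform_boundedness)
    show "funs X \<noteq> {}" using Z.zero(1) by blast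
    show "(\<lambda>t. x t + c * y t) \<in> funs X" if "x \<in> funs X" "y \<in> funs X" for x y c
      by (intro Z.add Z.scale that)
    show "fnorm X (\<lambda>t. x t + c * y t) \<le> fnorm X x + \<bar>c\<bar> * fnorm X y" if "x \<in> funs X" "y \<in> funs X" for x y c
      using Z.triangle[OF that(1) Z.scale[OF that(2)], of c] Z.norm_scale[OF that(2), of c] by simp
    show "p n (\<lambda>t. x t + c * y t) \<le> p n x + \<bar>c\<bar> * p n y" if "x \<in> funs X" "y \<in> funs X" for n x y c
      unfolding p_def ext[OF lin[OF that]] rad_lin
      by (rule order_trans[OF Z.triangle[OF rad_sum_mem Z.scale[OF rad_sum_mem]]])
         (simp only: Z.norm_scale[OF rad_sum_mem] order_refl)
    show "p n (\<lambda>t. c * x t) \<le> \<bar>c\<bar> * p n x" if "x \<in> funs X" for n x c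
    proof -
      have "rad_coeff (\<lambda>t. c * x t / w t) = (\<lambda>k. c * rad_coeff (\<lambda>t. x t / w t) k)"
        by (simp add: rad_coeff_def fun_eq_iff mult.assoc flip: times_divide_eq_right)
      then have "(\<lambda>t. rad_sum (rad_coeff (\<lambda>t. c * x t / w t)) {1..n} t * w t)
          = (\<lambda>t. c * (rad_sum (rad_coeff (\<lambda>t. x t / w t)) {1..n} t * w t))"
        by (simp add: rad_sum_def sum_distrib_left sum_distrib_right mult.assoc)
      then show ?thesis unfolding p_def by (simp only: Z.norm_scale[OF rad_sum_mem])
    qed
    show "\<exists>K. \<forall>x\<in>funs X. p n x \<le> K * fnorm X x" for n
    proof (intro exI ballI)
      fix x assume x: "x \<in> funs X"
      let ?c = "rad_coeff (\<lambda>t. x t / w t)"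
      have rv: "(\<lambda>t. rademacher k t * w t) \<in> funs X" for k
        by (rule bounded_mult_mem[OF rademacher_leb01 abs_rademacher_le_1])
      have "(\<lambda>t. rad_sum ?c {1..n} t * w t) = (\<lambda>t. \<Sum>k\<in>{1..n}. ?c k * (rademacher k t * w t))"
        by (simp add: rad_sum_def sum_distrib_right mult.assoc fun_eq_iff)
      then have "p n x \<le> (\<Sum>k\<in>{1..n}. fnorm X (\<lambda>t. ?c k * (rademacher k t * w t)))"
        unfolding p_def using Z.sum[of "{1..n}" "\<lambda>k t. ?c k * (rademacher k t * w t)"] Z.scale[OF rv] by simp
      also have "\<dots> \<le> (\<Sum>k\<in>{1..n}. (fnorm (kothe_dual X) (\<lambda>t. rademacher k t * (1 / w t)) * fnorm X (\<lambda>t. rademacher k t * w t)) * fnorm X x)"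
      proof (rule sum_mono)
        fix k
        have "\<bar>?c k\<bar> * fnorm X (\<lambda>t. rademacher k t * w t)
          \<le> (fnorm X x * fnorm (kothe_dual X) (\<lambda>t. rademacher k t * (1 / w t))) * fnorm X (\<lambda>t. rademacher k t * w t)"
          by (intro mult_right_mono abs_rad_coeff_le x Z.norm_nonneg rv)
        then show "fnorm X (\<lambda>t. ?c k * (rademacher k t * w t))
          \<le> (fnorm (kothe_dual X) (\<lambda>t. rademacher k t * (1 / w t)) * fnorm X (\<lambda>t. rademacher k t * w t)) * fnorm X x"
          unfolding Z.norm_scale[OF rv] by (simp only: mult_ac)
      qed
      finally show "p n x \<le> (\<Sum>k\<in>{1..n}. fnorm (kothe_dual X) (\<lambda>t. rademacher k t * (1 / w t)) * fnorm X (\<lambda>t. rademacher k t * w t)) * fnorm X x"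
        by (simp only: sum_distrib_right)
    qed
    show "\<exists>B. \<forall>n\<in>UNIV. p n x \<le> B" if x: "x \<in> funs X" for x
    proof -
      let ?s = "\<lambda>n t. rad_sum (rad_coeff (\<lambda>t. x t / w t)) {1..n} t * w t"
      obtain g where "is_rad_projection (weighted X w) (\<lambda>t. x t / w t) g"
        using P div_mem(1)[OF x] unfolding rad_projection_bounded_def by blast
      then have g: "(\<lambda>t. g t * w t) \<in> funs X" "(\<lambda>n. fnorm X (\<lambda>t. ?s n t - g t * w t)) \<longlonglongrightarrow> 0"
        by (simp_all only: is_rad_projection_iff weighted_mem)
      obtain B where B: "\<And>n. \<bar>fnorm X (\<lambda>t. ?s n t - g t * w t)\<bar> \<le> B"
        using convergent_imp_Bseq[OF convergentI[OF g(2)]] by (auto simp: Bseq_def)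
      have "p n x \<le> B + fnorm X (\<lambda>t. g t * w t)" for n
      proof -
        have "p n x = fnorm X (\<lambda>t. (?s n t - g t * w t) + g t * w t)" by (simp add: p_def)
        also have "\<dots> \<le> fnorm X (\<lambda>t. ?s n t - g t * w t) + fnorm X (\<lambda>t. g t * w t)"
          by (rule Z.triangle[OF Z.diff(1)[OF rad_sum_mem g(1)] g(1)])
        finally show ?thesis using B[of n] by linarith
      qed
      then show ?thesis by blast
    qed
    show "\<exists>l\<in>funs X. (\<lambda>n. fnorm X (\<lambda>i. s n i - l i)) \<longlonglongrightarrow> 0"
      if s: "\<And>n. s n \<in> funs X" and fast: "\<And>n. fnorm X (\<lambda>i. s (Suc n) i - s n i) \<le> (1 / 3) ^ n" for s
    proof -
      have close: "fnorm X (\<lambda>i. s (n + k) i - s n i) \<le> 3 / 2 * (1 / 3) ^ n - 3 / 2 * (1 / 3) ^ (n + k)" for n k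
      proof (induction k)
        case (Suc k)
        have "(\<lambda>i. s (n + Suc k) i - s n i) = (\<lambda>i. (s (Suc (n + k)) i - s (n + k) i) + (s (n + k) i - s n i))"
          by simp
        then have "fnorm X (\<lambda>i. s (n + Suc k) i - s n i)
            \<le> fnorm X (\<lambda>i. s (Suc (n + k)) i - s (n + k) i) + fnorm X (\<lambda>i. s (n + k) i - s n i)"
          using Z.triangle[OF Z.diff(1)[OF s s] Z.diff(1)[OF s s], of "Suc (n + k)" "n + k" "n + k" n] by (simp only:)
        then show ?case using fast[of "n + k"] Suc by simp
      qed (simp add: Z.zero)
      have close': "fnorm X (\<lambda>i. s m i - s n i) \<le> 3 / 2 * (1 / 3) ^ n" if "n \<le> m" for m n
      proof -
        have "0 \<le> (1 / 3 :: real) ^ m" by simp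
        moreover have "fnorm X (\<lambda>i. s m i - s n i) \<le> 3 / 2 * (1 / 3) ^ n - 3 / 2 * (1 / 3) ^ m"
          using close[of n "m - n"] that by simp
        ultimately show ?thesis by linarith
      qed
      have "cauchy_in X s"
        unfolding cauchy_in_def
      proof (intro conjI allI impI s)
        fix e :: real assume e: "e > 0"
        have "(\<lambda>n. 3 / 2 * (1 / 3 :: real) ^ n) \<longlonglongrightarrow> 0" by real_asymp
        then have "eventually (\<lambda>n. 3 / 2 * (1 / 3 :: real) ^ n < e / 2) sequentially"
          by (rule order_tendstoD(2)) (use e in simp)
        then obtain N where N: "3 / 2 * (1 / 3 :: real) ^ N < e / 2" by (auto simp: eventually_sequentially)
        have "fnorm X (\<lambda>t. s m t - s n t) < e" if "N \<le> m" "N \<le> n" for m n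
        proof -
          have "fnorm X (\<lambda>t. s m t - s n t) = fnorm X (\<lambda>t. (s m t - s N t) - (s n t - s N t))" by simp
          also have "\<dots> \<le> fnorm X (\<lambda>t. s m t - s N t) + fnorm X (\<lambda>t. s n t - s N t)"
            by (rule Z.diff(2)[OF Z.diff(1)[OF s s] Z.diff(1)[OF s s]])
          finally show ?thesis using close'[OF that(1)] close'[OF that(2)] N by linarith
        qed
        then show "\<exists>N. \<forall>m\<ge>N. \<forall>n\<ge>N. fnorm X (\<lambda>t. s m t - s n t) < e" by blast
      qed
      then show ?thesis using symmetric_space_complete[OF X] by metis
    qed
  qed (auto intro: Z.scale simp: Z.norm_scale Z.norm_nonneg)
  then show ?thesis unfolding projections_bdd_def p_def by blast
qed

text \<open>Square-summability makes the weighted partial sums Cauchy in X. Their norm limit agrees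
  a.e. with w g, which therefore lies in X.\<close>

lemma multiplicator_of_sums:
  assumes A: "rad_sums_bdd X w"
  shows "w \<in> funs (multiplicator X)"
proof -
  have "(\<lambda>t. w t * g t) \<in> funs X" if g: "g \<in> rademacher_sums" for g
  proof -
    have gm [measurable]: "g \<in> borel_measurable leb01" using g by (simp add: rademacher_sums_def)
    obtain a where a: "a \<in> l2_seqs" "AE t in leb01. (\<lambda>n. rad_sum a {1..n} t) \<longlonglongrightarrow> g t"
      using g by (rule rademacher_sums_l2)
    obtain h where h: "h \<in> funs X" "(\<lambda>n. fnorm X (\<lambda>t. rad_sum a {1..n} t * w t - h t)) \<longlonglongrightarrow> 0"
      using symmetric_space_complete[OF X rad_sums_cauchy[OF A a(1)]] by blast
    have m: "(\<lambda>t. w t * g t) \<in> borel_measurable leb01" by measurable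
    have "AE t in leb01. (\<lambda>n. rad_sum a {1..n} t * w t) \<longlonglongrightarrow> w t * g t"
      using a(2) by eventually_elim (subst mult.commute, intro tendsto_intros)
    from limit_unique[OF rad_sum_mem h m this] show ?thesis by (rule Z.norm_cong_AE(1)[OF h(1) m])
  qed
  then show ?thesis by (auto simp: multiplicator_def)
qed

text \<open>Membership in the dual is integrability against every x, so here Fatou's lemma along the
  partial sums does the work of a norm limit.\<close>

lemma multiplicator_dual_of_sums:
  assumes B: "rad_sums_bdd (kothe_dual X) (\<lambda>t. 1 / w t)"
  shows "(\<lambda>t. 1 / w t) \<in> funs (multiplicator (kothe_dual X))"
proof -
  obtain C where C: "C \<ge> 0"
    and R: "\<And>a n. fnorm (kothe_dual X) (\<lambda>t. rad_sum a {1..n} t * (1 / w t)) \<le> C * L2_set a {1..n}"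
    using B by (auto simp: rad_sums_bdd_def)
  have "(\<lambda>t. 1 / w t * g t) \<in> funs (kothe_dual X)" if g: "g \<in> rademacher_sums" for g
    unfolding kothe_dual_mem
  proof (intro conjI ballI)
    have gm [measurable]: "g \<in> borel_measurable leb01" using g by (simp add: rademacher_sums_def)
    show "(\<lambda>t. 1 / w t * g t) \<in> borel_measurable leb01" by measurable
    obtain a where a: "a \<in> l2_seqs" "AE t in leb01. (\<lambda>n. rad_sum a {1..n} t) \<longlonglongrightarrow> g t"
      using g by (rule rademacher_sums_l2)
    fix x assume x: "x \<in> funs X"
    have [measurable]: "x \<in> borel_measurable leb01" by (rule Z.meas[OF x])
    have "(\<integral>\<^sup>+t. ennreal \<bar>x t * (1 / w t * g t)\<bar> \<partial>leb01) \<le> ennreal (fnorm X x * (C * l2_norm a))"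
    proof (rule nn_integral_limit_le)
      show "AE t in leb01. (\<lambda>n. ennreal \<bar>x t * (rad_sum a {1..n} t * (1 / w t))\<bar>) \<longlonglongrightarrow> ennreal \<bar>x t * (1 / w t * g t)\<bar>"
        using a(2)
      proof eventually_elim
        case (elim t)
        have "(\<lambda>n. x t * (rad_sum a {1..n} t * (1 / w t))) \<longlonglongrightarrow> x t * (g t * (1 / w t))"
          by (intro tendsto_mult tendsto_const elim)
        then show ?case by (intro tendsto_ennrealI tendsto_rabs) (simp only: mult.commute)
      qed
      fix n
      have "(\<integral>\<^sup>+t. ennreal \<bar>x t * (rad_sum a {1..n} t * (1 / w t))\<bar> \<partial>leb01)
        \<le> ennreal (fnorm X x * fnorm (kothe_dual X) (\<lambda>t. rad_sum a {1..n} t * (1 / w t)))"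
        by (rule Holder_nn[OF x flipped.rad_sum_mem])
      also have "\<dots> \<le> ennreal (fnorm X x * (C * l2_norm a))"
        by (intro ennreal_leI mult_left_mono order_trans[OF R] L2_set_le_l2_norm a C Z.norm_nonneg x)
      finally show "(\<integral>\<^sup>+t. ennreal \<bar>x t * (rad_sum a {1..n} t * (1 / w t))\<bar> \<partial>leb01) \<le> ennreal (fnorm X x * (C * l2_norm a))" .
    qed measurable
    from le_less_trans[OF this ennreal_less_top]
    show "integrable leb01 (\<lambda>t. x t * (1 / w t * g t))" by (intro integrable_of_nn_integral_abs) auto
  qed
  then show ?thesis by (auto simp: multiplicator_def)
qed

end

section \<open>Embeddings between G, its dual and the symmetric space\<close>

lemma Linfty_subset: "sym_space E \<Longrightarrow> Linfty \<subseteq> funs E"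
  by (auto simp: Linfty_def intro: sym_space.bounded_mem)

text \<open>Common to both embeddings: a function of small Luxemburg norm has a small multiple of
  log^(1/2)(e/t) as majorant of its rearrangement, and this turns into a small pairing with
  y.\<close>

lemma (in dual_pair) rearr_L_half_bound:
  assumes f: "f \<in> borel_measurable leb01" and c: "c \<ge> 0"
    and le: "\<And>t. 0 < t \<Longrightarrow> t \<le> 1 \<Longrightarrow> rearr f t \<le> c * L_half t"
    and y: "y \<in> funs Y" and C: "C \<ge> 0" "(\<integral>\<^sup>+t. ennreal (L_half t * rearr y t) \<partial>leb01) \<le> ennreal (C * fnorm Y y)"
  shows "(\<integral>\<^sup>+t. ennreal \<bar>f t * y t\<bar> \<partial>leb01) \<le> ennreal (c * (C * fnorm Y y))"
proof -
  note ym = Y.meas[OF y]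
  note [measurable] = rearr_measurable[OF ym]
  have "(\<integral>\<^sup>+t. ennreal \<bar>f t * y t\<bar> \<partial>leb01) \<le> (\<integral>\<^sup>+t. ennreal (rearr f t * rearr y t) \<partial>leb01)"
    by (rule Hardy_Littlewood[OF f ym])
  also have "\<dots> \<le> (\<integral>\<^sup>+t. ennreal c * ennreal (L_half t * rearr y t) \<partial>leb01)"
  proof (rule nn_integral_mono_AE)
    show "AE t in leb01. ennreal (rearr f t * rearr y t) \<le> ennreal c * ennreal (L_half t * rearr y t)"
      using AE_leb01_pos
    proof eventually_elim
      case (elim t)
      have "rearr f t * rearr y t \<le> (c * L_half t) * rearr y t"
        using elim by (intro mult_right_mono le rearr_nonneg[OF ym]) auto
      then have "ennreal (rearr f t * rearr y t) \<le> ennreal (c * (L_half t * rearr y t))"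
        by (intro ennreal_leI) (simp only: mult.assoc)
      also have "\<dots> = ennreal c * ennreal (L_half t * rearr y t)" by (rule ennreal_mult'[OF c])
      finally show ?case .
    qed
  qed
  also have "\<dots> = ennreal c * (\<integral>\<^sup>+t. ennreal (L_half t * rearr y t) \<partial>leb01)"
    by (rule nn_integral_cmult) measurable
  also have "\<dots> \<le> ennreal c * ennreal (C * fnorm Y y)" by (intro mult_left_mono C) simp
  also have "\<dots> = ennreal (c * (C * fnorm Y y))" by (rule ennreal_mult'[OF c, symmetric])
  finally show ?thesis .
qed

text \<open>A bound on all pairings would stop in the bidual. Instead f is approximated by bounded
  h_n uniformly over all pairings; by \<open>norming\<close> the h_n are Cauchy in X, and pairing
  with 1 identifies their limit with f.\<close>

lemma G_subset_symmetric:
  assumes X: "symmetric_space X" and pair: "dual_pair X Y"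
    and orl: "orlicz_function N2" "orlicz_equivalent N2 (\<lambda>t. exp (t\<^sup>2) - 1)"
    and L: "\<exists>C\<ge>0. \<forall>y\<in>funs Y. (\<integral>\<^sup>+t. ennreal (L_half t * rearr y t) \<partial>leb01) \<le> ennreal (C * fnorm Y y)"
  shows "funs (G_space N2) \<subseteq> funs X"
proof
  interpret dual_pair X Y by (rule pair)
  fix f assume f: "f \<in> funs (G_space N2)"
  have fm [measurable]: "f \<in> borel_measurable leb01"
    using f by (simp add: G_space_def closure_in_def orlicz_space_def)
  obtain C where C: "C \<ge> 0" "\<And>y. y \<in> funs Y \<Longrightarrow> (\<integral>\<^sup>+t. ennreal (L_half t * rearr y t) \<partial>leb01) \<le> ennreal (C * fnorm Y y)"
    using L by blast
  obtain K where K: "K > 0" and rr: "\<And>g l t. l > 0 \<Longrightarrow> g \<in> borel_measurable leb01 \<Longrightarrow>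
      (\<integral>\<^sup>+t. ennreal (N2 (\<bar>g t\<bar> / l)) \<partial>leb01) \<le> 1 \<Longrightarrow> 0 < t \<Longrightarrow> t \<le> 1 \<Longrightarrow> rearr g t \<le> K * l * L_half t"
    using orlicz_rearr[OF orl] by blast
  have "\<exists>h\<in>Linfty. \<forall>y\<in>funs Y. (\<integral>\<^sup>+t. ennreal \<bar>(f t - h t) * y t\<bar> \<partial>leb01) \<le> ennreal (e * fnorm Y y)" if e: "e > 0" for e
  proof -
    \<comment> \<open>A scale l below this value gives K l C \<le> e, the constant wanted in the
      pairing; C + 1 keeps the quotient defined when C is 0.\<close>
    have "0 < e / (K * (C + 1))" using e K C by simp
    from G_space_approx[OF orl f this] obtain h l where h: "h \<in> Linfty" and l: "0 < l" "l < e / (K * (C + 1))"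
      and N: "(\<integral>\<^sup>+t. ennreal (N2 (\<bar>f t - h t\<bar> / l)) \<partial>leb01) \<le> 1" by blast
    have hm [measurable]: "h \<in> borel_measurable leb01" using h by (simp add: Linfty_def)
    have dm: "(\<lambda>t. f t - h t) \<in> borel_measurable leb01" by measurable
    have "(\<integral>\<^sup>+t. ennreal \<bar>(f t - h t) * y t\<bar> \<partial>leb01) \<le> ennreal (e * fnorm Y y)" if y: "y \<in> funs Y" for y
    proof -
      have "(\<integral>\<^sup>+t. ennreal \<bar>(f t - h t) * y t\<bar> \<partial>leb01) \<le> ennreal (K * l * (C * fnorm Y y))"
        using K l by (intro rearr_L_half_bound[OF dm _ rr[OF l(1) dm N] y C(1) C(2)[OF y]]) auto
      also have "\<dots> \<le> ennreal (e * fnorm Y y)"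
      proof (rule ennreal_leI)
        have "K * l * C \<le> K * (e / (K * (C + 1))) * C" using K l C(1) by (intro mult_right_mono mult_left_mono) auto
        also have "\<dots> = e * (C / (C + 1))" using K by simp
        also have "\<dots> \<le> e * 1" using C(1) e by (intro mult_left_mono) auto
        also have "\<dots> = e" by simp
        finally show "K * l * (C * fnorm Y y) \<le> e * fnorm Y y"
          using mult_right_mono[OF _ Y.norm_nonneg[OF y]] by (simp only: mult.assoc[symmetric])
      qed
      finally show ?thesis .
    qed
    then show ?thesis using h by blast
  qed
  then have "\<forall>n. \<exists>h. h \<in> Linfty \<and> (\<forall>y\<in>funs Y. (\<integral>\<^sup>+t. ennreal \<bar>(f t - h t) * y t\<bar> \<partial>leb01) \<le> ennreal (1 / real (Suc n) * fnorm Y y))"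
    by (metis of_nat_0_less_iff zero_less_Suc zero_less_divide_1_iff)
  from choice[OF this] obtain h where h: "\<And>n. h n \<in> Linfty"
    and fh: "\<And>n y. y \<in> funs Y \<Longrightarrow> (\<integral>\<^sup>+t. ennreal \<bar>(f t - h n t) * y t\<bar> \<partial>leb01) \<le> ennreal (1 / real (Suc n) * fnorm Y y)"
    by blast
  have hX: "h n \<in> funs X" for n using Linfty_subset[OF symmetric_space_sym[OF X]] h by blast
  have hm [measurable]: "h n \<in> borel_measurable leb01" for n by (rule Z.meas[OF hX])
  have diff_norm: "fnorm X (\<lambda>t. h m t - h n t) \<le> 1 / real (Suc m) + 1 / real (Suc n)" for m n
  proof (rule norming[OF Z.diff(1)[OF hX hX]])
    fix y assume y: "y \<in> funs Y" "fnorm Y y \<le> 1"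
    have [measurable]: "y \<in> borel_measurable leb01" by (rule Y.meas[OF y(1)])
    have int: "integrable leb01 (\<lambda>t. (h m t - h n t) * y t)" by (rule integrable_mult[OF Z.diff(1)[OF hX hX] y(1)])
    have "ennreal (LINT t|leb01. \<bar>(h m t - h n t) * y t\<bar>) = (\<integral>\<^sup>+t. ennreal \<bar>(h m t - h n t) * y t\<bar> \<partial>leb01)"
      by (rule nn_integral_eq_integral[symmetric]) (use int in auto)
    also have "\<dots> \<le> (\<integral>\<^sup>+t. ennreal \<bar>(f t - h m t) * y t\<bar> + ennreal \<bar>(f t - h n t) * y t\<bar> \<partial>leb01)"
    proof (rule nn_integral_mono)
      fix t
      have "\<bar>(h m t - h n t) * y t\<bar> \<le> \<bar>(f t - h m t) * y t\<bar> + \<bar>(f t - h n t) * y t\<bar>"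
        unfolding abs_mult distrib_right[symmetric] by (intro mult_right_mono) auto
      then show "ennreal \<bar>(h m t - h n t) * y t\<bar> \<le> ennreal \<bar>(f t - h m t) * y t\<bar> + ennreal \<bar>(f t - h n t) * y t\<bar>"
        by (simp add: ennreal_leI flip: ennreal_plus)
    qed
    also have "\<dots> = (\<integral>\<^sup>+t. ennreal \<bar>(f t - h m t) * y t\<bar> \<partial>leb01) + (\<integral>\<^sup>+t. ennreal \<bar>(f t - h n t) * y t\<bar> \<partial>leb01)"
      by (rule nn_integral_add) measurable
    also have "\<dots> \<le> ennreal (1 / real (Suc m) * fnorm Y y) + ennreal (1 / real (Suc n) * fnorm Y y)"
      by (intro add_mono fh y)
    also have "\<dots> \<le> ennreal (1 / real (Suc m) * 1) + ennreal (1 / real (Suc n) * 1)"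
      by (intro add_mono ennreal_leI mult_left_mono y) auto
    also have "\<dots> = ennreal (1 / real (Suc m) + 1 / real (Suc n))" by (subst ennreal_plus) auto
    finally have "(LINT t|leb01. \<bar>(h m t - h n t) * y t\<bar>) \<le> 1 / real (Suc m) + 1 / real (Suc n)"
      by (subst (asm) ennreal_le_iff) auto
    then show "\<bar>LINT t|leb01. (h m t - h n t) * y t\<bar> \<le> 1 / real (Suc m) + 1 / real (Suc n)"
      using integral_abs_bound[of leb01 "\<lambda>t. (h m t - h n t) * y t"] by linarith
  qed
  have "cauchy_in X h"
    unfolding cauchy_in_def
  proof (intro conjI allI impI hX)
    fix e :: real assume e: "e > 0"
    obtain N where N: "1 / real (Suc N) < e / 2" using nat_approx_posE[of "e / 2"] e by auto
    have "fnorm X (\<lambda>t. h m t - h n t) < e" if "N \<le> m" "N \<le> n" for m n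
    proof -
      have "1 / real (Suc m) \<le> 1 / real (Suc N)" "1 / real (Suc n) \<le> 1 / real (Suc N)"
        using that by (auto intro!: divide_left_mono)
      then show ?thesis using diff_norm[of m n] N by linarith
    qed
    then show "\<exists>N. \<forall>m\<ge>N. \<forall>n\<ge>N. fnorm X (\<lambda>t. h m t - h n t) < e" by blast
  qed
  then obtain g where g: "g \<in> funs X" "(\<lambda>n. fnorm X (\<lambda>t. h n t - g t)) \<longlonglongrightarrow> 0"
    by (rule symmetric_space_complete[OF X])
  have [measurable]: "g \<in> borel_measurable leb01" by (rule Z.meas[OF g(1)])
  have "(\<integral>\<^sup>+t. ennreal \<bar>f t - g t\<bar> \<partial>leb01) \<le> 0"
  proof (rule LIMSEQ_le_const)
    let ?b = "\<lambda>n. ennreal (1 / real (Suc n) * fnorm Y (\<lambda>t. 1) + fnorm X (\<lambda>t. h n t - g t) * fnorm Y (\<lambda>t. 1))"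
    have "(\<lambda>n. 1 / real (Suc n) * fnorm Y (\<lambda>t. 1) + fnorm X (\<lambda>t. h n t - g t) * fnorm Y (\<lambda>t. 1))
        \<longlonglongrightarrow> 0 * fnorm Y (\<lambda>t. 1) + 0 * fnorm Y (\<lambda>t. 1)"
      by (intro tendsto_intros g(2) LIMSEQ_Suc[OF lim_const_over_n])
    from tendsto_ennrealI[OF this] show "?b \<longlonglongrightarrow> 0" by simp
    have "(\<integral>\<^sup>+t. ennreal \<bar>f t - g t\<bar> \<partial>leb01) \<le> ?b n" for n
    proof -
      have "(\<integral>\<^sup>+t. ennreal \<bar>f t - g t\<bar> \<partial>leb01)
        \<le> (\<integral>\<^sup>+t. ennreal \<bar>(f t - h n t) * 1\<bar> + ennreal \<bar>(h n t - g t) * 1\<bar> \<partial>leb01)"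
        by (intro nn_integral_mono) (auto intro!: ennreal_leI simp flip: ennreal_plus)
      also have "\<dots> = (\<integral>\<^sup>+t. ennreal \<bar>(f t - h n t) * 1\<bar> \<partial>leb01) + (\<integral>\<^sup>+t. ennreal \<bar>(h n t - g t) * 1\<bar> \<partial>leb01)"
        by (rule nn_integral_add) measurable
      also have "\<dots> \<le> ennreal (1 / real (Suc n) * fnorm Y (\<lambda>t. 1)) + ennreal (fnorm X (\<lambda>t. h n t - g t) * fnorm Y (\<lambda>t. 1))"
        by (intro add_mono fh Holder_nn Z.diff(1) hX g(1) Y.one)
      also have "\<dots> = ?b n"
        by (rule ennreal_plus[symmetric]) (auto intro!: mult_nonneg_nonneg divide_nonneg_nonneg Y.norm_nonneg Y.one Z.norm_nonneg Z.diff(1) hX g(1))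
      finally show ?thesis .
    qed
    then show "\<exists>N. \<forall>n\<ge>N. (\<integral>\<^sup>+t. ennreal \<bar>f t - g t\<bar> \<partial>leb01) \<le> ?b n" by blast
  qed
  then have "(\<integral>\<^sup>+t. ennreal \<bar>f t - g t\<bar> \<partial>leb01) = 0" by simp
  then have "AE t in leb01. ennreal \<bar>f t - g t\<bar> = 0"
    by (subst (asm) nn_integral_0_iff_AE) measurable
  then have "AE t in leb01. f t = g t" by (auto elim!: eventually_mono)
  then show "f \<in> funs X" by (rule Z.norm_cong_AE(1)[OF g(1) fm])
qed

text \<open>Write f as (f - h) + h with h bounded. The product of y with f - h is integrable by the
  logarithmic bound, the product with h because bounded functions lie in \<open>Z\<close>.\<close>

lemma symmetric_subset_G_dual:
  assumes pair: "dual_pair Z Y"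
    and orl: "orlicz_function N2" "orlicz_equivalent N2 (\<lambda>t. exp (t\<^sup>2) - 1)"
    and L: "\<exists>C\<ge>0. \<forall>y\<in>funs Y. (\<integral>\<^sup>+t. ennreal (L_half t * rearr y t) \<partial>leb01) \<le> ennreal (C * fnorm Y y)"
  shows "funs Y \<subseteq> funs (kothe_dual (G_space N2))"
proof
  interpret dual_pair Z Y by (rule pair)
  fix y assume y: "y \<in> funs Y"
  have [measurable]: "y \<in> borel_measurable leb01" by (rule Y.meas[OF y])
  show "y \<in> funs (kothe_dual (G_space N2))"
    unfolding kothe_dual_mem
  proof (intro conjI ballI)
    show "y \<in> borel_measurable leb01" by measurable
    fix f assume f: "f \<in> funs (G_space N2)"
    have fm [measurable]: "f \<in> borel_measurable leb01"
      using f by (simp add: G_space_def closure_in_def orlicz_space_def)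
    obtain C where C: "C \<ge> 0" "(\<integral>\<^sup>+t. ennreal (L_half t * rearr y t) \<partial>leb01) \<le> ennreal (C * fnorm Y y)"
      using L y by blast
    obtain K where K: "K > 0" and rr: "\<And>g l t. l > 0 \<Longrightarrow> g \<in> borel_measurable leb01 \<Longrightarrow>
        (\<integral>\<^sup>+t. ennreal (N2 (\<bar>g t\<bar> / l)) \<partial>leb01) \<le> 1 \<Longrightarrow> 0 < t \<Longrightarrow> t \<le> 1 \<Longrightarrow> rearr g t \<le> K * l * L_half t"
      using orlicz_rearr[OF orl] by blast
    obtain h l where h: "h \<in> Linfty" and l: "0 < l"
      and N: "(\<integral>\<^sup>+t. ennreal (N2 (\<bar>f t - h t\<bar> / l)) \<partial>leb01) \<le> 1"
      using G_space_approx[OF orl f zero_less_one] by blast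
    have hm [measurable]: "h \<in> borel_measurable leb01" using h by (simp add: Linfty_def)
    have dm: "(\<lambda>t. f t - h t) \<in> borel_measurable leb01" by measurable
    have "(\<integral>\<^sup>+t. ennreal \<bar>(f t - h t) * y t\<bar> \<partial>leb01) \<le> ennreal (K * l * (C * fnorm Y y))"
      using K l by (intro rearr_L_half_bound[OF dm _ rr[OF l dm N] y C]) auto
    from le_less_trans[OF this ennreal_less_top] have "integrable leb01 (\<lambda>t. (f t - h t) * y t)"
      by (intro integrable_of_nn_integral_abs) auto
    moreover have "integrable leb01 (\<lambda>t. h t * y t)"
      using Linfty_subset[OF Z.sym_space_axioms] h y by (intro integrable_mult) auto
    ultimately have "integrable leb01 (\<lambda>t. (f t - h t) * y t + h t * y t)"
      by (rule Bochner_Integration.integrable_add)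
    then show "integrable leb01 (\<lambda>t. f t * y t)" by (simp add: left_diff_distrib)
  qed
qed

theorem theorem4p1:
  fixes X :: fspace and w N2 :: "real \<Rightarrow> real"
  assumes "symmetric_space X"
    and "isometric_in_bidual X"
    and "orlicz_function N2"
    and "orlicz_equivalent N2 (\<lambda>t. exp (t\<^sup>2) - 1)"
    and "w \<in> borel_measurable leb01"
    and "AE t in leb01. w t > 0"
    and "Linfty \<subseteq> funs (weighted X w)"
    and "funs (weighted X w) \<subseteq> L1"
  shows "(rad_projection_bounded (weighted X w) \<longleftrightarrow>
           funs (G_space N2) \<subseteq> funs X \<and> funs X \<subseteq> funs (kothe_dual (G_space N2)) \<and>
           w \<in> funs (multiplicator X) \<and>
           (\<lambda>t. 1 / w t) \<in> funs (multiplicator (kothe_dual X)))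
       \<and> ((\<lambda>t. rearr w t * sqrt (ln (exp 1 / t))) \<in> funs (kothe_dual (kothe_dual X)) \<and>
          (\<lambda>t. rearr (\<lambda>s. 1 / w s) t * sqrt (ln (exp 1 / t))) \<in> funs (kothe_dual X)
          \<longrightarrow> rad_projection_bounded (weighted X w))"
proof -
  note X = assms(1) and orl = assms(3,4)
  let ?Y = "kothe_dual X" and ?iw = "\<lambda>t. 1 / w t"
  have wp: "weighted_pair X ?Y w" by (rule weighted_pair_kothe[OF assms(1,2,5-8)])
  interpret weighted_pair X ?Y w by (rule wp)
  interpret F: weighted_pair ?Y X ?iw by (rule flip_weighted)
  show ?thesis
  proof (intro conjI iffI impI)
    assume "rad_projection_bounded (weighted X w)"
    then have P: "projections_bdd X w" by (rule projections_bdd_of_bounded[OF X wp])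
    note A = rad_sums_bdd_of_projections[OF P]
      and B = F.rad_sums_bdd_of_projections[OF projections_bdd_dual[OF P]]
    show "funs (G_space N2) \<subseteq> funs X"
      by (rule G_subset_symmetric[OF X dual_pair_axioms orl L_half_rearr_le[OF A]])
    \<comment> \<open>The roles of X and its dual are exchanged: the dual estimate makes the
      logarithmic bound hold for the elements of X itself.\<close>
    show "funs X \<subseteq> funs (kothe_dual (G_space N2))"
      by (rule symmetric_subset_G_dual[OF F.dual_pair_axioms orl F.L_half_rearr_le[OF B]])
    show "w \<in> funs (multiplicator X)" by (rule multiplicator_of_sums[OF X wp A])
    show "?iw \<in> funs (multiplicator ?Y)" by (rule multiplicator_dual_of_sums[OF X wp B])
  next
    assume "funs (G_space N2) \<subseteq> funs X \<and> funs X \<subseteq> funs (kothe_dual (G_space N2)) \<and>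
      w \<in> funs (multiplicator X) \<and> ?iw \<in> funs (multiplicator ?Y)"
    then have GX: "funs (G_space N2) \<subseteq> funs X" and XG: "funs X \<subseteq> funs (kothe_dual (G_space N2))"
      and wM: "w \<in> funs (multiplicator X)" and iM: "?iw \<in> funs (multiplicator ?Y)" by auto
    \<comment> \<open>A series with square-summable coefficients lies in G and hence in X, so it is
      an admissible test function in the multiplicator condition on w.\<close>
    have "(\<lambda>t. rad_series a t * w t) \<in> funs X" if a: "a \<in> l2_seqs" for a
      using wM GX rad_series_G[OF orl a] rad_series_rademacher_sums[OF a]
      by (auto simp: multiplicator_def mult.commute)
    moreover have "(\<lambda>t. rad_series a t * ?iw t) \<in> funs ?Y" if a: "a \<in> l2_seqs" for a
    proof -
      \<comment> \<open>The inclusion of X in the dual of G, read from the other side: elements of G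
        are integrable against all of X, so the series lies in the dual of X.\<close>
      have "rad_series a \<in> funs ?Y"
        unfolding kothe_dual_mem
      proof (intro conjI ballI)
        fix x assume "x \<in> funs X"
        then have "integrable leb01 (\<lambda>t. rad_series a t * x t)"
          using XG rad_series_G[OF orl a] by (auto simp: kothe_dual_mem)
        then show "integrable leb01 (\<lambda>t. x t * rad_series a t)" by (simp only: mult.commute)
      qed simp
      then have "(\<lambda>t. ?iw t * rad_series a t) \<in> funs ?Y"
        using iM rad_series_rademacher_sums[OF a] unfolding multiplicator_def fspace.simps by blast
      then show ?thesis by (simp only: mult.commute)
    qed
    ultimately show "rad_projection_bounded (weighted X w)"
      by (intro rad_projection_bounded_of_sums[OF X wp] rad_sums_bdd_of_series_mem F.rad_sums_bdd_of_series_mem)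
  next
    assume "(\<lambda>t. rearr w t * L_half t) \<in> funs (kothe_dual ?Y) \<and> (\<lambda>t. rearr ?iw t * L_half t) \<in> funs ?Y"
    then have Lw: "(\<lambda>t. rearr w t * L_half t) \<in> funs (kothe_dual ?Y)" and Li: "(\<lambda>t. rearr ?iw t * L_half t) \<in> funs ?Y"
      by auto
    have nn: "ennreal (L_half t * rearr u t * rearr y t) = ennreal \<bar>rearr y t * (rearr u t * L_half t)\<bar>"
      if "0 < t \<and> t \<le> 1" "u \<in> borel_measurable leb01" "y \<in> borel_measurable leb01" for t u y
    proof -
      have "0 \<le> L_half t" using that(1) L_half_ge_1[of t] by linarith
      then have "0 \<le> rearr y t * (rearr u t * L_half t)"
        using that by (intro mult_nonneg_nonneg rearr_nonneg) auto
      then show ?thesis by (simp add: mult_ac)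
    qed
    note absY = Z.kothe_dual_absorbs[OF symmetric_space_absorbs[OF X]]
    have A: "rad_sums_bdd X w"
    proof (rule rad_sums_bdd_of_L_half)
      let ?N = "fnorm (kothe_dual ?Y) (\<lambda>t. rearr w t * L_half t)"
      show N: "0 \<le> ?N" by (rule Y.kothe_norm_nonneg[OF absY Lw])
      fix y assume y: "y \<in> funs ?Y" "fnorm ?Y y \<le> 1"
      have "(\<integral>\<^sup>+t. ennreal (L_half t * rearr w t * rearr y t) \<partial>leb01)
          = (\<integral>\<^sup>+t. ennreal \<bar>rearr y t * (rearr w t * L_half t)\<bar> \<partial>leb01)"
        by (intro nn_integral_cong_AE eventually_mono[OF AE_leb01_pos] nn v_meas Y.meas y)
      \<comment> \<open>Hoelder's inequality between the dual and the bidual, because the majorant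
        of w is only assumed to lie in the bidual.\<close>
      also have "\<dots> \<le> ennreal (fnorm ?Y (rearr y) * ?N)"
        by (rule Y.kothe_Holder_nn[OF absY Lw Y.rearr_mem(1)[OF y(1)]])
      also have "\<dots> \<le> ennreal (1 * ?N)"
        by (intro ennreal_leI mult_right_mono N order_trans[OF Y.rearr_mem(2)] y)
      finally show "(\<integral>\<^sup>+t. ennreal (L_half t * rearr w t * rearr y t) \<partial>leb01) \<le> ennreal ?N" by simp
    qed
    have B: "rad_sums_bdd ?Y ?iw"
    proof (rule F.rad_sums_bdd_of_L_half)
      let ?N = "fnorm ?Y (\<lambda>t. rearr ?iw t * L_half t)"
      show N: "0 \<le> ?N" by (rule Y.norm_nonneg[OF Li])
      fix x assume x: "x \<in> funs X" "fnorm X x \<le> 1"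
      have "(\<integral>\<^sup>+t. ennreal (L_half t * rearr ?iw t * rearr x t) \<partial>leb01)
          = (\<integral>\<^sup>+t. ennreal \<bar>rearr x t * (rearr ?iw t * L_half t)\<bar> \<partial>leb01)"
        by (intro nn_integral_cong_AE eventually_mono[OF AE_leb01_pos] nn F.v_meas Z.meas x)
      also have "\<dots> \<le> ennreal (fnorm X (rearr x) * ?N)"
        by (rule Holder_nn[OF Z.rearr_mem(1)[OF x(1)] Li])
      also have "\<dots> \<le> ennreal (1 * ?N)"
        by (intro ennreal_leI mult_right_mono N order_trans[OF Z.rearr_mem(2)] x)
      finally show "(\<integral>\<^sup>+t. ennreal (L_half t * rearr ?iw t * rearr x t) \<partial>leb01) \<le> ennreal ?N" by simp
    qed
    show "rad_projection_bounded (weighted X w)" by (rule rad_projection_bounded_of_sums[OF X wp A B])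
  qed
qed

end
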